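(* Let $n\ge 2$ and let $(X,w)$ be a tight Euclidean $9$-design on $2$ concentric spheres in $\mathbb R^n$ of positive radii $r_1, r_2$ (so $\boldsymbol 0\notin X$). Write $X=X_1\cup X_2$ with $X_i=X\cap S_i$. Then: (1) $X$ is antipodal, i.e. $-X=X$. (2) For every $\boldsymbol x\in X_1$ and $\boldsymbol y\in X_2$, the number $\frac{\boldsymbol x\cdot\boldsymbol y}{r_1r_2}$ is a zero of the Gegenbauer polynomial $Q_{4,n-1}(x)=\frac{n(n+6)}{24}\big((n+4)(n+2)x^4-6(n+2)x^2+3\big)$. (3) $n=2$, and $(X,w)$ is similar to the following weighted set $(Y,w)$: $Y=Y_1\cup Y_2$ where $Y_1=\{r_1(\cos\tfrac{2k\pi}{8},\sin\tfrac{2k\pi}{8}) : 0\le k\le 7\}$ and $Y_2=\{r_2(\cos\tfrac{(2k+1)\pi}{8},\sin\tfrac{(2k+1)\pi}{8}) : 0\le k\le 7\}$ are regular $8$-gons, with $r_1,r_2$ positive reals, $r_1\neq r_2$, and weight $w(\boldsymbol y)=w_1$ on $Y_1$ and $w(\boldsymbol y)=\frac{r_1^8}{r_2^8}w_1$ on $Y_2$ for some $w_1>0$. In particular, there is no tight Euclidean $9$-design on $2$ concentric spheres of positive radii in $\mathbb R^n$ for $n\ge 3$.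
   Context: A weighted finite set $(X,w)$ in $\mathbb R^n$ is a finite set $X\subset\mathbb R^n$ with a weight $w:X\to\mathbb R_{>0}$. Let $\{r_1,\dots,r_p\}=\{\|\boldsymbol x\|:\boldsymbol x\in X\}$, $S_i$ the sphere of radius $r_i$ centered at the origin, $X_i=X\cap S_i$, $S=S_1\cup\dots\cup S_p$; $X$ is said to be supported by $p$ concentric spheres. $(X,w)$ is a Euclidean $t$-design if $\sum_{i=1}^p\frac{w(X_i)}{|S_i|}\int_{S_i}f(\boldsymbol x)\,d\sigma_i(\boldsymbol x)=\sum_{\boldsymbol x\in X}w(\boldsymbol x)f(\boldsymbol x)$ for every polynomial $f$ of degree at most $t$, where $w(X_i)=\sum_{\boldsymbol x\in X_i}w(\boldsymbol x)$, $\sigma_i$ is surface measure on $S_i$ and $|S_i|$ its area. Let $\mathcal P_4^*(\mathbb R^n)$ be the space of polynomials all of whose terms have degree $4$, $2$ or $0$, and $\mathcal P_4^*(S)$ the space of their restrictions to $S$. Every Euclidean $9$-design supported on $S$ with $\boldsymbol 0\notin X$ satisfies $|X|\ge 2\dim\mathcal P_4^*(S)$; it is called tight if equality holds. For $p=2$ and $\boldsymbol 0\notin X$ this means $|X|=2\big(\binom{n+3}{4}+\binom{n+1}{2}\big)=\frac{n(n+1)(n^2+5n+18)}{12}$. Gegenbauer polynomials $Q_{l,n-1}$ are normalized so that $Q_{l,n-1}(1)$ equals the dimension of the space of homogeneous harmonic polynomials of degree $l$ on $\mathbb R^n$. Two weighted sets are similar if one is obtained from the other by an orthogonal transformation of $\mathbb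 R^n$ (with the weights carried along, up to a common positive scalar). *)

theory Defs
  imports "HOL-Analysis.Analysis"
begin

definition monomial :: "('n::finite \<Rightarrow> nat) \<Rightarrow> real^'n \<Rightarrow> real" where
  "monomial \<alpha> x = (\<Prod>i\<in>UNIV. (x $ i) ^ (\<alpha> i))"

definition mdeg :: "('n::finite \<Rightarrow> nat) \<Rightarrow> nat" where
  "mdeg \<alpha> = (\<Sum>i\<in>UNIV. \<alpha> i)"

definition poly_deg_le :: "nat \<Rightarrow> (real^'n::finite \<Rightarrow> real) \<Rightarrow> bool" where
  "poly_deg_le t f \<longleftrightarrow> (\<exists>A c. finite A \<and> (\<forall>\<alpha>\<in>A. mdeg \<alpha> \<le> t) \<and>
      f = (\<lambda>x. \<Sum>\<alpha>\<in>A. c \<alpha> * monomial \<alpha> x))"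

text \<open>Normalized surface average (1/|S_r|) \<integral>_{S_r} f d\<sigma> over the sphere of radius r
  centred at 0, expressed through the cone measure: the uniform (Lebesgue) measure on
  the unit ball pushed forward by x \<mapsto> x/|x| is the normalized surface measure on
  the unit sphere.\<close>
definition sphere_avg :: "real \<Rightarrow> (real^'n::finite \<Rightarrow> real) \<Rightarrow> real" where
  "sphere_avg r f = integral (ball 0 1) (\<lambda>x. f (r *\<^sub>R (x /\<^sub>R norm x))) / Henstock_Kurzweil_Integration.content (ball (0::real^'n) 1)"

definition layer :: "(real^'n::finite) set \<Rightarrow> real \<Rightarrow> (real^'n) set" where
  "layer X r = {x \<in> X. norm x = r}"

definition euclidean_design :: "nat \<Rightarrow> (real^'n::finite) set \<Rightarrow> (real^'n \<Rightarrow> real) \<Rightarrow> bool" where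
  "euclidean_design t X w \<longleftrightarrow> finite X \<and> (\<forall>x\<in>X. w x > 0) \<and>
     (\<forall>f. poly_deg_le t f \<longrightarrow>
        (\<Sum>r\<in>norm ` X. (\<Sum>x\<in>layer X r. w x) * sphere_avg r f) = (\<Sum>x\<in>X. w x * f x))"

definition gegenbauer4 :: "nat \<Rightarrow> real \<Rightarrow> real" where
  "gegenbauer4 n x = real n * (real n + 6) / 24 *
     ((real n + 4) * (real n + 2) * x ^ 4 - 6 * (real n + 2) * x ^ 2 + 3)"

definition Y1 :: "real \<Rightarrow> (real^2) set" where
  "Y1 r = {r *\<^sub>R vector [cos (2 * real k * pi / 8), sin (2 * real k * pi / 8)] | k::nat. k \<le> 7}"

definition Y2 :: "real \<Rightarrow> (real^2) set" where
  "Y2 r = {r *\<^sub>R vector [cos ((2 * real k + 1) * pi / 8), sin ((2 * real k + 1) * pi / 8)] | k::nat. k \<le> 7}"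

end

(*
  For z in X let K(x,z) be the reproducing kernel of the even polynomials of degree at most 4 on
  the two spheres, in the inner product given by the design.  Exactness in degree 8 makes the matrix
  K, with weights, a symmetric idempotent P on R^X, and tightness says that its rank is |X|/2.
  Exactness in degree 9 gives P l P = 0 for every linear form l.  Hence R^X is the orthogonal sum of
  E = im P and l E for each l without zeros on X, so E is stable under all quotients l'/l and P
  splits along the lines through 0.  On one line this forces antipodality, and otherwise K(x,y) = 0,
  which prescribes the angles inside a sphere (two up to sign) and between the spheres (the zeros of
  the Gegenbauer polynomial).

  Each normalized layer is then a spherical 7-design.  Let b_i in (0, n + 6) be the multiple of the
  share of layer i in the 8th moment normalized by b_1 + b_2 = n + 6; all angles and cardinalities
  are functions of n and b_i.  For n = 2 cardinalities force b_1 = b_2 = 4 and 8 points per circle.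
  For n >= 3, polynomials in the inner product that take integer values on a layer have integer sums
  against each other.  Applied to the zeros of the Gegenbauer polynomial this makes
  6 (n + 1) (n + 2) a square; applied to pairs of odd polynomials it makes the cosines of the
  angles inside the layer with the larger b_i rational and 3 (n + 2) (n + 4) a square.  So
  n + 1 = 6 s^2, n + 2 = t^2, n + 4 = 3 r^2, and the formulas for the angles yield an integer square
  strictly between c^2 and (c + 2)^2 for an explicit integer c; the value (c + 1)^2 fails by parity.
*)
theory Submission
  imports Defs "HOL-Computational_Algebra.Nth_Powers"
begin

text \<open>Both l E and l' E are orthogonal to E, and l E is already the whole complement, so l' E
  lies in l E: this is why l'/l preserves E. The two parts of the kernel scale differently.
  Harmonics of degree 4 extend to both spheres with one common factor \<open>H\<close>, while
  polynomials of degree at most 2 are free on each sphere, with factor \<open>W r\<close>. Hence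
  between the spheres K is a bare multiple of the Gegenbauer polynomial, and inside a sphere the
  zero condition depends on n and on the share b of that sphere alone.

  The plane survives because the count that makes \<open>\<rho>\<close> rational has the factor 4 -
  2 n. For n >= 3 the layer with the larger b is used: there b > 4, which makes both squared cosines
  positive. The squares in the final step come from the quadratic satisfied by these squared
  cosines: its discriminant and its constant term, suitably scaled, are Z^2 = 4 L^2 + R D^2 and M^2
  = L^2 - s^2 D^2 with integers Z, M, L. The number caught between two squares is (4 d M)^2 with d =
  Z - 2 L, and the overview's c is R D^2 - 5 d^2.\<close>

section \<open>Arithmetic\<close>

text \<open>In the application n + 1 = 6 s^2 and n + 2 = t^2, so D = (n - 1) / 2 and R = (n + 4) /
  3, while L = s D (b - 2) / 2. \<open>Z\<close> is a multiple of the difference of the two squared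
  cosines, \<open>M\<close> one of the product of the cosines. With d = Z - 2 L the first equation
  reads d (d + 4 L) = R D^2, which allows L to be eliminated from the second.\<close>

lemma no_integral_shell:
  fixes s t r D R Z L M :: int
  assumes s: "s \<ge> 1" and t: "t^2 = 6 * s^2+1" and R: "R = 2 * s^2+1" and D: "D = 3 * s^2-1"
    and Z: "Z^2 = 4*L^2 + R*D^2" and M: "L^2 = s^2*D^2 + M^2"
    and Z0: "Z \<ge> 0" and M0: "M \<ge> 0" and L: "4*L \<ge> s*D*t^2"
  shows False
proof -
  have s2: "s^2 \<ge> 1" using s by (simp add: one_le_power)
  have D0: "D > 0" using s2 D by linarith
  have R0: "R > 0" using s2 R by linarith
  have t2: "t^2 > 0" using t s2 by linarith
  have Dt: "s*D*t^2 > 0" using s D0 t2 by simp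
  have L0: "L > 0" using L Dt by linarith
  define d where "d = Z - 2*L"
  have dd: "d*(d+4*L) = R*D^2" using Z unfolding d_def by (simp add: algebra_simps power2_eq_square)
  have "R*D^2 > 0" using R0 D0 by simp
  then have "(2*L)^2 < Z^2" using Z by (simp add: power_mult_distrib)
  then have "2*L < Z" using Z0 by (rule power_less_imp_less_base)
  then have d1: "d \<ge> 1" unfolding d_def by simp
  \<comment> \<open>Sharp by one: d >= s would require s^2 t^2 < R D, but these numbers are 6 s^4 +
    s^2 and 6 s^4 + s^2 - 1.\<close>
  have "d < s"
  proof (rule ccontr)
    assume "\<not> d < s"
    then have ds: "d \<ge> s" by simp
    have "s * (s*D*t^2) < s * (s + s*D*t^2)" using s by simp
    also have "\<dots> \<le> d*(d+4*L)"
      using ds L s L0 Dt by (intro mult_mono) auto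
    also have "\<dots> = R*D^2" by (rule dd)
    finally have "s^2*D*t^2 < R*D*D" by (simp add: power2_eq_square mult_ac)
    then have "D*(s^2*t^2) < D*(R*D)" by (simp add: mult_ac)
    then have "s^2*t^2 < R*D" using D0 by simp
    then have "s^2*(6 * s^2+1) < (2 * s^2+1)*(3 * s^2-1)" using t R D by simp
    then show False by (simp add: algebra_simps)
  qed
  then have "d^2 < s^2" using d1 by (intro power_strict_mono) auto
  define Y where "Y = 4*d*M"
  define u where "u = d^2"
  have u1: "u \<ge> 1" "u < s^2" using d1 \<open>d^2 < s^2\<close> unfolding u_def by (auto simp: one_le_power)
  have L4: "4*d*L = R*D^2 - u" using dd unfolding u_def by (simp add: algebra_simps power2_eq_square)
  have "Y^2 = (4*d*L)^2 - 16*u* s^2*D^2"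
    unfolding Y_def u_def using M by (simp add: algebra_simps power_mult_distrib)
  also have "\<dots> = (R*D^2 - u)^2 - 16*u* s^2*D^2" by (simp only: L4)
  \<comment> \<open>The shift 5 u is the one at which the terms in s^2 u D^2 cancel; 8 (R - 2 s^2) =
    8 is what remains.\<close>
  also have "\<dots> = (R*D^2-5*u)^2 + 8*u*D^2 - 24*u^2"
  proof -
    have "R*D^2*8*u - 16*u* s^2*D^2 = 8*u*D^2" unfolding R by (simp add: algebra_simps)
    then show ?thesis by (simp add: power2_eq_square algebra_simps)
  qed
  finally have Y2: "Y^2 = (R*D^2-5*u)^2 + 8*u*D^2 - 24*u^2" .
  have Y0: "Y \<ge> 0" unfolding Y_def using d1 M0 by simp
  have D2: "D \<ge> 2 * s^2" unfolding D using s2 by linarith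
  have DD: "D^2 \<ge> 4 * s^2"
  proof -
    have "D*D \<ge> (2 * s^2)*(2 * s^2)" using D2 s2 by (intro mult_mono) auto
    moreover have "s^2 * s^2 \<ge> s^2*1" using s2 by (intro mult_left_mono) auto
    ultimately show ?thesis by (simp add: power2_eq_square)
  qed
  have DD3: "D^2 > 3*u" using DD u1 by linarith
  have "8*u*(D^2-3*u) > 0" using u1 DD3 by simp
  then have "Y^2 > (R*D^2-5*u)^2" using Y2 by (simp add: algebra_simps power2_eq_square)
  then have Ylow: "Y > R*D^2-5*u" using Y0 by (rule power_less_imp_less_base)
  have RD: "R*D^2 \<ge> 2 * s^2*(4 * s^2)" using DD R s2 by (intro mult_mono) auto
  have "s^2 * s^2 \<ge> s^2*1" using s2 by (intro mult_left_mono) auto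
  then have RDu: "R*D^2-5*u \<ge> 0" using RD u1 by (simp add: power2_eq_square)
  have "(R*D^2-5*u+2)^2 - Y^2 = D^2*(4*R-8*u) + 24*u^2 - 20*u + 4"
    unfolding Y2 by (simp add: algebra_simps power2_eq_square)
  moreover have "D^2*(4*R-8*u) \<ge> 0" using u1 R by (intro mult_nonneg_nonneg) auto
  moreover have "u*u \<ge> u*1" using u1 by (intro mult_left_mono) auto
  then have "u^2 \<ge> u" by (simp add: power2_eq_square)
  ultimately have "Y^2 < (R*D^2-5*u+2)^2" using u1 by linarith
  then have "Y < R*D^2-5*u+2" using RDu by (intro power_less_imp_less_base[of Y 2]) auto
  then have "Y = R*D^2-5*u+1" using Ylow by simp
  then have "(R*D^2-5*u+1)^2 = (R*D^2-5*u)^2 + 8*u*D^2 - 24*u^2" using Y2 by simp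
  then have "2*(R*D^2-5*u) + 1 = 8*u*D^2-24*u^2" by (simp add: power2_eq_square algebra_simps)
  then have "odd (8*u*D^2-24*u^2)" by (metis even_plus_one_iff even_mult_iff even_numeral)
  then show False by simp
qed

lemma square_mod_3: "(e::nat)^2 mod 3 \<noteq> 2"
  using power_mod[of e 3 2]
  by (cases "e mod 3 = 0"; cases "e mod 3 = 1"; cases "e mod 3 = 2"; (simp; presburger)?)

text \<open>Consecutive numbers are coprime, so 2 and 3 each divide exactly one of them and the
  cofactors are squares. Of the four distributions, a = s^2 with a + 1 = 6 t^2 and a = 3 s^2 with a
  + 1 = 2 t^2 would give a square congruent to 2 modulo 3. Case B is later excluded in the same way
  through n + 4.\<close>

lemma six_times_square_cases:
  fixes a j :: nat
  assumes "a * (a+1) = 6 * j^2" and a: "a > 0"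
  obtains (A) s t where "a = 6 * s^2" "a+1 = t^2" | (B) s t where "a = 2 * s^2" "a+1 = 3*t^2"
proof -
  have sq: "\<exists>s t. p = s^2 \<and> q = t^2" if "coprime p q" "p*q = j^2" "p > 0" "q > 0" for p q :: nat
    using is_nth_power_mult_coprime_natD[OF that(1), of 2] that unfolding is_nth_power_def by (metis)
  have cop: "coprime a (a+1)" by simp
  have d6: "6 dvd a*(a+1)" using assms by simp
  have "2 dvd a*(a+1)" "3 dvd a*(a+1)" using d6 by (auto intro: dvd_trans[rotated])
  then have "2 dvd a \<or> 2 dvd a+1" and "3 dvd a \<or> 3 dvd a+1"
    using prime_dvd_mult_iff[of "2::nat" a "a+1"] prime_dvd_mult_iff[of "3::nat" a "a+1"] by auto
  then have "6 dvd a \<or> 6 dvd a+1 \<or> 2 dvd a \<and> 3 dvd a+1 \<or> 3 dvd a \<and> 2 dvd a+1"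
    by presburger
  then consider "6 dvd a" | "6 dvd a+1" | "2 dvd a" "3 dvd a+1" | "3 dvd a" "2 dvd a+1"
    by blast
  then show thesis
  proof cases
    case 1
    then obtain p where p: "a = 6*p" by (auto elim: dvdE)
    have "coprime p (a+1)" using cop p by (metis coprime_mult_left_iff)
    moreover have "p*(a+1) = j^2" using assms(1) p by simp
    ultimately obtain s t where "p = s^2" "a+1 = t^2" using sq[of p "a+1"] a p by auto
    then show ?thesis using p by (intro A) auto
  next
    case 2
    then obtain p where p: "a+1 = 6*p" by (auto elim: dvdE)
    have "coprime a p" using cop p by (metis coprime_mult_right_iff)
    moreover have "a*p = j^2" using assms(1) unfolding p by simp
    ultimately obtain s t where st: "a = s^2" "p = t^2" using sq[of a p] a p by auto
    have "s^2 mod 3 \<noteq> 2" by (rule square_mod_3)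
    moreover have "s^2 mod 3 = 2" using p st by presburger
    ultimately show ?thesis by simp
  next
    case 3
    then obtain p q where p: "a = 2*p" "a+1 = 3*q" by (metis dvdE)
    have "coprime p q" using cop unfolding p(2) unfolding p(1)
        by (metis coprime_mult_left_iff coprime_mult_right_iff)
    moreover have "p*q = j^2" using assms(1) unfolding p(2) unfolding p(1) by simp
    ultimately obtain s t where "p = s^2" "q = t^2" using sq[of p q] a p by auto
    then show ?thesis using p by (intro B) auto
  next
    case 4
    then obtain p q where p: "a = 3*p" "a+1 = 2*q" by (metis dvdE)
    have "coprime p q" using cop unfolding p(2) unfolding p(1)
        by (metis coprime_mult_left_iff coprime_mult_right_iff)
    moreover have "p*q = j^2" using assms(1) unfolding p(2) unfolding p(1) by simp
    ultimately obtain s t where st: "p = s^2" "q = t^2" using sq[of p q] a p by auto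
    have "t^2 mod 3 \<noteq> 2" by (rule square_mod_3)
    moreover have "t^2 mod 3 = 2" using p st by presburger
    ultimately show ?thesis by simp
  qed
qed

section \<open>Idempotent kernels\<close>

text \<open>The basis spans the family and also consists of combinations of it. Identities for
  \<open>v\<close> can thus be transferred to \<open>e\<close>, and the number \<open>m\<close> can
  serve as a trace.\<close>

lemma gram_schmidt:
  fixes v :: "'b \<Rightarrow> 'a \<Rightarrow> real" and q :: "'a \<Rightarrow> real"
  assumes "finite Z" "finite X" and q: "\<And>x. x \<in> X \<Longrightarrow> q x > 0"
  shows "\<exists>(m::nat) e. (\<forall>i<m. \<forall>j<m. (\<Sum>x\<in>X. q x * e i x * e j x) = (if i = j then 1 else 0)) \<and>
     (\<forall>z\<in>Z. \<exists>c. \<forall>x\<in>X. v z x = (\<Sum>i<m. c i * e i x)) \<and>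
     (\<forall>i<m. \<exists>c. \<forall>x\<in>X. e i x = (\<Sum>z\<in>Z. c z * v z x))"
  using assms(1)
proof (induction Z rule: finite_induct)
  case empty
  show ?case by (intro exI[of _ 0]) auto
next
  case (insert z Z)
  from insert.IH show ?case
  proof (elim exE conjE)
    fix m :: nat and e :: "nat \<Rightarrow> 'a \<Rightarrow> real"
    assume o: "\<forall>i<m. \<forall>j<m. (\<Sum>x\<in>X. q x * e i x * e j x) = (if i = j then 1 else 0)"
      and sp: "\<forall>z\<in>Z. \<exists>c. \<forall>x\<in>X. v z x = (\<Sum>i<m. c i * e i x)"
      and inn: "\<forall>i<m. \<exists>c. \<forall>x\<in>X. e i x = (\<Sum>z\<in>Z. c z * v z x)"
    have on: "(\<Sum>x\<in>X. q x * e i x * e j x) = (if i = j then 1 else 0)" if "i < m" "j < m" for i j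
      using o that by blast
    define a where "a i = (\<Sum>x\<in>X. q x * e i x * v z x)" for i
    define h where "h x = v z x - (\<Sum>i<m. a i * e i x)" for x
    from inn obtain C where C: "\<And>i x. i < m \<Longrightarrow> x \<in> X \<Longrightarrow> e i x = (\<Sum>z\<in>Z. C i z * v z x)" by metis
    have inn': "\<exists>c. \<forall>x\<in>X. e i x = (\<Sum>z\<in>insert z Z. c z * v z x)" if "i < m" for i
    proof -
      have "\<forall>x\<in>X. e i x = (\<Sum>y\<in>insert z Z. (if y = z then 0 else C i y) * v y x)"
        using C[OF that] insert.hyps by (auto intro!: sum.cong)
      then show ?thesis by (rule exI[where x = "\<lambda>y. if y = z then 0 else C i y"])
    qed
    show ?case
    proof (cases "\<forall>x\<in>X. h x = 0")
      case True
      then have "\<forall>x\<in>X. v z x = (\<Sum>i<m. a i * e i x)" unfolding h_def by simp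
      then show ?thesis using o sp inn' by (intro exI[of _ m] exI[of _ e]) blast
    next
      case False
      define N where "N = (\<Sum>x\<in>X. q x * (h x)^2)"
      have "N > 0"
      proof -
        from False obtain x0 where x0: "x0 \<in> X" "h x0 \<noteq> 0" by auto
        show ?thesis unfolding N_def
          by (rule sum_pos2[OF assms(2) x0(1)]) (use q x0 less_imp_le[OF q] in auto)
      qed
      have orth: "(\<Sum>x\<in>X. q x * e i x * h x) = 0" if "i < m" for i
      proof -
        have "(\<Sum>x\<in>X. q x * e i x * h x) = a i - (\<Sum>x\<in>X. \<Sum>j<m. a j * (q x * e i x * e j x))"
          unfolding h_def a_def by (simp add: algebra_simps sum_subtractf sum_distrib_left)
        also have "(\<Sum>x\<in>X. \<Sum>j<m. a j * (q x * e i x * e j x)) = (\<Sum>j<m. a j * (\<Sum>x\<in>X. q x * e i x * e j x))"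
          by (subst sum.swap) (simp add: sum_distrib_left)
        also have "\<dots> = (\<Sum>j<m. if j = i then a j else 0)"
          using that by (intro sum.cong) (auto simp: on)
        also have "\<dots> = a i" using that by simp
        finally show ?thesis by simp
      qed
      define f where "f x = h x / sqrt N" for x
      have ff: "(\<Sum>x\<in>X. q x * f x * f x) = 1"
      proof -
        have "(\<Sum>x\<in>X. q x * f x * f x) = (\<Sum>x\<in>X. q x * (h x)^2 / N)"
          unfolding f_def using \<open>N > 0\<close> by (intro sum.cong) (auto simp: power2_eq_square field_simps)
        also have "\<dots> = 1" using \<open>N > 0\<close> by (simp add: N_def flip: sum_divide_distrib)
        finally show ?thesis .
      qed
      have fe: "(\<Sum>x\<in>X. q x * e i x * f x) = 0" if "i < m" for i
        using orth[OF that] unfolding f_def by (simp flip: sum_divide_distrib)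
      define e' where "e' i = (if i < m then e i else f)" for i
      have "(\<Sum>x\<in>X. q x * e' i x * e' j x) = (if i = j then 1 else 0)" if "i < Suc m" "j < Suc m" for i j
        using that on[of i j] ff fe[of i] fe[of j] unfolding e'_def by (auto simp: less_Suc_eq mult_ac)
      moreover have "\<exists>c. \<forall>x\<in>X. v y x = (\<Sum>i<Suc m. c i * e' i x)" if "y \<in> insert z Z" for y
      proof (cases "y = z")
        case True
        have "\<forall>x\<in>X. v y x = (\<Sum>i<Suc m. (if i < m then a i else sqrt N) * e' i x)"
          using \<open>N > 0\<close> True unfolding e'_def f_def h_def by simp
        then show ?thesis by (rule exI[where x = "\<lambda>i. if i < m then a i else sqrt N"])
      next
        case False
        then obtain c where "\<forall>x\<in>X. v y x = (\<Sum>i<m. c i * e i x)" using sp \<open>y \<in> _\<close> by blast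
        then have "\<forall>x\<in>X. v y x = (\<Sum>i<Suc m. (if i < m then c i else 0) * e' i x)"
          unfolding e'_def by simp
        then show ?thesis by (rule exI[where x = "\<lambda>i. if i < m then c i else 0"])
      qed
      moreover have "\<exists>c. \<forall>x\<in>X. e' i x = (\<Sum>y\<in>insert z Z. c y * v y x)" if "i < Suc m" for i
      proof (cases "i < m")
        case True
        then show ?thesis using inn' unfolding e'_def by simp
      next
        case False
        have "f x = (\<Sum>y\<in>insert z Z. (if y = z then 1 else - (\<Sum>i<m. a i * C i y)) / sqrt N * v y x)"
            if "x \<in> X" for x
        proof -
          have "h x = v z x - (\<Sum>i<m. a i * (\<Sum>y\<in>Z. C i y * v y x))"
            unfolding h_def using C that by simp
          also have "(\<Sum>i<m. a i * (\<Sum>y\<in>Z. C i y * v y x)) = (\<Sum>y\<in>Z. (\<Sum>i<m. a i * C i y) * v y x)"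
            by (simp add: sum_distrib_left sum_distrib_right mult_ac) (rule sum.swap)
          also have "v z x - \<dots> = (\<Sum>y\<in>insert z Z. (if y = z then 1 else - (\<Sum>i<m. a i * C i y)) * v y x)"
            using insert.hyps by (simp add: sum_negf[symmetric]) (auto intro!: sum.cong)
          finally show ?thesis unfolding f_def by (simp add: sum_divide_distrib mult_ac)
        qed
        then have "\<forall>x\<in>X. e' i x = (\<Sum>y\<in>insert z Z. (if y = z then 1 else
            - (\<Sum>i<m. a i * C i y)) / sqrt N * v y x)"
          using False unfolding e'_def by simp
        then show ?thesis by (rule exI[where x = "\<lambda>y. (if y = z then 1 else - (\<Sum>i<m. a i * C i y)) / sqrt N"])
      qed
      ultimately show ?thesis by (intro exI[of _ "Suc m"] exI[of _ e']) blast
    qed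
  qed
qed

text \<open>\<open>K\<close> is the w-orthogonal projection onto the span E of its columns. By
  \<open>odd\<close> and \<open>odd'\<close>, l E and l' E are orthogonal to E; by
  \<open>tr\<close>, E has half the dimension. So l E is the complement of E and contains l' E,
  hence multiplication by l'/l preserves E. This multiplication is symmetric, so it commutes with
  the projection, which is the claim entry by entry.\<close>

lemma commuting_kernel:
  fixes K :: "'a \<Rightarrow> 'a \<Rightarrow> real" and w l l' :: "'a \<Rightarrow> real"
  assumes fin: "finite X" and w: "\<And>x. x \<in> X \<Longrightarrow> w x > 0"
    and sym: "\<And>x y. x \<in> X \<Longrightarrow> y \<in> X \<Longrightarrow> K x y = K y x"
    and idem: "\<And>x y. x \<in> X \<Longrightarrow> y \<in> X \<Longrightarrow> (\<Sum>z\<in>X. w z * K x z * K z y) = K x y"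
    and tr: "2 * (\<Sum>x\<in>X. w x * K x x) = card X"
    and l0: "\<And>x. x \<in> X \<Longrightarrow> l x \<noteq> 0"
    and odd: "\<And>x y. x \<in> X \<Longrightarrow> y \<in> X \<Longrightarrow> (\<Sum>z\<in>X. w z * l z * K x z * K z y) = 0"
    and odd': "\<And>x y. x \<in> X \<Longrightarrow> y \<in> X \<Longrightarrow> (\<Sum>z\<in>X. w z * l' z * K x z * K z y) = 0"
    and x: "x \<in> X" and y: "y \<in> X"
  shows "K x y * (l' x / l x - l' y / l y) = 0"
proof -
  \<comment> \<open>The weight w l^2 makes the functions l e_i orthonormal for w, so that
    \<open>R\<close> below is the projection onto l E.\<close>
  define q where "q z = w z * (l z)^2" for z
  have q0: "\<And>z. z \<in> X \<Longrightarrow> q z > 0" using w l0 unfolding q_def by simp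
  have "\<exists>(m::nat) e. (\<forall>i<m. \<forall>j<m. (\<Sum>x\<in>X. q x * e i x * e j x) = (if i = j then 1 else 0)) \<and>
     (\<forall>z\<in>X. \<exists>c. \<forall>x\<in>X. K x z = (\<Sum>i<m. c i * e i x)) \<and>
     (\<forall>i<m. \<exists>c. \<forall>x\<in>X. e i x = (\<Sum>z\<in>X. c z * K x z))"
    using fin fin q0 by (rule gram_schmidt)
  then show ?thesis
  proof (elim exE conjE)
    fix m :: nat and e :: "nat \<Rightarrow> 'a \<Rightarrow> real"
    assume o: "\<forall>i<m. \<forall>j<m. (\<Sum>x\<in>X. q x * e i x * e j x) = (if i = j then 1 else 0)"
      and sp: "\<forall>z\<in>X. \<exists>c. \<forall>x\<in>X. K x z = (\<Sum>i<m. c i * e i x)"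
      and inn: "\<forall>i<m. \<exists>c. \<forall>x\<in>X. e i x = (\<Sum>z\<in>X. c z * K x z)"
    have on: "(\<Sum>x\<in>X. q x * e i x * e j x) = (if i = j then 1 else 0)" if "i < m" "j < m" for i j
      using o that by blast
    from sp obtain c where c: "\<And>x z. x \<in> X \<Longrightarrow> z \<in> X \<Longrightarrow> K x z = (\<Sum>i<m. c z i * e i x)" by metis
    have Ke: "(\<Sum>z\<in>X. w z * K x z * e i z) = e i x" if x: "x \<in> X" and i: "i < m" for i x
    proof -
      obtain b where b: "\<And>x. x \<in> X \<Longrightarrow> e i x = (\<Sum>z\<in>X. b z * K x z)" using inn i by blast
      have "(\<Sum>z\<in>X. w z * K x z * e i z) = (\<Sum>z\<in>X. \<Sum>y\<in>X. b y * (w z * K x z * K z y))"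
        by (simp add: b sum_distrib_left mult_ac)
      also have "\<dots> = (\<Sum>y\<in>X. b y * K x y)"
        by (subst sum.swap) (simp add: sum_distrib_left[symmetric] idem[OF x])
      finally show ?thesis using b[OF x] by simp
    qed
    have Kle: "(\<Sum>z\<in>X. w z * g z * K x z * e i z) = 0" if x: "x \<in> X" and i: "i < m"
       and g: "\<And>x y. x \<in> X \<Longrightarrow> y \<in> X \<Longrightarrow> (\<Sum>z\<in>X. w z * g z * K x z * K z y) = 0" for i x g
    proof -
      obtain b where b: "\<And>x. x \<in> X \<Longrightarrow> e i x = (\<Sum>z\<in>X. b z * K x z)" using inn i by blast
      have "(\<Sum>z\<in>X. w z * g z * K x z * e i z) = (\<Sum>z\<in>X. \<Sum>y\<in>X. b y * (w z * g z * K x z * K z y))"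
        by (simp add: b sum_distrib_left mult_ac)
      also have "\<dots> = 0"
        by (subst sum.swap) (simp add: sum_distrib_left[symmetric] g[OF x])
      finally show ?thesis .
    qed
    define R where "R x y = l x * l y * (\<Sum>i<m. e i x * e i y)" for x y
    have KR: "(\<Sum>z\<in>X. w z * K x z * R z y) = 0" if "x \<in> X" "y \<in> X" for x y
    proof -
      have "(\<Sum>z\<in>X. w z * K x z * R z y) = (\<Sum>z\<in>X. \<Sum>i<m. l y * e i y * (w z * l z * K x z * e i z))"
        unfolding R_def by (simp add: sum_distrib_left mult_ac)
      also have "\<dots> = (\<Sum>i<m. l y * e i y * (\<Sum>z\<in>X. w z * l z * K x z * e i z))"
        by (subst sum.swap) (simp add: sum_distrib_left)
      finally show ?thesis using Kle[OF that(1) _ odd] by simp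
    qed
    have RR: "(\<Sum>z\<in>X. w z * R x z * R z y) = R x y" for x y
    proof -
      have "(\<Sum>z\<in>X. w z * R x z * R z y)
          = (\<Sum>z\<in>X. \<Sum>i<m. \<Sum>j<m. l x * l y * e i x * e j y * (q z * e i z * e j z))"
        unfolding R_def q_def
        by (intro sum.cong refl) (simp add: sum_product sum_distrib_left sum_distrib_right mult_ac
            power2_eq_square)
      also have "\<dots> = (\<Sum>i<m. \<Sum>j<m. l x * l y * e i x * e j y * (\<Sum>z\<in>X. q z * e i z * e j z))"
        by (subst sum.swap, intro sum.cong refl, subst sum.swap) (simp add: sum_distrib_left)
      also have "\<dots> = (\<Sum>i<m. \<Sum>j<m. if j = i then l x * l y * e i x * e j y else 0)"
        by (intro sum.cong refl) (auto simp: on)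
      also have "\<dots> = R x y" unfolding R_def by (simp add: sum_distrib_left mult_ac)
      finally show ?thesis .
    qed
    have trR: "(\<Sum>x\<in>X. w x * R x x) = m"
    proof -
      have "(\<Sum>x\<in>X. w x * R x x) = (\<Sum>x\<in>X. \<Sum>i<m. q x * e i x * e i x)"
        unfolding R_def q_def by (simp add: sum_distrib_left mult_ac power2_eq_square)
      also have "\<dots> = (\<Sum>i<m. 1)" by (subst sum.swap) (simp add: on)
      finally show ?thesis by simp
    qed
    \<comment> \<open>The trace of \<open>R\<close> is the size of an orthonormal basis. For
      \<open>K\<close> the basis is orthonormal for another weight; here the coefficients
      \<open>c\<close> of the columns form the w-dual basis of \<open>e\<close>.\<close>
    have trK: "(\<Sum>x\<in>X. w x * K x x) = m"
    proof -
      have ci: "(\<Sum>x\<in>X. w x * c x i * e i x) = 1" if i: "i < m" for i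
      proof -
        have "(\<Sum>z\<in>X. w z * c z j * e i z) = (if i = j then 1 else 0)" if j: "j < m" for j
        proof -
          have "(if i = j then 1 else 0) = (\<Sum>x\<in>X. q x * e j x * e i x)" using on i j by auto
          also have "\<dots> = (\<Sum>x\<in>X. q x * e j x * (\<Sum>z\<in>X. w z * K x z * e i z))"
            using Ke i by simp
          also have "\<dots> = (\<Sum>x\<in>X. \<Sum>z\<in>X. q x * e j x * (w z * (\<Sum>k<m. c z k * e k x) * e i z))"
            by (simp add: sum_distrib_left c)
          also have "\<dots> = (\<Sum>x\<in>X. \<Sum>z\<in>X. \<Sum>k<m. w z * c z k * e i z * (q x * e j x * e k x))"
            by (simp add: sum_distrib_left sum_distrib_right mult_ac)
          also have "\<dots> = (\<Sum>z\<in>X. \<Sum>k<m. w z * c z k * e i z * (\<Sum>x\<in>X. q x * e j x * e k x))"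
            by (subst sum.swap, intro sum.cong refl, subst sum.swap) (simp add: sum_distrib_left)
          also have "\<dots> = (\<Sum>z\<in>X. \<Sum>k<m. if k = j then w z * c z k * e i z else 0)"
            using j by (intro sum.cong refl) (auto simp: on)
          finally show ?thesis using j by simp
        qed
        from this[OF i] show ?thesis by simp
      qed
      have "(\<Sum>x\<in>X. w x * K x x) = (\<Sum>x\<in>X. \<Sum>i<m. w x * c x i * e i x)"
        by (simp add: c sum_distrib_left mult_ac)
      also have "\<dots> = (\<Sum>i<m. 1)" by (subst sum.swap) (simp add: ci)
      finally show ?thesis by simp
    qed
    \<comment> \<open>The projection onto the complement of E + l E. Its trace is |X| - 2 m = 0, and
      the trace of a symmetric idempotent is a sum of squares, so it vanishes identically.\<close>
    define U where "U x y = (if x = y then 1 / w x else 0) - K x y - R x y" for x y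
    have Rsym: "R x y = R y x" for x y unfolding R_def by (simp add: mult_ac)
    have UU: "(\<Sum>z\<in>X. w z * (U x z)^2) = U x x" if x: "x \<in> X" for x
    proof -
      have "w z * (U x z)^2 = (if z = x then 1 / w x - 2 * K x x - 2 * R x x else 0) + w z * K x z * K z x
           + w z * R x z * R z x + 2 * (w z * K x z * R z x)" if "z \<in> X" for z
        using w[OF that] sym[OF x that] Rsym[of x z] unfolding U_def
        by (auto simp: power2_eq_square field_simps)
      then have "(\<Sum>z\<in>X. w z * (U x z)^2) = (\<Sum>z\<in>X. (if z = x then 1 / w x - 2 * K x x - 2 * R x x else 0)
          + w z * K x z * K z x
           + w z * R x z * R z x + 2 * (w z * K x z * R z x))" by (intro sum.cong) auto
      also have "\<dots> = 1 / w x - 2 * K x x - 2 * R x x + K x x + R x x + 2 * 0"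
        unfolding sum.distrib idem[OF x x] RR using fin x KR[OF x x] by (simp flip: sum_distrib_left)
      finally show ?thesis unfolding U_def by simp
    qed
    have "(\<Sum>x\<in>X. w x * U x x) = (\<Sum>x\<in>X. 1 - w x * K x x - w x * R x x)"
      using w unfolding U_def by (intro sum.cong) (auto simp: field_simps less_imp_neq[symmetric])
    also have "\<dots> = 0" using tr trK trR by (simp add: sum_subtractf)
    finally have "(\<Sum>x\<in>X. w x * (\<Sum>z\<in>X. w z * (U x z)^2)) = 0" by (simp add: UU)
    then have "\<forall>x\<in>X. w x * (\<Sum>z\<in>X. w z * (U x z)^2) = 0"
      by (subst (asm) sum_nonneg_eq_0_iff) (auto intro!: mult_nonneg_nonneg sum_nonneg simp: fin
          less_imp_le[OF w])
    then have "\<forall>x\<in>X. (\<Sum>z\<in>X. w z * (U x z)^2) = 0" using w by fastforce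
    then have "\<forall>x\<in>X. \<forall>z\<in>X. w z * (U x z)^2 = 0"
      by (subst (asm) sum_nonneg_eq_0_iff) (auto simp: fin less_imp_le[OF w])
    then have U0: "U x z = 0" if "x \<in> X" "z \<in> X" for x z using w that by fastforce
    \<comment> \<open>This is U = 0 composed with multiplication by l'/l and with \<open>K\<close>.
      The contribution of \<open>R\<close> disappears because l' E is orthogonal to E. The
      right-hand side is symmetric in x and y.\<close>
    have main: "l' x / l x * K x y = (\<Sum>z\<in>X. w z * K x z * (l' z / l z) * K z y)" if x: "x \<in> X"
        and y: "y \<in> X" for x y
    proof -
      have "w x \<noteq> 0" using w[OF x] by simp
      have "0 = (\<Sum>z\<in>X. w z * U x z * (l' z / l z) * K z y)" using U0 x by simp
      also have "\<dots> = (\<Sum>z\<in>X. (if z = x then l' x / l x * K x y else 0) - w z * K x z * (l' z / l z) * K z y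
          - (\<Sum>i<m. l x * e i x * (w z * l' z * K y z * e i z)))"
        unfolding U_def R_def using \<open>w x \<noteq> 0\<close> l0 sym y
        by (intro sum.cong) (auto simp: algebra_simps sum_distrib_left sum_distrib_right intro!: sum.cong)
      also have "\<dots> = l' x / l x * K x y - (\<Sum>z\<in>X. w z * K x z * (l' z / l z) * K z y)
          - (\<Sum>i<m. l x * e i x * (\<Sum>z\<in>X. w z * l' z * K y z * e i z))"
        unfolding sum_subtractf using fin x by (simp add: sum_distrib_left) (rule sum.swap)
      also have "(\<Sum>i<m. l x * e i x * (\<Sum>z\<in>X. w z * l' z * K y z * e i z)) = 0"
        using Kle[OF y _ odd'] by simp
      finally show ?thesis by simp
    qed
    have "l' x / l x * K x y = (\<Sum>z\<in>X. w z * K x z * (l' z / l z) * K z y)" using main x y by simp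
    also have "\<dots> = (\<Sum>z\<in>X. w z * K y z * (l' z / l z) * K z x)"
      using sym x y by (intro sum.cong) (auto simp: mult_ac)
    also have "\<dots> = l' y / l y * K y x" using main x y by simp
    finally show ?thesis using sym[OF x y] by (simp add: algebra_simps)
  qed
qed

section \<open>Moments of the uniform measure on the sphere\<close>

text \<open>Uniqueness of Haar measure by Fubini: for a translation invariant \<open>\<mu>\<close>, the double integral
  of \<open>1\<^sub>A(x) 1\<^sub>B(y)\<close> can be sheared in both variables, which gives
  \<open>\<lambda>(A) \<mu>(B) = \<mu>(A) \<lambda>(- B)\<close>; take for \<open>B\<close> the unit ball.\<close>
lemma lborel_distr_orthogonal:
  fixes T :: "'a::euclidean_space \<Rightarrow> 'a"
  assumes T: "orthogonal_transformation T"
  shows "distr lborel borel T = lborel"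
proof -
  define N where "N = distr lborel borel T"
  define B where "B = ball (0::'a) 1"
  have lin: "linear T" using T by (rule orthogonal_transformation_linear)
  have Tm [measurable]: "T \<in> borel_measurable borel"
    using lin by (intro borel_measurable_continuous_onI linear_continuous_on linear_conv_bounded_linear[THEN
        iffD1])
  have [measurable_cong, simp]: "sets N = sets borel" unfolding N_def by simp
  have [simp]: "space N = UNIV" unfolding N_def by simp
  obtain S where S: "orthogonal_transformation S" "\<And>y. T (S y) = y"
    using orthogonal_transformation_inv[OF T] orthogonal_transformation_surj[OF T] surj_f_inv_f by metis
  have N_eq: "emeasure N A = emeasure lborel (T -` A)" if "A \<in> sets borel" for A
    unfolding N_def using that by (simp add: emeasure_distr)
  have inv: "(\<integral>\<^sup>+y. f (y + a) \<partial>N) = (\<integral>\<^sup>+y. f y \<partial>N)"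
      if f[measurable]: "f \<in> borel_measurable borel" for f :: "'a \<Rightarrow> ennreal" and a
  proof -
    have "(\<integral>\<^sup>+y. f (y + a) \<partial>N) = (\<integral>\<^sup>+y. f (T (S a + y)) \<partial>lborel)"
      unfolding N_def by (subst nn_integral_distr) (auto simp: linear_add[OF lin] S add.commute)
    also have "\<dots> = (\<integral>\<^sup>+y. f (T y) \<partial>(distr lborel borel ((+) (S a))))"
      by (subst nn_integral_distr) auto
    also have "\<dots> = (\<integral>\<^sup>+y. f y \<partial>N)"
      unfolding N_def lborel_distr_plus by (subst nn_integral_distr) auto
    finally show ?thesis .
  qed
  have invL: "(\<integral>\<^sup>+y. f (y + a) \<partial>lborel) = (\<integral>\<^sup>+y. f y \<partial>lborel)"
      if f[measurable]: "f \<in> borel_measurable borel" for f :: "'a \<Rightarrow> ennreal" and a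
  proof -
    have "(\<integral>\<^sup>+y. f y \<partial>lborel) = (\<integral>\<^sup>+y. f y \<partial>(distr lborel borel ((+) a)))" by (simp add: lborel_distr_plus)
    also have "\<dots> = (\<integral>\<^sup>+y. f (y + a) \<partial>lborel)" by (subst nn_integral_distr) (auto simp: add.commute)
    finally show ?thesis by simp
  qed
  have "T -` B = B" unfolding B_def by (auto simp: orthogonal_transformation_norm[OF T])
  then have NB: "emeasure N B = emeasure lborel B" using N_eq[of B] by (simp add: B_def)
  have "sigma_finite_measure N"
  proof
    let ?F = "range (\<lambda>n::nat. ball (0::'a) n)"
    have "emeasure N (ball 0 n) \<noteq> \<infinity>" for n :: nat
    proof -
      have "T -` ball 0 n = ball 0 n" by (auto simp: orthogonal_transformation_norm[OF T])
      then show ?thesis using N_eq[of "ball 0 n"] emeasure_lborel_ball_finite[of 0 n] by (auto simp: less_top)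
    qed
    moreover have "\<Union>?F = UNIV" using reals_Archimedean2 by auto
    ultimately show "\<exists>A. countable A \<and> A \<subseteq> sets N \<and> \<Union> A = space N \<and> (\<forall>a\<in>A. emeasure N a \<noteq> \<infinity>)"
      by (intro exI[of _ ?F]) auto
  qed
  then interpret N: sigma_finite_measure N .
  interpret P: pair_sigma_finite lborel N ..
  show ?thesis unfolding N_def[symmetric]
  proof (rule measure_eqI)
    fix A assume "A \<in> sets N"
    then have [measurable]: "A \<in> sets borel" by simp
    have [measurable]: "B \<in> sets borel" unfolding B_def by simp
    let ?I = "\<lambda>A x. indicator A x :: ennreal"
    have "emeasure lborel A * emeasure N B = (\<integral>\<^sup>+y. (\<integral>\<^sup>+x. ?I A x * ?I B y \<partial>lborel) \<partial>N)"
      by (simp add: nn_integral_multc nn_integral_cmult)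
    also have "\<dots> = (\<integral>\<^sup>+y. (\<integral>\<^sup>+x. ?I A (x + y) * ?I B y \<partial>lborel) \<partial>N)"
      by (subst invL[of "\<lambda>x. ?I A x * ?I B _"]) auto
    also have "\<dots> = (\<integral>\<^sup>+x. (\<integral>\<^sup>+y. ?I A (x + y) * ?I B y \<partial>N) \<partial>lborel)"
      by (rule P.Fubini') measurable
    also have "\<dots> = (\<integral>\<^sup>+x. (\<integral>\<^sup>+y. ?I A y * ?I B (y - x) \<partial>N) \<partial>lborel)"
    proof (rule nn_integral_cong)
      fix x
      show "(\<integral>\<^sup>+y. ?I A (x + y) * ?I B y \<partial>N) = (\<integral>\<^sup>+y. ?I A y * ?I B (y - x) \<partial>N)"
        using inv[of "\<lambda>y. ?I A y * ?I B (y - x)" x] by (simp add: add.commute)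
    qed
    also have "\<dots> = (\<integral>\<^sup>+y. (\<integral>\<^sup>+x. ?I A y * ?I B (y - x) \<partial>lborel) \<partial>N)"
      by (rule P.Fubini'[symmetric]) measurable
    also have "\<dots> = (\<integral>\<^sup>+y. ?I A y * emeasure lborel B \<partial>N)"
    proof (rule nn_integral_cong)
      fix y
      have "(\<integral>\<^sup>+x. ?I A y * ?I B (y - x) \<partial>lborel) = ?I A y * (\<integral>\<^sup>+x. ?I B (x - y) \<partial>lborel)"
        by (subst nn_integral_cmult[symmetric]) (auto simp: B_def indicator_def dist_norm norm_minus_commute
            intro!: nn_integral_cong)
      also have "(\<integral>\<^sup>+x. ?I B (x - y) \<partial>lborel) = emeasure lborel B"
        using invL[of "?I B" "-y"] by simp
      finally show "(\<integral>\<^sup>+x. ?I A y * ?I B (y - x) \<partial>lborel) = ?I A y * emeasure lborel B" .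
    qed
    also have "\<dots> = emeasure N A * emeasure lborel B" by (simp add: nn_integral_multc)
    finally have "emeasure lborel A * emeasure lborel B = emeasure N A * emeasure lborel B" by (simp add: NB)
    moreover have "emeasure lborel B < \<infinity>" unfolding B_def by (rule emeasure_lborel_ball_finite)
    moreover have "emeasure lborel B \<noteq> 0" using content_ball_pos[of 1 "0::'a"] unfolding B_def
        by (auto simp: measure_def)
    ultimately show "emeasure N A = emeasure lborel A"
        by (auto simp: ennreal_mult_cancel_left mult.commute[of _ "emeasure lborel B"])
  qed simp
qed

section \<open>The uniform probability measure on the unit sphere as a cone measure\<close>

definition ball_density :: "'a::euclidean_space \<Rightarrow> real" where
  "ball_density x = indicator (ball 0 1) x / measure lborel (ball (0::'a) 1)"

lemma borel_measurable_ball_density [measurable, simp]: "ball_density \<in> borel_measurable borel"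
  unfolding ball_density_def by (intro borel_measurable_divide borel_measurable_indicator) auto

lemma ball_density_nonneg [simp]: "ball_density x \<ge> 0"
  by (simp add: ball_density_def)

text \<open>The cone measure behind \<open>sphere_avg\<close>, packaged as a measure so that change
  of variables and almost-everywhere arguments apply. The origin, which the normalization sends to
  0, is a null set.\<close>

definition usphere :: "'a::euclidean_space measure" where
  "usphere = distr (density lborel (\<lambda>x::'a. ennreal (ball_density x)))
     borel (\<lambda>x. x /\<^sub>R norm x)"

lemma sets_usphere [measurable_cong, simp]: "sets usphere = sets borel"
  by (simp add: usphere_def)

lemma space_usphere [simp]: "space usphere = UNIV"
  by (simp add: usphere_def)

lemma vol_ball_pos: "measure lborel (ball (0::'a::euclidean_space) 1) > 0"
  by (simp add: content_ball_pos)

lemma borel_measurable_usphere [simp]: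
  "f \<in> borel_measurable usphere \<longleftrightarrow> f \<in> borel_measurable borel"
  by (simp cong: measurable_cong_sets)

lemma emeasure_usphere_UNIV: "emeasure (usphere :: 'a::euclidean_space measure) UNIV = 1"
proof -
  have "emeasure (usphere :: 'a measure) UNIV
      = (\<integral>\<^sup>+x. ennreal (ball_density x) \<partial>(lborel :: 'a measure))"
    unfolding usphere_def by (simp add: emeasure_distr emeasure_density)
  also have "\<dots> = (\<integral>\<^sup>+x. ennreal (1 / measure lborel (ball (0::'a) 1)) * indicator (ball 0 1) x \<partial>(lborel ::
      'a measure))"
    by (intro nn_integral_cong) (auto simp: indicator_def ball_density_def)
  also have "\<dots> = ennreal (1 / measure lborel (ball (0::'a) 1)) * emeasure lborel (ball (0::'a) 1)"
    by (subst nn_integral_cmult_indicator) simp_all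
  also have "emeasure lborel (ball (0::'a) 1) = ennreal (measure lborel (ball (0::'a) 1))"
    using emeasure_lborel_ball_finite[of "0::'a" 1] by (simp add: emeasure_eq_ennreal_measure less_top)
  also have "ennreal (1 / measure lborel (ball (0::'a) 1)) * \<dots> = 1"
    using vol_ball_pos[where 'a='a] by (simp add: ennreal_mult[symmetric] del: ennreal_eq_1)
  finally show ?thesis .
qed

lemma finite_measure_usphere: "finite_measure (usphere :: 'a::euclidean_space measure)"
  by (rule finite_measureI) (simp add: emeasure_usphere_UNIV)

lemma integral_usphere_const: "(\<integral>x. c \<partial>(usphere :: 'a::euclidean_space measure)) = (c::real)"
  by (simp add: measure_def emeasure_usphere_UNIV)

lemma AE_usphere: "AE x in (usphere :: 'a::euclidean_space measure). norm x = 1"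
proof -
  have "AE x in (lborel :: 'a measure). x \<noteq> 0"
    by (rule AE_lborel_singleton)
  then have "AE x in (lborel :: 'a measure). 0 < ennreal (ball_density x) \<longrightarrow> norm (x /\<^sub>R norm x) = 1"
    by eventually_elim auto
  then have "AE x in density lborel (\<lambda>x::'a. ennreal (ball_density x)). norm (x /\<^sub>R norm x) = 1"
    by (subst AE_density) simp_all
  then show ?thesis
    unfolding usphere_def by (subst AE_distr_iff) auto
qed

lemma integral_usphere:
  fixes f :: "'a::euclidean_space \<Rightarrow> real"
  assumes [measurable]: "f \<in> borel_measurable borel"
  shows "(\<integral>x. f x \<partial>usphere) = (\<integral>x. ball_density x * f (x /\<^sub>R norm x) \<partial>lborel)"
  unfolding usphere_def by (subst integral_distr, simp, simp, subst integral_density) auto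

lemma integrable_usphere:
  fixes f :: "'a::euclidean_space \<Rightarrow> real"
  assumes [measurable]: "f \<in> borel_measurable borel"
  shows "integrable usphere f \<longleftrightarrow> integrable lborel (\<lambda>x. ball_density x * f (x /\<^sub>R norm x))"
  unfolding usphere_def by (subst integrable_distr_eq, simp, simp, subst integrable_density) auto

lemma usphere_cong:
  fixes f g :: "'a::euclidean_space \<Rightarrow> real"
  assumes "\<And>x. norm x = 1 \<Longrightarrow> f x = g x" "continuous_on UNIV f" "continuous_on UNIV g"
  shows "(\<integral>x. f x \<partial>usphere) = (\<integral>x. g x \<partial>usphere)"
proof (rule integral_cong_AE)
  show "AE x in usphere. f x = g x" using AE_usphere by eventually_elim (rule assms(1))
qed (use assms in \<open>auto simp: borel_measurable_continuous_onI\<close>)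

lemma usphere_integrable:
  fixes f :: "'a::euclidean_space \<Rightarrow> real"
  assumes f: "continuous_on UNIV f"
  shows "integrable usphere f"
proof -
  interpret finite_measure "usphere :: 'a measure" by (rule finite_measure_usphere)
  have "compact (f ` sphere 0 1)"
    using f by (intro compact_continuous_image) (auto intro: continuous_on_subset)
  then obtain B where B: "\<And>x. norm x = 1 \<Longrightarrow> norm (f x) \<le> B"
    using compact_imp_bounded[THEN bounded_pos[THEN iffD1]] by fastforce
  show ?thesis
  proof (rule integrable_const_bound)
    show "AE x in usphere. norm (f x) \<le> B" using AE_usphere by eventually_elim (rule B)
  qed (use f in \<open>simp add: borel_measurable_continuous_onI\<close>)
qed

lemma sphere_avg_eq:
  fixes f :: "real^'n \<Rightarrow> real"
  assumes f: "continuous_on UNIV f"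
  shows "sphere_avg r f = (\<integral>x. f (r *\<^sub>R x) \<partial>usphere)"
proof -
  let ?c = "measure lborel (ball (0::real^'n) 1)"
  let ?h = "\<lambda>x::real^'n. f (r *\<^sub>R (x /\<^sub>R norm x))"
  have fr: "continuous_on UNIV (\<lambda>x. f (r *\<^sub>R x))"
    by (intro continuous_on_compose2[OF f] continuous_intros) auto
  have [measurable]: "(\<lambda>x. f (r *\<^sub>R x)) \<in> borel_measurable borel"
    using fr by (rule borel_measurable_continuous_onI)
  have eq: "(\<integral>x. f (r *\<^sub>R x) \<partial>usphere) = (\<integral>x. ball_density x * ?h x \<partial>lborel)"
    by (rule integral_usphere) measurable
  have "integrable lborel (\<lambda>x. ball_density x * ?h x)"
    using usphere_integrable[OF fr] integrable_usphere[of "\<lambda>x. f (r *\<^sub>R x)"] by simp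
  then have "integrable lborel (\<lambda>x. ?c * (ball_density x * ?h x))"
    by (rule integrable_mult_right)
  then have int: "set_integrable lborel (ball 0 1) ?h"
    using vol_ball_pos[where 'a="real^'n"] unfolding set_integrable_def ball_density_def by simp
  have "(\<integral>x. ball_density x * ?h x \<partial>lborel) = (LINT x:ball 0 1|lborel. ?h x) / ?c"
    unfolding set_lebesgue_integral_def ball_density_def by simp
  also have "\<dots> = integral (ball 0 1) ?h / ?c"
    using set_borel_integral_eq_integral(2)[OF int] by simp
  finally show ?thesis unfolding sphere_avg_def eq by simp
qed

text \<open>\<open>T\<close> preserves the ball and commutes with normalization, so the invariance
  of Lebesgue measure carries over.\<close>

lemma usphere_orthogonal:
  fixes f :: "'a::euclidean_space \<Rightarrow> real" and T :: "'a \<Rightarrow> 'a"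
  assumes T: "orthogonal_transformation T" and f: "continuous_on UNIV f"
  shows "(\<integral>x. f (T x) \<partial>usphere) = (\<integral>x. f x \<partial>usphere)"
proof -
  have lin: "linear T" using T by (rule orthogonal_transformation_linear)
  have [measurable]: "T \<in> borel_measurable borel"
    using lin by (intro borel_measurable_continuous_onI linear_continuous_on linear_conv_bounded_linear[THEN
        iffD1])
  have [measurable]: "f \<in> borel_measurable borel"
    using f by (rule borel_measurable_continuous_onI)
  have dens: "ball_density (T x) = ball_density x" for x
    by (simp add: orthogonal_transformation_norm[OF T] ball_density_def indicator_def)
  have "(\<integral>x. f (T x) \<partial>usphere) = (\<integral>x. ball_density x * f (T (x /\<^sub>R norm x)) \<partial>lborel)"
    by (rule integral_usphere) measurable
  also have "\<dots> = (\<integral>x. ball_density (T x) * f (T x /\<^sub>R norm (T x)) \<partial>lborel)"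
    by (simp add: orthogonal_transformation_norm[OF T] orthogonal_transformation_scaleR[OF T] dens)
  also have "\<dots> = (\<integral>x. ball_density x * f (x /\<^sub>R norm x) \<partial>(distr lborel borel T))"
    by (subst integral_distr) auto
  also have "\<dots> = (\<integral>x. f x \<partial>usphere)"
    unfolding lborel_distr_orthogonal[OF T] by (rule integral_usphere[symmetric]) measurable
  finally show ?thesis .
qed

section \<open>Mixed moments of two linear forms on the sphere\<close>

definition moment :: "nat \<Rightarrow> nat \<Rightarrow> real^'n \<Rightarrow> real^'n \<Rightarrow> real" where
  "moment a b x y = (\<integral>z. (x \<bullet> z)^a * (y \<bullet> z)^b \<partial>usphere)"

lemma integrable_moment [simp]: "integrable usphere (\<lambda>z. (x \<bullet> z)^a * (y \<bullet> (z::real^'n))^b)"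
  by (intro usphere_integrable continuous_intros)

lemma moment_0_0: "moment 0 0 x y = 1"
  using integral_usphere_const[of 1] by (simp add: moment_def)

text \<open>Some rotation carries \<open>e\<close> to the direction of \<open>u\<close>, so only the
  norm of \<open>u\<close> matters. The constant is determined later, degree by degree, from
  \<open>moment_last_sum\<close>.\<close>

lemma moment_power:
  assumes k: "k > 0"
  obtains c where "\<And>u :: real^'n. moment k 0 u y = c * norm u ^ k"
proof -
  obtain e :: "real^'n" where e: "norm e = 1" using vector_choose_size[of 1] by auto
  have "moment k 0 u y = moment k 0 e y * norm u ^ k" for u :: "real^'n"
  proof (cases "u = 0")
    case True
    then show ?thesis using k by (simp add: moment_def)
  next
    case False
    then have "norm (u /\<^sub>R norm u) = 1" by simp
    obtain T where T: "orthogonal_transformation T" "T e = u /\<^sub>R norm u"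
      using orthogonal_transformation_exists_1[OF e \<open>norm (u /\<^sub>R norm u) = 1\<close>] by blast
    have u: "u = norm u *\<^sub>R T e" using False by (simp add: T)
    have "moment k 0 u y = (\<integral>z. norm u ^ k * (T e \<bullet> z)^k \<partial>usphere)"
      unfolding moment_def by (subst (1) u) (simp add: power_mult_distrib)
    also have "\<dots> = norm u ^ k * (\<integral>z. (T e \<bullet> z)^k \<partial>usphere)"
      by simp
    also have "(\<integral>z. (T e \<bullet> z)^k \<partial>usphere) = (\<integral>z. (T e \<bullet> T z)^k \<partial>usphere)"
      by (rule usphere_orthogonal[OF T(1), symmetric]) (intro continuous_intros)
    also have "\<dots> = moment k 0 e y"
      using T(1) by (simp add: moment_def orthogonal_transformation_def)
    finally show ?thesis by simp
  qed
  then show thesis by (rule that)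
qed

lemma moment_binomial:
  "moment m 0 (x + t *\<^sub>R y) v = (\<Sum>j\<le>m. (of_nat (m choose j) * moment (m - j) j x y) * t^j)"
proof -
  have "((x + t *\<^sub>R y) \<bullet> z)^m = (\<Sum>j\<le>m. of_nat (m choose j) * t^j * ((x \<bullet> z)^(m-j) * (y \<bullet> z)^j))" for z
  proof -
    have "((x + t *\<^sub>R y) \<bullet> z)^m = (t * (y \<bullet> z) + x \<bullet> z)^m" by (simp add: inner_add_left add.commute)
    also have "\<dots> = (\<Sum>j\<le>m. of_nat (m choose j) * (t * (y \<bullet> z))^j * (x \<bullet> z)^(m-j))" by (rule binomial_ring)
    finally show ?thesis by (simp add: power_mult_distrib mult_ac)
  qed
  then show ?thesis by (simp add: moment_def mult_ac)
qed

text \<open>Polarization: the pure moment at x + t y is written in two ways as a polynomial in t,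
  and comparing coefficients gives every mixed moment.\<close>

lemma moment_coeffs:
  fixes x y :: "real^'n"
  assumes "\<And>u::real^'n. moment m 0 u v = c u" "\<And>t. c (x + t *\<^sub>R y) = (\<Sum>j\<le>m. d j * t^j)" "j \<le> m"
  shows "of_nat (m choose j) * moment (m - j) j x y = d j"
proof -
  have "\<forall>t. (\<Sum>j\<le>m. (of_nat (m choose j) * moment (m - j) j x y) * t^j) = (\<Sum>j\<le>m. d j * t^j)"
    unfolding moment_binomial[symmetric, where v = v] assms(1,2) by simp
  then show ?thesis using assms(3) unfolding polyfun_eq_coeffs by blast
qed

lemma norm_add_scaleR_sq: "norm (x + t *\<^sub>R y)^2 = (norm x)^2 + 2 * t * (x \<bullet> y) + t^2 * (norm y)^2"
  unfolding power2_norm_eq_inner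
  by (simp add: inner_add_left inner_add_right inner_commute power2_eq_square algebra_simps)

text \<open>On the unit sphere the squared coordinates add up to 1, so two degrees can be traced
  out. This is the recursion that fixes the constant in each even degree from the degree two
  below.\<close>

lemma moment_last_sum:
  fixes x :: "real^'n"
  shows "(\<Sum>e\<in>Basis. moment a 2 x e) = moment a 0 x v"
proof -
  have "(\<Sum>e\<in>Basis. moment a 2 x e) = (\<integral>z. (x \<bullet> z)^a * (\<Sum>e\<in>Basis. (e \<bullet> z)^2) \<partial>usphere)"
    by (simp add: moment_def sum_distrib_left)
  also have "\<dots> = moment a 0 x v"
    unfolding moment_def
  proof (rule usphere_cong)
    fix z :: "real^'n" assume "norm z = 1"
    then have "(\<Sum>e\<in>Basis. (e \<bullet> z)^2) = 1"
      using euclidean_inner[of z z] by (simp add: power2_eq_square inner_commute norm_eq_1)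
    then show "(x \<bullet> z)^a * (\<Sum>e\<in>Basis. (e \<bullet> z)^2) = (x \<bullet> z)^a * (v \<bullet> z)^0" by simp
  qed (intro continuous_intros)+
  finally show ?thesis .
qed

lemma sum_Basis_inner_sq: "norm (x::real^'n) = 1 \<Longrightarrow> (\<Sum>e\<in>Basis. (x \<bullet> e)^2) = 1"
  using euclidean_inner[of x x] by (simp add: power2_eq_square norm_eq_1)


text \<open>The lists in this lemma and the next three are the coefficients in t of the powers 1, 2,
  3, 4 of norm x ^ 2 + 2 t (x . y) + t^2 norm y ^ 2, that is of norm (x + t y) ^ m for m = 2, 4, 6,
  8.\<close>

lemma moment_coeffs_1:
  obtains k where "\<And>(x::real^'n) y j. j \<le> 2 \<Longrightarrow>
    of_nat (2 choose j) * moment (2 - j) j x y = k * [norm x ^ 2, 2*(x \<bullet> y), norm y ^ 2] ! j"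
proof -
  obtain k where k: "\<And>u :: real^'n. moment 2 0 u 0 = k * norm u ^ 2" by (rule moment_power[of 2]) auto
  have "of_nat (2 choose j) * moment (2 - j) j x y = k * [norm x ^ 2, 2*(x \<bullet> y), norm y ^ 2] ! j" if "j
      \<le> 2" for x y :: "real^'n" and j
  proof (rule moment_coeffs[OF k _ that])
    fix t
    have "norm (x + t *\<^sub>R y) ^ 2 = ((norm x)^2 + 2 * t * (x \<bullet> y) + t^2 * (norm y)^2)^1"
      unfolding norm_add_scaleR_sq[symmetric] by (simp flip: power_mult)
    also have "\<dots> = (\<Sum>j\<le>2. [norm x ^ 2, 2*(x \<bullet> y), norm y ^ 2] ! j * t ^ j)"
      by (simp add: eval_nat_numeral algebra_simps)
    finally show "k * norm (x + t *\<^sub>R y) ^ 2 = (\<Sum>j\<le>2. k * [norm x ^ 2, 2*(x \<bullet> y), norm y ^ 2] ! j * t ^ j)"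
      by (simp add: sum_distrib_left mult.assoc)
  qed
  then show thesis by (rule that)
qed

lemma moment_coeffs_2:
  obtains k where "\<And>(x::real^'n) y j. j \<le> 4 \<Longrightarrow>
    of_nat (4 choose j) * moment (4 - j) j x y
        = k * [norm x ^ 4, 4*(x \<bullet> y)*norm x ^ 2, 4*(x \<bullet> y)^2+2*norm x ^ 2*norm y ^ 2, 4*(x \<bullet> y)*norm y ^ 2,
            norm y ^ 4] ! j"
proof -
  obtain k where k: "\<And>u :: real^'n. moment 4 0 u 0 = k * norm u ^ 4" by (rule moment_power[of 4]) auto
  have "of_nat (4 choose j) * moment (4 - j) j x y
      = k * [norm x ^ 4, 4*(x \<bullet> y)*norm x ^ 2, 4*(x \<bullet> y)^2+2*norm x ^ 2*norm y ^ 2, 4*(x \<bullet> y)*norm y ^ 2,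
          norm y ^ 4] ! j" if "j \<le> 4" for x y :: "real^'n" and j
  proof (rule moment_coeffs[OF k _ that])
    fix t
    have "norm (x + t *\<^sub>R y) ^ 4 = ((norm x)^2 + 2 * t * (x \<bullet> y) + t^2 * (norm y)^2)^2"
      unfolding norm_add_scaleR_sq[symmetric] by (simp flip: power_mult)
    also have "\<dots> = (\<Sum>j\<le>4. [norm x ^ 4, 4*(x \<bullet> y)*norm x ^ 2, 4*(x \<bullet> y)^2+2*norm x ^ 2*norm y ^ 2, 4*(x \<bullet>
        y)*norm y ^ 2, norm y ^ 4] ! j * t ^ j)"
      by (simp add: eval_nat_numeral algebra_simps)
    finally show "k * norm (x + t *\<^sub>R y) ^ 4
        = (\<Sum>j\<le>4. k * [norm x ^ 4, 4*(x \<bullet> y)*norm x ^ 2, 4*(x \<bullet> y)^2+2*norm x ^ 2*norm y ^ 2, 4*(x \<bullet> y)*norm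
            y ^ 2, norm y ^ 4] ! j * t ^ j)"
      by (simp add: sum_distrib_left mult.assoc)
  qed
  then show thesis by (rule that)
qed

lemma moment_coeffs_3:
  obtains k where "\<And>(x::real^'n) y j. j \<le> 6 \<Longrightarrow>
    of_nat (6 choose j) * moment (6 - j) j x y
        = k * [norm x ^ 6, 6*(x \<bullet> y)*norm x ^ 4, 12*(x \<bullet> y)^2*norm x ^ 2+3*norm x ^ 4*norm y ^ 2, 8*(x \<bullet>
            y)^3+12*(x \<bullet> y)*norm x ^ 2*norm y ^ 2, 12*(x \<bullet> y)^2*norm y ^ 2+3*norm x ^ 2*norm y ^ 4, 6*(x \<bullet>
                y)*norm y ^ 4, norm y ^ 6] ! j"
proof -
  obtain k where k: "\<And>u :: real^'n. moment 6 0 u 0 = k * norm u ^ 6" by (rule moment_power[of 6]) auto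
  have "of_nat (6 choose j) * moment (6 - j) j x y
      = k * [norm x ^ 6, 6*(x \<bullet> y)*norm x ^ 4, 12*(x \<bullet> y)^2*norm x ^ 2+3*norm x ^ 4*norm y ^ 2, 8*(x \<bullet>
          y)^3+12*(x \<bullet> y)*norm x ^ 2*norm y ^ 2, 12*(x \<bullet> y)^2*norm y ^ 2+3*norm x ^ 2*norm y ^ 4, 6*(x \<bullet>
              y)*norm y ^ 4, norm y ^ 6] ! j" if "j \<le> 6" for x y :: "real^'n" and j
  proof (rule moment_coeffs[OF k _ that])
    fix t
    have "norm (x + t *\<^sub>R y) ^ 6 = ((norm x)^2 + 2 * t * (x \<bullet> y) + t^2 * (norm y)^2)^3"
      unfolding norm_add_scaleR_sq[symmetric] by (simp flip: power_mult)
    also have "\<dots> = (\<Sum>j\<le>6. [norm x ^ 6, 6*(x \<bullet> y)*norm x ^ 4, 12*(x \<bullet> y)^2*norm x ^ 2+3*norm x ^ 4*norm y ^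
        2, 8*(x \<bullet> y)^3+12*(x \<bullet> y)*norm x ^ 2*norm y ^ 2, 12*(x \<bullet> y)^2*norm y ^ 2+3*norm x ^ 2*norm y ^ 4,
            6*(x \<bullet> y)*norm y ^ 4, norm y ^ 6] ! j * t ^ j)"
      by (simp add: eval_nat_numeral algebra_simps)
    finally show "k * norm (x + t *\<^sub>R y) ^ 6
        = (\<Sum>j\<le>6. k * [norm x ^ 6, 6*(x \<bullet> y)*norm x ^ 4, 12*(x \<bullet> y)^2*norm x ^ 2+3*norm x ^ 4*norm y ^ 2,
            8*(x \<bullet> y)^3+12*(x \<bullet> y)*norm x ^ 2*norm y ^ 2, 12*(x \<bullet> y)^2*norm y ^ 2+3*norm x ^ 2*norm y ^ 4,
                6*(x \<bullet> y)*norm y ^ 4, norm y ^ 6] ! j * t ^ j)"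
      by (simp add: sum_distrib_left mult.assoc)
  qed
  then show thesis by (rule that)
qed

lemma moment_coeffs_4:
  obtains k where "\<And>(x::real^'n) y j. j \<le> 8 \<Longrightarrow>
    of_nat (8 choose j) * moment (8 - j) j x y
        = k * [norm x ^ 8, 8*(x \<bullet> y)*norm x ^ 6, 24*(x \<bullet> y)^2*norm x ^ 4+4*norm x ^ 6*norm y ^ 2, 32*(x \<bullet>
            y)^3*norm x ^ 2+24*(x \<bullet> y)*norm x ^ 4*norm y ^ 2, 16*(x \<bullet> y)^4+48*(x \<bullet> y)^2*norm x ^ 2*norm y ^
                2+6*norm x ^ 4*norm y ^ 4, 32*(x \<bullet> y)^3*norm y ^ 2+24*(x \<bullet> y)*norm x ^ 2*norm y ^ 4, 24*(x \<bullet>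
                y)^2*norm y ^ 4+4*norm x ^ 2*norm y ^ 6, 8*(x \<bullet> y)*norm y ^ 6, norm y ^ 8] ! j"
proof -
  obtain k where k: "\<And>u :: real^'n. moment 8 0 u 0 = k * norm u ^ 8" by (rule moment_power[of 8]) auto
  have "of_nat (8 choose j) * moment (8 - j) j x y
      = k * [norm x ^ 8, 8*(x \<bullet> y)*norm x ^ 6, 24*(x \<bullet> y)^2*norm x ^ 4+4*norm x ^ 6*norm y ^ 2, 32*(x \<bullet>
          y)^3*norm x ^ 2+24*(x \<bullet> y)*norm x ^ 4*norm y ^ 2, 16*(x \<bullet> y)^4+48*(x \<bullet> y)^2*norm x ^ 2*norm y ^
              2+6*norm x ^ 4*norm y ^ 4, 32*(x \<bullet> y)^3*norm y ^ 2+24*(x \<bullet> y)*norm x ^ 2*norm y ^ 4, 24*(x \<bullet>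
                y)^2*norm y ^ 4+4*norm x ^ 2*norm y ^ 6, 8*(x \<bullet> y)*norm y ^ 6, norm y ^ 8] ! j" if "j
                \<le> 8" for x y :: "real^'n" and j
  proof (rule moment_coeffs[OF k _ that])
    fix t
    have "norm (x + t *\<^sub>R y) ^ 8 = ((norm x)^2 + 2 * t * (x \<bullet> y) + t^2 * (norm y)^2)^4"
      unfolding norm_add_scaleR_sq[symmetric] by (simp flip: power_mult)
    also have "\<dots> = (\<Sum>j\<le>8. [norm x ^ 8, 8*(x \<bullet> y)*norm x ^ 6, 24*(x \<bullet> y)^2*norm x ^ 4+4*norm x ^ 6*norm y ^
        2, 32*(x \<bullet> y)^3*norm x ^ 2+24*(x \<bullet> y)*norm x ^ 4*norm y ^ 2, 16*(x \<bullet> y)^4+48*(x \<bullet> y)^2*norm x ^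
            2*norm y ^ 2+6*norm x ^ 4*norm y ^ 4, 32*(x \<bullet> y)^3*norm y ^ 2+24*(x \<bullet> y)*norm x ^ 2*norm y ^ 4,
                24*(x \<bullet> y)^2*norm y ^ 4+4*norm x ^ 2*norm y ^ 6, 8*(x \<bullet> y)*norm y ^ 6, norm y ^ 8] ! j * t ^
                j)"
      by (simp add: eval_nat_numeral algebra_simps)
    finally show "k * norm (x + t *\<^sub>R y) ^ 8
        = (\<Sum>j\<le>8. k * [norm x ^ 8, 8*(x \<bullet> y)*norm x ^ 6, 24*(x \<bullet> y)^2*norm x ^ 4+4*norm x ^ 6*norm y ^ 2,
            32*(x \<bullet> y)^3*norm x ^ 2+24*(x \<bullet> y)*norm x ^ 4*norm y ^ 2, 16*(x \<bullet> y)^4+48*(x \<bullet> y)^2*norm x ^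
                2*norm y ^ 2+6*norm x ^ 4*norm y ^ 4, 32*(x \<bullet> y)^3*norm y ^ 2+24*(x \<bullet> y)*norm x ^ 2*norm y ^
                4, 24*(x \<bullet> y)^2*norm y ^ 4+4*norm x ^ 2*norm y ^ 6, 8*(x \<bullet> y)*norm y ^ 6, norm y ^ 8] ! j *
                t ^ j)"
      by (simp add: sum_distrib_left mult.assoc)
  qed
  then show thesis by (rule that)
qed

lemma eq_divide_from_scaled:
  fixes X :: real
  assumes "m * X = k * E" "k = p / D" "p * E = m * F" "m \<noteq> 0"
  shows "X = F / D"
proof -
  have "m * X = m * (F / D)" using assms by simp
  then show ?thesis using mult_left_cancel[OF assms(4)] by blast
qed

lemma moment_deg2:
  fixes x y :: "real^'n"
  shows "moment 2 0 x y = norm x ^ 2 / CARD('n)" "moment 1 1 x y = (x \<bullet> y) / CARD('n)"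
proof -
  obtain k where k: "\<And>(x::real^'n) y j. j \<le> 2 \<Longrightarrow>
    of_nat (2 choose j) * moment (2 - j) j x y = k * [norm x ^ 2, 2*(x \<bullet> y), norm y ^ 2] ! j"
    by (rule moment_coeffs_1) blast
  have "1 = (\<Sum>e\<in>(Basis::(real^'n) set). moment 0 2 x e)"
    by (subst moment_last_sum[where v = 0]) (simp add: moment_0_0)
  also have "\<dots> = (\<Sum>e\<in>(Basis::(real^'n) set). k)"
    using k[of 2 x] by (intro sum.cong) auto
  finally have k1: "k = 1 / CARD('n)" by (simp add: field_simps)
  show "moment 2 0 x y = norm x ^ 2 / CARD('n)" using k[of 0 x y] by (simp add: k1)
  show "moment 1 1 x y = (x \<bullet> y) / CARD('n)" using k[of 1 x y] by (simp add: k1)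
qed

lemma moment_deg4:
  fixes x y :: "real^'n"
  defines "n \<equiv> real CARD('n)"
  shows "moment 4 0 x y = 3 * norm x ^ 4 / (n * (n + 2))"
    "moment 3 1 x y = 3 * norm x ^ 2 * (x \<bullet> y) / (n * (n + 2))"
    "moment 2 2 x y = (2 * (x \<bullet> y)^2 + norm x ^ 2 * norm y ^ 2) / (n * (n + 2))"
proof -
  obtain k where k: "\<And>(x::real^'n) y j. j \<le> 4 \<Longrightarrow>
    of_nat (4 choose j) * moment (4 - j) j x y
        = k * [norm x ^ 4, 4*(x \<bullet> y)*norm x ^ 2, 4*(x \<bullet> y)^2+2*norm x ^ 2*norm y ^ 2, 4*(x \<bullet> y)*norm y ^ 2,
            norm y ^ 4] ! j"
    by (rule moment_coeffs_2) blast
  have n: "n > 0" unfolding n_def by simp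
  obtain u :: "real^'n" where u: "norm u = 1" using vector_choose_size[of 1] by auto
  \<comment> \<open>Tracing out the second argument leaves the known moment of degree 2 and so an
    equation for k. The same step in degrees 6 and 8 produces the numerators 15 and 105.\<close>
  have "1 / n = (\<Sum>e\<in>(Basis::(real^'n) set). moment 2 2 u e)"
    unfolding moment_last_sum[where v = 0] moment_deg2 u n_def by simp
  also have "\<dots> = (\<Sum>e\<in>(Basis::(real^'n) set). k * (4 * (u \<bullet> e)^2 + 2) / 6)"
  proof (rule sum.cong)
    fix e :: "real^'n" assume "e \<in> Basis"
    then show "moment 2 2 u e = k * (4 * (u \<bullet> e)^2 + 2) / 6"
      using k[of 2 u e] by (simp add: u eval_nat_numeral)
  qed simp
  also have "\<dots> = k * (4 + 2 * n) / 6"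
    unfolding sum_divide_distrib[symmetric] sum_distrib_left[symmetric] sum.distrib sum_Basis_inner_sq[OF u]
        n_def by simp
  finally have "k * (n + 2) = 3 / n" by (simp add: field_simps)
  then have "k = 3 / n / (n + 2)" using n by (simp add: eq_divide_eq mult_ac)
  then have k1: "k = 3 / (n * (n + 2))" by simp
  show "moment 4 0 x y = 3 * norm x ^ 4 / (n * (n + 2))" using k[of 0 x y] by (simp add: k1)
  have E31: "4 * moment 3 1 x y = k * (4*(x \<bullet> y)*norm x ^ 2)"
    using k[of 1 x y] by (simp add: eval_nat_numeral algebra_simps)
  show "moment 3 1 x y = 3 * norm x ^ 2 * (x \<bullet> y) / (n * (n + 2))" 
    by (rule eq_divide_from_scaled[OF E31 k1]) (simp_all add: algebra_simps)
  have E22: "6 * moment 2 2 x y = k * (4*(x \<bullet> y)^2+2*norm x ^ 2*norm y ^ 2)"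
    using k[of 2 x y] by (simp add: eval_nat_numeral algebra_simps)
  show "moment 2 2 x y = (2 * (x \<bullet> y)^2 + norm x ^ 2 * norm y ^ 2) / (n * (n + 2))"
    by (rule eq_divide_from_scaled[OF E22 k1]) (simp_all add: algebra_simps)
qed

lemma moment_deg6:
  fixes x y :: "real^'n"
  defines "n \<equiv> real CARD('n)"
  shows "moment 6 0 x y = 15 * norm x ^ 6 / (n * (n + 2) * (n + 4))"
    "moment 4 2 x y = (12 * (x \<bullet> y)^2 * norm x ^ 2 + 3 * norm x ^ 4 * norm y ^ 2) / (n * (n + 2) * (n + 4))"
    "moment 3 3 x y = (6 * (x \<bullet> y)^3 + 9 * (x \<bullet> y) * norm x ^ 2 * norm y ^ 2) / (n * (n + 2) * (n + 4))"
proof -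
  obtain k where k: "\<And>(x::real^'n) y j. j \<le> 6 \<Longrightarrow>
    of_nat (6 choose j) * moment (6 - j) j x y
        = k * [norm x ^ 6, 6*(x \<bullet> y)*norm x ^ 4, 12*(x \<bullet> y)^2*norm x ^ 2+3*norm x ^ 4*norm y ^ 2, 8*(x \<bullet>
            y)^3+12*(x \<bullet> y)*norm x ^ 2*norm y ^ 2, 12*(x \<bullet> y)^2*norm y ^ 2+3*norm x ^ 2*norm y ^ 4, 6*(x \<bullet>
                y)*norm y ^ 4, norm y ^ 6] ! j"
    by (rule moment_coeffs_3) blast
  have n: "n > 0" unfolding n_def by simp
  obtain u :: "real^'n" where u: "norm u = 1" using vector_choose_size[of 1] by auto
  have "3 / (n * (n + 2)) = (\<Sum>e\<in>(Basis::(real^'n) set). moment 4 2 u e)"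
    unfolding moment_last_sum[where v = 0] moment_deg4 u n_def by simp
  also have "\<dots> = (\<Sum>e\<in>(Basis::(real^'n) set). k * (12 * (u \<bullet> e)^2 + 3) / 15)"
  proof (rule sum.cong)
    fix e :: "real^'n" assume "e \<in> Basis"
    then show "moment 4 2 u e = k * (12 * (u \<bullet> e)^2 + 3) / 15"
      using k[of 2 u e] by (simp add: u eval_nat_numeral)
  qed simp
  also have "\<dots> = k * (12 + 3 * n) / 15"
    unfolding sum_divide_distrib[symmetric] sum_distrib_left[symmetric] sum.distrib sum_Basis_inner_sq[OF u]
        n_def by simp
  finally have "k * (n + 4) = 15 / (n * (n + 2))" by (simp add: field_simps)
  then have "k = 15 / (n * (n + 2)) / (n + 4)" using n by (simp add: eq_divide_eq mult_ac)
  then have k1: "k = 15 / (n * (n + 2) * (n + 4))" by simp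
  show "moment 6 0 x y = 15 * norm x ^ 6 / (n * (n + 2) * (n + 4))" using k[of 0 x y] by (simp add: k1)
  have E42: "15 * moment 4 2 x y = k * (12*(x \<bullet> y)^2*norm x ^ 2+3*norm x ^ 4*norm y ^ 2)"
    using k[of 2 x y] by (simp add: eval_nat_numeral algebra_simps)
  show "moment 4 2 x y = (12 * (x \<bullet> y)^2 * norm x ^ 2 + 3 * norm x ^ 4 * norm y ^ 2) / (n * (n + 2) * (n
      + 4))"
    by (rule eq_divide_from_scaled[OF E42 k1]) (simp_all add: algebra_simps)
  have E33: "20 * moment 3 3 x y = k * (8*(x \<bullet> y)^3+12*(x \<bullet> y)*norm x ^ 2*norm y ^ 2)"
    using k[of 3 x y] by (simp add: eval_nat_numeral algebra_simps)
  show "moment 3 3 x y = (6 * (x \<bullet> y)^3 + 9 * (x \<bullet> y) * norm x ^ 2 * norm y ^ 2) / (n * (n + 2) * (n + 4))"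
    by (rule eq_divide_from_scaled[OF E33 k1]) (simp_all add: algebra_simps)
qed

lemma moment_4_4:
  fixes x y :: "real^'n"
  defines "n \<equiv> real CARD('n)"
  shows "moment 4 4 x y = (24 * (x \<bullet> y)^4 + 72 * (x \<bullet> y)^2 * norm x ^ 2 * norm y ^ 2
      + 9 * norm x ^ 4 * norm y ^ 4)
     / (n * (n + 2) * (n + 4) * (n + 6))"
proof -
  obtain k where k: "\<And>(x::real^'n) y j. j \<le> 8 \<Longrightarrow>
    of_nat (8 choose j) * moment (8 - j) j x y
        = k * [norm x ^ 8, 8*(x \<bullet> y)*norm x ^ 6, 24*(x \<bullet> y)^2*norm x ^ 4+4*norm x ^ 6*norm y ^ 2, 32*(x \<bullet>
            y)^3*norm x ^ 2+24*(x \<bullet> y)*norm x ^ 4*norm y ^ 2, 16*(x \<bullet> y)^4+48*(x \<bullet> y)^2*norm x ^ 2*norm y ^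
                2+6*norm x ^ 4*norm y ^ 4, 32*(x \<bullet> y)^3*norm y ^ 2+24*(x \<bullet> y)*norm x ^ 2*norm y ^ 4, 24*(x \<bullet>
                y)^2*norm y ^ 4+4*norm x ^ 2*norm y ^ 6, 8*(x \<bullet> y)*norm y ^ 6, norm y ^ 8] ! j"
    by (rule moment_coeffs_4) blast
  have n: "n > 0" unfolding n_def by simp
  obtain u :: "real^'n" where u: "norm u = 1" using vector_choose_size[of 1] by auto
  have "15 / (n * (n + 2) * (n + 4)) = (\<Sum>e\<in>(Basis::(real^'n) set). moment 6 2 u e)"
    unfolding moment_last_sum[where v = 0] moment_deg6 u n_def by simp
  also have "\<dots> = (\<Sum>e\<in>(Basis::(real^'n) set). k * (24 * (u \<bullet> e)^2 + 4) / 28)"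
  proof (rule sum.cong)
    fix e :: "real^'n" assume "e \<in> Basis"
    then show "moment 6 2 u e = k * (24 * (u \<bullet> e)^2 + 4) / 28"
      using k[of 2 u e] by (simp add: u eval_nat_numeral)
  qed simp
  also have "\<dots> = k * (24 + 4 * n) / 28"
    unfolding sum_divide_distrib[symmetric] sum_distrib_left[symmetric] sum.distrib sum_Basis_inner_sq[OF u]
        n_def by simp
  finally have "k * (n + 6) = 105 / (n * (n + 2) * (n + 4))" by (simp add: field_simps)
  then have "k = 105 / (n * (n + 2) * (n + 4)) / (n + 6)" using n by (simp add: eq_divide_eq mult_ac)
  then have k1: "k = 105 / (n * (n + 2) * (n + 4) * (n + 6))" by simp
  have "70 * moment 4 4 x y = k * (16*(x \<bullet> y)^4+48*(x \<bullet> y)^2*norm x ^ 2*norm y ^ 2+6*norm x ^ 4*norm y ^ 4)"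
    using k[of 4 x y] by (simp add: eval_nat_numeral)
  then show ?thesis by (rule eq_divide_from_scaled[OF _ k1]) (simp_all add: algebra_simps)
qed

section \<open>Zonal kernels\<close>

lemma usphere_quartic:
  fixes x y :: "real^'n"
  shows "(\<integral>z. (a4 * (x \<bullet> z)^4 + a2 * (x \<bullet> z)^2 + a0) * (b4 * (y \<bullet> z)^4 + b2 * (y \<bullet> z)^2 + b0) \<partial>usphere)
    = a4 * b4 * moment 4 4 x y + a4 * b2 * moment 4 2 x y + a4 * b0 * moment 4 0 x y
    + a2 * b4 * moment 4 2 y x + a2 * b2 * moment 2 2 x y + a2 * b0 * moment 2 0 x y
    + a0 * b4 * moment 4 0 y x + a0 * b2 * moment 2 0 y x + a0 * b0"
proof -
  have "(\<integral>z. (a4 * (x \<bullet> z)^4 + a2 * (x \<bullet> z)^2 + a0) * (b4 * (y \<bullet> z)^4 + b2 * (y \<bullet> z)^2 + b0) \<partial>usphere)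
    = (\<integral>z. a4 * b4 * ((x \<bullet> z)^4 * (y \<bullet> z)^4) + a4 * b2 * ((x \<bullet> z)^4 * (y \<bullet> z)^2)
        + a4 * b0 * ((x \<bullet> z)^4 * (y \<bullet> z)^0)
    + a2 * b4 * ((y \<bullet> z)^4 * (x \<bullet> z)^2) + a2 * b2 * ((x \<bullet> z)^2 * (y \<bullet> z)^2)
        + a2 * b0 * ((x \<bullet> z)^2 * (y \<bullet> z)^0)
    + a0 * b4 * ((y \<bullet> z)^4 * (x \<bullet> z)^0) + a0 * b2 * ((y \<bullet> z)^2 * (x \<bullet> z)^0)
        + a0 * b0 * ((x \<bullet> z)^0 * (y \<bullet> z)^0) \<partial>usphere)"
    by (simp add: algebra_simps)
  also have "\<dots> = a4 * b4 * moment 4 4 x y + a4 * b2 * moment 4 2 x y + a4 * b0 * moment 4 0 x y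
    + a2 * b4 * moment 4 2 y x + a2 * b2 * moment 2 2 x y + a2 * b0 * moment 2 0 x y
    + a0 * b4 * moment 4 0 y x + a0 * b2 * moment 2 0 y x + a0 * b0 * moment 0 0 x y"
    unfolding moment_def
    by (simp only: Bochner_Integration.integral_add Bochner_Integration.integrable_add
        integrable_mult_right integral_mult_right_zero integrable_moment)
  finally show ?thesis by (simp add: moment_0_0)
qed

text \<open>Reproducing kernels, extended homogeneously in both arguments, of the harmonic polynomials
  of degree 4 and of the even polynomials of degree at most 2 on the unit sphere.\<close>

definition zonal4 :: "real^'n \<Rightarrow> real^'n \<Rightarrow> real" where
  "zonal4 x z = (let n = real CARD('n) in n * (n + 6) / 24 * ((n + 4) * (n + 2) * (x \<bullet> z)^4
     - 6 * (n + 2) * (x \<bullet> z)^2 * norm x ^ 2 * norm z ^ 2 + 3 * norm x ^ 4 * norm z ^ 4))"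

definition zonal2 :: "real^'n \<Rightarrow> real^'n \<Rightarrow> real" where
  "zonal2 x z = (let n = real CARD('n) in n * (n + 2) / 2 * (x \<bullet> z)^2 - n / 2 * norm x ^ 2 * norm z ^ 2)"

lemma continuous_zonal [continuous_intros]:
  "continuous_on S (zonal4 x)" "continuous_on S (zonal2 x)"
  unfolding zonal4_def zonal2_def Let_def by (intro continuous_intros)+

lemma zonal_commute: "zonal4 x z = zonal4 z x" "zonal2 x z = zonal2 z x"
  by (simp_all add: zonal4_def zonal2_def inner_commute mult_ac)

lemma zonal4_unit:
  fixes x z :: "real^'n"
  assumes "norm z = 1" and "n = real CARD('n)" and "N = n * (n + 2)" and "P = norm x ^ 2"
  shows "zonal4 x z = N * (n + 4) * (n + 6) / 24 * (x \<bullet> z)^4 + (- N * (n + 6) / 4 * P) * (x \<bullet> z)^2 + n * (n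
      + 6) / 8 * P^2"
proof -
  have "norm x ^ 4 = P^2" unfolding assms by (simp flip: power_mult)
  then show ?thesis unfolding zonal4_def Let_def assms(1) assms(2)[symmetric] assms(4)[symmetric]
    by (simp add: assms(3) field_simps)
qed

lemma zonal2_unit:
  fixes x z :: "real^'n"
  assumes "norm z = 1" and "n = real CARD('n)" and "N = n * (n + 2)" and "P = norm x ^ 2"
  shows "zonal2 x z = 0 * (x \<bullet> z)^4 + N / 2 * (x \<bullet> z)^2 + (- n / 2 * P)"
  unfolding zonal2_def Let_def assms(1) assms(2)[symmetric] assms(4)[symmetric]
  by (simp add: assms(3) algebra_simps)

text \<open>Integration with explicit moments takes the place of the theory of spherical harmonics.
  Only z is confined to the sphere; x and y are arbitrary because the kernels are homogeneous in
  them.\<close>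

lemma zonal_convolution:
  fixes x y :: "real^'n"
  shows "(\<integral>z. zonal4 x z * zonal4 y z \<partial>usphere) = zonal4 x y" (is ?A)
    and "(\<integral>z. zonal4 x z * zonal2 y z \<partial>usphere) = 0" (is ?B)
    and "(\<integral>z. zonal2 x z * zonal2 y z \<partial>usphere) = zonal2 x y" (is ?C)
proof -
  define n where "n = real CARD('n)"
  have n: "n > 0" by (simp add: n_def)
  define P where "P = norm x ^ 2"
  define Q where "Q = norm y ^ 2"
  define c where "c = x \<bullet> y"
  have n0: "n \<noteq> 0" "n + 2 \<noteq> 0" "n + 4 \<noteq> 0" "n + 6 \<noteq> 0" using n by auto
  have pow4: "norm x ^ 4 = P^2" "norm y ^ 4 = Q^2" unfolding P_def Q_def by (simp_all flip: power_mult)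
  define m44 m42 m42' m22 m4 m4' m2 m2' where "m44 = moment 4 4 x y" and "m42 = moment 4 2 x y" and "m42'
      = moment 4 2 y x"
    and "m22 = moment 2 2 x y" and "m4 = moment 4 0 x y" and "m4' = moment 4 0 y x" and "m2
        = moment 2 0 x y" and "m2' = moment 2 0 y x"
  note mdefs = m44_def m42_def m42'_def m22_def m4_def m4'_def m2_def m2'_def
  note folds = pow4 n_def[symmetric] P_def[symmetric] Q_def[symmetric] inner_commute[of y x] c_def[symmetric]
  define N where "N = n * (n + 2)"
  have N: "N \<noteq> 0" using n0 unfolding N_def by simp
  \<comment> \<open>The moments are kept multiplied by their denominators, and \<open>A\<close>,
    \<open>B\<close> contain these denominators, so the final identities are polynomial in n, P, Q
    and c.\<close>
  have ms: "N * ((n + 4) * (n + 6)) * m44 = 24 * c^4 + 72 * c^2 * P * Q + 9 * P^2 * Q^2"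
    "N * (n + 4) * m42 = 12 * c^2 * P + 3 * P^2 * Q" "N * (n + 4) * m42' = 12 * c^2 * Q + 3 * Q^2 * P"
    "N * m22 = 2 * c^2 + P * Q" "N * m4 = 3 * P^2" "N * m4' = 3 * Q^2" "n * m2 = P" "n * m2' = Q"
    unfolding mdefs moment_4_4 moment_deg4 moment_deg2 moment_deg6(2) folds using n0 N
    by (simp_all add: N_def[symmetric] mult.assoc[symmetric])
  note z4 = zonal4_unit[OF _ n_def N_def P_def] zonal4_unit[OF _ n_def N_def Q_def]
  note z2 = zonal2_unit[OF _ n_def N_def P_def] zonal2_unit[OF _ n_def N_def Q_def]
  define A where "A = N * (n + 4) * (n + 6) / 24"
  define B where "B = N * (n + 6) / 4"
  define C where "C = n * (n + 6) / 8"
  note AB = A_def[symmetric] B_def[symmetric] C_def[symmetric]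
  have A: "A * m44 = (24 * c^4 + 72 * c^2 * P * Q + 9 * P^2 * Q^2) / 24"
    "A * m42 = (n + 6) / 24 * (12 * c^2 * P + 3 * P^2 * Q)" "A * m42' = (n + 6) / 24 * (12 * c^2 * Q
        + 3 * Q^2 * P)"
    unfolding A_def ms(1-3)[symmetric] by (simp_all add: field_simps)
  have A4: "A * m4 = (n + 4) * (n + 6) / 24 * (3 * P^2)" "A * m4' = (n + 4) * (n + 6) / 24 * (3 * Q^2)"
    unfolding A_def ms(5,6)[symmetric] by (simp_all add: field_simps)
  have B: "B * m22 = (n + 6) / 4 * (2 * c^2 + P * Q)"
    unfolding B_def ms(4)[symmetric] by (simp add: mult_ac)
  have B2: "B * m2 = (n + 2) * (n + 6) / 4 * P"
    unfolding B_def N_def ms(7)[symmetric] by (simp add: mult_ac)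
  have B2': "B * m2' = (n + 2) * (n + 6) / 4 * Q"
    unfolding B_def N_def ms(8)[symmetric] by (simp add: mult_ac)
  show ?A
  proof -
    have "(\<integral>z. zonal4 x z * zonal4 y z \<partial>usphere) =
     (\<integral>z. (A * (x \<bullet> z)^4 + (- (B * P)) * (x \<bullet> z)^2 + C * P^2)
        * (A * (y \<bullet> z)^4 + (- (B * Q)) * (y \<bullet> z)^2 + C * Q^2) \<partial>usphere)"
      by (rule usphere_cong) (simp only: z4 AB minus_mult_left[symmetric] minus_divide_left[symmetric],
          (intro continuous_intros)+)
    also have "\<dots> = A * (A * m44) - (B * Q) * (A * m42) + (C * Q^2) * (A * m4) - (B * P) * (A * m42')
        + (B * P * Q) * (B * m22) - (C * Q^2 * P) * (B * m2) + (C * P^2) * (A * m4')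
            - (C * P^2 * Q) * (B * m2') + C * P^2 * (C * Q^2)"
      unfolding usphere_quartic mdefs[symmetric] by (simp add: algebra_simps)
    also have "\<dots> = zonal4 x y"
      unfolding A A4 B B2 B2' unfolding zonal4_def Let_def folds A_def B_def C_def N_def
      by (simp add: field_simps power2_eq_square power4_eq_xxxx)
    finally show ?thesis .
  qed
  show ?B
  proof -
    have "(\<integral>z. zonal4 x z * zonal2 y z \<partial>usphere) =
     (\<integral>z. (A * (x \<bullet> z)^4 + (- (B * P)) * (x \<bullet> z)^2 + C * P^2)
        * (0 * (y \<bullet> z)^4 + N / 2 * (y \<bullet> z)^2 + (- (n / 2 * Q))) \<partial>usphere)"
      by (rule usphere_cong) (simp only: z4 z2 AB minus_mult_left[symmetric] minus_divide_left[symmetric],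
          (intro continuous_intros)+)
    also have "\<dots> = (N / 2) * (A * m42) - (n / 2 * Q) * (A * m4) - (P * N / 2) * (B * m22)
        + (n / 2 * Q * P) * (B * m2) + (C * P^2 / 2 * (n + 2)) * (n * m2')
        - C * P^2 * (n / 2 * Q)"
      unfolding usphere_quartic mdefs[symmetric] by (simp add: N_def field_simps)
    also have "\<dots> = 0"
      unfolding A A4 B B2 B2' ms unfolding C_def N_def
      by (simp add: field_simps power2_eq_square power4_eq_xxxx)
    finally show ?thesis .
  qed
  show ?C
  proof -
    have "(\<integral>z. zonal2 x z * zonal2 y z \<partial>usphere) =
     (\<integral>z. (0 * (x \<bullet> z)^4 + N / 2 * (x \<bullet> z)^2 + (- (n / 2 * P))) * (0 * (y \<bullet> z)^4 + N / 2 * (y \<bullet> z)^2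
         + (- (n / 2 * Q))) \<partial>usphere)"
      by (rule usphere_cong) (simp only: z2 minus_mult_left[symmetric] minus_divide_left[symmetric], (intro
          continuous_intros)+)
    also have "\<dots> = N / 4 * (N * m22) - (N / 4 * Q) * (n * m2) - (N / 4 * P) * (n * m2')
        + n / 2 * P * (n / 2 * Q)"
      unfolding usphere_quartic mdefs[symmetric] by (simp add: algebra_simps)
    also have "\<dots> = zonal2 x y"
      unfolding ms zonal2_def Let_def folds by (simp add: N_def algebra_simps power2_eq_square)
    finally show ?thesis .
  qed
qed

section \<open>The kernel of a tight design\<close>

lemma plus_minus_trans:
  fixes a b t :: "'a::group_add"
  shows "t = a \<or> t = - a \<Longrightarrow> t = b \<or> t = - b \<Longrightarrow> a = b \<or> a = - b"
  by auto

section \<open>Closure rules for polynomials of bounded degree\<close>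

lemma poly_deg_le_const: "poly_deg_le t (\<lambda>x::real^'n. c)"
  unfolding poly_deg_le_def
  by (rule exI[of _ "{\<lambda>_. 0}"], rule exI[of _ "\<lambda>_. c"]) (simp add: mdeg_def monomial_def)

lemma poly_deg_le_add:
  fixes f g :: "real^'n \<Rightarrow> real"
  assumes "poly_deg_le t f" "poly_deg_le t g"
  shows "poly_deg_le t (\<lambda>x. f x + g x)"
proof -
  obtain A c B d where A: "finite A" "\<forall>\<alpha>\<in>A. mdeg \<alpha> \<le> t" "f = (\<lambda>x. \<Sum>\<alpha>\<in>A. c \<alpha> * monomial \<alpha> x)"
    and B: "finite B" "\<forall>\<alpha>\<in>B. mdeg \<alpha> \<le> t" "g = (\<lambda>x. \<Sum>\<alpha>\<in>B. d \<alpha> * monomial \<alpha> x)"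
    using assms unfolding poly_deg_le_def by blast
  have "(\<Sum>\<alpha>\<in>A \<union> B. ((if \<alpha> \<in> A then c \<alpha> else 0) + (if \<alpha> \<in> B then d \<alpha> else 0)) * monomial \<alpha> x) = f x
      + g x" for x
  proof -
    have "(\<Sum>\<alpha>\<in>A \<union> B. (if \<alpha> \<in> A then c \<alpha> else 0) * monomial \<alpha> x) = f x"
      unfolding A using A B by (intro sum.mono_neutral_cong_right) auto
    moreover have "(\<Sum>\<alpha>\<in>A \<union> B. (if \<alpha> \<in> B then d \<alpha> else 0) * monomial \<alpha> x) = g x"
      unfolding B using A B by (intro sum.mono_neutral_cong_right) auto
    ultimately show ?thesis by (simp add: distrib_right sum.distrib)
  qed
  then show ?thesis unfolding poly_deg_le_def using A B
    by (intro exI[of _ "A \<union> B"] exI[of _ "\<lambda>\<alpha>. (if \<alpha> \<in> A then c \<alpha> else 0) + (if \<alpha> \<in> B then d \<alpha> else 0)"]) auto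
qed

lemma poly_deg_le_sum:
  fixes f :: "'a \<Rightarrow> real^'n \<Rightarrow> real"
  assumes "finite I" "\<And>i. i \<in> I \<Longrightarrow> poly_deg_le t (f i)"
  shows "poly_deg_le t (\<lambda>x. \<Sum>i\<in>I. f i x)"
  using assms by (induction I rule: finite_induct) (auto intro: poly_deg_le_const poly_deg_le_add)

lemma poly_deg_le_monomial:
  fixes \<alpha> :: "'n::finite \<Rightarrow> nat"
  assumes "mdeg \<alpha> \<le> t"
  shows "poly_deg_le t (\<lambda>x. c * monomial \<alpha> x)"
  unfolding poly_deg_le_def using assms
  by (intro exI[of _ "{\<alpha>}"] exI[of _ "\<lambda>_. c"]) simp

lemma monomial_mult: "monomial \<alpha> x * monomial \<beta> x = monomial (\<lambda>i. \<alpha> i + \<beta> i) x"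
  by (simp add: monomial_def power_add prod.distrib)

lemma mdeg_add: "mdeg (\<lambda>i. \<alpha> i + \<beta> i) = mdeg \<alpha> + mdeg \<beta>"
  by (simp add: mdeg_def sum.distrib)

lemma poly_deg_le_mult:
  fixes f g :: "real^'n \<Rightarrow> real"
  assumes "poly_deg_le s f" "poly_deg_le t g" "s + t \<le> u"
  shows "poly_deg_le u (\<lambda>x. f x * g x)"
proof -
  obtain A c B d where A: "finite A" "\<forall>\<alpha>\<in>A. mdeg \<alpha> \<le> s" "f = (\<lambda>x. \<Sum>\<alpha>\<in>A. c \<alpha> * monomial \<alpha> x)"
    and B: "finite B" "\<forall>\<alpha>\<in>B. mdeg \<alpha> \<le> t" "g = (\<lambda>x. \<Sum>\<alpha>\<in>B. d \<alpha> * monomial \<alpha> x)"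
    using assms unfolding poly_deg_le_def by blast
  have "(\<lambda>x. f x * g x) = (\<lambda>x. \<Sum>\<alpha>\<in>A. \<Sum>\<beta>\<in>B. (c \<alpha> * d \<beta>) * monomial (\<lambda>i. \<alpha> i + \<beta> i) x)"
    unfolding A B sum_product by (simp add: mult_ac flip: monomial_mult)
  moreover have "poly_deg_le u \<dots>"
  proof (intro poly_deg_le_sum A B poly_deg_le_monomial)
    fix \<alpha> \<beta> assume "\<alpha> \<in> A" "\<beta> \<in> B"
    then have "mdeg \<alpha> + mdeg \<beta> \<le> s + t" using A B by (intro add_mono) auto
    then show "mdeg (\<lambda>i. \<alpha> i + \<beta> i) \<le> u" using assms(3) by (simp add: mdeg_add)
  qed
  ultimately show ?thesis by simp
qed

lemma poly_deg_le_component: "poly_deg_le 1 (\<lambda>x::real^'n. x $ i)"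
proof -
  have "(\<lambda>x::real^'n. x $ i) = (\<lambda>x. 1 * monomial (\<lambda>j. if j = i then 1 else 0) x)"
  proof
    fix x :: "real^'n"
    have "(\<Prod>j\<in>UNIV. x $ j ^ (if j = i then 1 else 0)) = (\<Prod>j\<in>UNIV. if j = i then x $ j else 1)"
      by (intro prod.cong) auto
    also have "\<dots> = x $ i" by simp
    finally show "x $ i = 1 * monomial (\<lambda>j. if j = i then 1 else 0) x"
      unfolding monomial_def by simp
  qed
  moreover have "mdeg (\<lambda>j. if j = i then 1 else 0) \<le> 1" by (simp add: mdeg_def)
  ultimately show ?thesis using poly_deg_le_monomial by metis
qed

lemma poly_deg_le_inner: "poly_deg_le 1 (\<lambda>z::real^'n. a \<bullet> z)"
  unfolding inner_vec_def inner_real_def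
  by (intro poly_deg_le_sum poly_deg_le_mult[OF poly_deg_le_const[of 0] poly_deg_le_component]) auto

lemma poly_deg_le_norm_sq: "poly_deg_le 2 (\<lambda>z::real^'n. norm z ^ 2)"
  unfolding power2_norm_eq_inner inner_vec_def inner_real_def
  by (intro poly_deg_le_sum poly_deg_le_mult[OF poly_deg_le_component poly_deg_le_component]) auto

lemma poly_deg_le_power:
  assumes "poly_deg_le s f" "k * s \<le> t"
  shows "poly_deg_le t (\<lambda>x. f x ^ k)"
proof -
  have "poly_deg_le (k * s) (\<lambda>x. f x ^ k)"
    by (induction k) (auto intro: poly_deg_le_const poly_deg_le_mult[OF assms(1)])
  from poly_deg_le_mult[OF this poly_deg_le_const[of 0 1]] assms(2) show ?thesis by simp
qed

lemma poly_deg_le_cmult: "poly_deg_le t f \<Longrightarrow> poly_deg_le t (\<lambda>x. c * f x)"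
  by (rule poly_deg_le_mult[OF poly_deg_le_const[of 0]]) auto

lemma poly_deg_le_diff: "poly_deg_le t f \<Longrightarrow> poly_deg_le t g \<Longrightarrow> poly_deg_le t (\<lambda>x. f x - g x)"
  using poly_deg_le_add[OF _ poly_deg_le_cmult[of t g "-1"]] by fastforce

lemma poly_deg_le_divide: "poly_deg_le t f \<Longrightarrow> poly_deg_le t (\<lambda>x. f x / c)"
  using poly_deg_le_cmult[of t f "1 / c"] by simp

lemma poly_deg_le_continuous: "poly_deg_le t (f :: real^'n \<Rightarrow> real) \<Longrightarrow> continuous_on S f"
  unfolding poly_deg_le_def monomial_def by (auto intro!: continuous_intros)

lemma zonal4_scale: "zonal4 x (s *\<^sub>R z) = s^4 * zonal4 x z"
  by (simp add: zonal4_def Let_def power_mult_distrib field_simps)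

lemma zonal2_scale: "zonal2 x (s *\<^sub>R z) = s^2 * zonal2 x z"
  by (simp add: zonal2_def Let_def power_mult_distrib field_simps)

lemma poly_deg_le_zonal4: "poly_deg_le 4 (zonal4 (x :: real^'n))"
proof -
  have "norm z ^ 4 = (norm z ^ 2) ^ 2" for z :: "real^'n" by (simp flip: power_mult)
  then have "zonal4 x = (\<lambda>z. real CARD('n) * (real CARD('n) + 6) / 24 * ((real CARD('n)
      + 4) * (real CARD('n) + 2) * (x \<bullet> z)^4
     - 6 * (real CARD('n) + 2) * norm x ^ 2 * ((x \<bullet> z)^2 * norm z ^ 2) + 3 * norm x ^ 4 * (norm z ^ 2)^2))"
    by (auto simp: zonal4_def Let_def fun_eq_iff)
  moreover have "poly_deg_le 4 \<dots>"
    by (intro poly_deg_le_cmult poly_deg_le_add poly_deg_le_diff poly_deg_le_power[OF poly_deg_le_inner]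
        poly_deg_le_power[OF poly_deg_le_norm_sq]
        poly_deg_le_mult[OF poly_deg_le_power[OF poly_deg_le_inner, of 2 2] poly_deg_le_norm_sq]) auto
  ultimately show ?thesis by simp
qed

text \<open>The constants are dimensions: n (n + 6) (n^2 - 1) / 24 for harmonic polynomials of
  degree 4 and n (n + 1) / 2 for even polynomials of degree at most 2 on the sphere. They reappear
  in the trace of the kernel.\<close>

lemma zonal_self:
  fixes x :: "real^'n"
  defines "n \<equiv> real CARD('n)"
  shows "zonal4 x x = n * (n + 6) / 24 * (n^2 - 1) * norm x ^ 8" "zonal2 x x = n * (n + 1) / 2 * norm x ^ 4"
proof -
  define P where "P = norm x ^ 2"
  have P: "x \<bullet> x = P" "norm x ^ 4 = P^2" "norm x ^ 8 = P^4"
    unfolding P_def by (rule power2_norm_eq_inner[symmetric]) (simp_all flip: power_mult)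
  show "zonal4 x x = n * (n + 6) / 24 * (n^2 - 1) * norm x ^ 8" "zonal2 x x = n * (n + 1) / 2 * norm x ^ 4"
    unfolding zonal4_def zonal2_def Let_def n_def[symmetric] P P_def[symmetric]
    by (simp_all add: power2_eq_square power4_eq_xxxx field_simps)
qed


text \<open>\<open>tight\<close> is |X| = 2 dim, multiplied by 12 to stay within the natural
  numbers; \<open>n\<close> is the dimension as a real number.\<close>

locale tight_two_shell =
  fixes X :: "(real^'n) set" and w :: "real^'n \<Rightarrow> real" and r1 r2 n :: real
  assumes n_eq: "n = real CARD('n)" and n2: "CARD('n) \<ge> 2"
    and design: "euclidean_design 9 X w"
    and radii: "norm ` X = {r1, r2}" and r1pos: "0 < r1" and r2pos: "0 < r2" and r12: "r1 \<noteq> r2"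
    and tight: "12 * card X = CARD('n) * (CARD('n) + 1) * (CARD('n)^2 + 5 * CARD('n) + 18)"
begin

definition W :: "real \<Rightarrow> real" where "W r = (\<Sum>x\<in>layer X r. w x)"
text \<open>The scale of the homogeneous harmonics of degree 4: a product of two of them grows like
  the 8th power of the radius.\<close>

definition H :: real where "H = W r1 * r1^8 + W r2 * r2^8"
definition opp :: "real \<Rightarrow> real" where "opp r = r1 + r2 - r"

lemma fin: "finite X" and wpos: "x \<in> X \<Longrightarrow> w x > 0"
  using design unfolding euclidean_design_def by auto

lemma norm_cases: "x \<in> X \<Longrightarrow> norm x = r1 \<or> norm x = r2"
  using radii by auto

lemma norm_in: "x \<in> X \<Longrightarrow> norm x \<in> {r1, r2}"
  using radii by auto

lemma Wpos: "r \<in> {r1, r2} \<Longrightarrow> W r > 0"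
proof -
  assume "r \<in> {r1, r2}"
  then have "r \<in> norm ` X" using radii by simp
  then obtain x where "x \<in> layer X r" unfolding layer_def by auto
  then show ?thesis unfolding W_def layer_def using fin wpos by (intro sum_pos) auto
qed

lemma rpos: "r \<in> {r1, r2} \<Longrightarrow> r > 0" using r1pos r2pos by auto

lemma Hpos: "H > 0" using Wpos r1pos r2pos unfolding H_def by (intro add_pos_pos mult_pos_pos) auto

lemma npos: "n \<ge> 2" using n2 by (simp add: n_eq)

lemma exact:
  assumes "poly_deg_le 9 f"
  shows "(\<Sum>x\<in>X. w x * f x) = (\<Sum>r\<in>{r1,r2}. W r * (\<integral>z. f (r *\<^sub>R z) \<partial>usphere))"
proof -
  have "(\<Sum>r\<in>norm ` X. (\<Sum>x\<in>layer X r. w x) * sphere_avg r f) = (\<Sum>x\<in>X. w x * f x)"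
    using design assms unfolding euclidean_design_def by blast
  then show ?thesis unfolding radii W_def sphere_avg_eq[OF poly_deg_le_continuous[OF assms]] by (rule sym)
qed

text \<open>Lagrange interpolation in the variable norm z ^ 2: degree 2, value 1 on the sphere of
  radius \<open>r\<close> and 0 on the other one, whose radius is \<open>opp r\<close>.\<close>

definition radial :: "real \<Rightarrow> real^'n \<Rightarrow> real" where
  "radial r z = (norm z ^ 2 - opp r ^ 2) / (r^2 - opp r ^ 2)"

lemma radial_scale:
  assumes "r \<in> {r1, r2}" "s \<in> {r1, r2}" "norm z = s"
  shows "radial r z = (if s = r then 1 else 0)"
proof -
  have "r1^2 \<noteq> r2^2" using r12 r1pos r2pos by (simp add: power2_eq_iff)
  then show ?thesis using assms unfolding radial_def opp_def by auto
qed

text \<open>On the two spheres the even polynomials of degree at most 4 are the orthogonal sum of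
  the homogeneous harmonics of degree 4, which have no radial freedom, and of the even polynomials
  of degree at most 2 on each sphere separately. The formula is asymmetric because exactness
  requires a polynomial of degree 4 in z; symmetry holds on the spheres.\<close>

definition K :: "real^'n \<Rightarrow> real^'n \<Rightarrow> real" where
  "K x z = zonal4 x z / H + radial (norm x) z * (n * (n + 2) / 2 * (x \<bullet> z)^2 / norm x ^ 4
      - n / 2) / W (norm x)"

lemma poly_deg_le_radial: "poly_deg_le 2 (radial r)"
  unfolding radial_def by (intro poly_deg_le_divide poly_deg_le_diff poly_deg_le_norm_sq poly_deg_le_const)

lemma poly_deg_le_K: "poly_deg_le 4 (K x)"
  unfolding K_def
  by (intro poly_deg_le_add poly_deg_le_divide poly_deg_le_zonal4 poly_deg_le_mult[OF poly_deg_le_radial, of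
      2]
      poly_deg_le_diff poly_deg_le_cmult poly_deg_le_power[OF poly_deg_le_inner] poly_deg_le_const) auto

lemma K_shell:
  assumes r: "norm x = r" "r \<in> {r1, r2}" and s: "norm z = s" "s \<in> {r1, r2}"
  shows "K x z = zonal4 x z / H + (if s = r then zonal2 x z / (W r * r^4) else 0)"
proof (cases "s = r")
  case True
  have "r > 0" using rpos r by simp
  then have "zonal2 x z / r^4 = n * (n + 2) / 2 * (x \<bullet> z)^2 / r^4 - n / 2"
    unfolding zonal2_def Let_def r(1) s(1) True n_eq[symmetric]
        by (simp add: field_simps power2_eq_square power4_eq_xxxx)
  then have "zonal2 x z / (W r * r^4) = (n * (n + 2) / 2 * (x \<bullet> z)^2 / r^4 - n / 2) / W r"
    by (metis divide_divide_eq_left mult.commute)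
  then show ?thesis unfolding K_def using True radial_scale[OF r(2) s(2,1)] r(1) by simp
next
  case False
  then show ?thesis unfolding K_def using radial_scale[OF r(2) s(2,1)] r(1) by simp
qed

lemma K_sym: "x \<in> X \<Longrightarrow> y \<in> X \<Longrightarrow> K x y = K y x"
  using K_shell[OF refl norm_in refl norm_in, of x y] K_shell[OF refl norm_in refl norm_in, of y x]
    zonal_commute[of x y] by auto

text \<open>The product has degree 8 in z, so the sum becomes an integral over both spheres, where
  the mixed terms vanish. The harmonic part collects the sum of W s * s^8 divided by H^2, which is 1
  / H.\<close>

lemma K_reproducing:
  assumes x: "x \<in> X" and y: "y \<in> X"
  shows "(\<Sum>z\<in>X. w z * K x z * K z y) = K x y"
proof -
  define p q where "p = norm x" and "q = norm y"
  have p: "p \<in> {r1, r2}" and q: "q \<in> {r1, r2}" using norm_in x y unfolding p_def q_def by auto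
  let ?a = "\<lambda>s. if s = p then 1 / (W p * p^4) else 0" and ?b = "\<lambda>s. if s = q then 1 / (W q * q^4) else 0"
  have "(\<Sum>z\<in>X. w z * K x z * K z y) = (\<Sum>z\<in>X. w z * (K x z * K y z))"
    using K_sym y by (intro sum.cong) auto
  also have "\<dots> = (\<Sum>s\<in>{r1,r2}. W s * (\<integral>z. K x (s *\<^sub>R z) * K y (s *\<^sub>R z) \<partial>usphere))"
    by (intro exact poly_deg_le_mult[OF poly_deg_le_K poly_deg_le_K]) simp
  also have "\<dots> = (\<Sum>s\<in>{r1,r2}. W s * (s^8 / H^2 * zonal4 x y + ?a s * ?b s * s^4 * zonal2 x y))"
  proof (intro sum.cong refl arg_cong2[where f = "(*)"])
    fix s assume s: "s \<in> {r1, r2}"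
    have ev: "K v (s *\<^sub>R z) = s^4 / H * zonal4 v z + (if s
        = norm v then 1 / (W (norm v) * norm v^4) else 0) * s^2 * zonal2 v z"
      if "norm z = 1" "norm v \<in> {r1, r2}" for v z
      using K_shell[OF refl that(2) _ s, of "s *\<^sub>R z"] that(1) rpos[OF s]
          by (simp add: zonal4_scale zonal2_scale)
    have "(\<integral>z. K x (s *\<^sub>R z) * K y (s *\<^sub>R z) \<partial>usphere)
      = (\<integral>z. (s^4 / H * s^4 / H) * (zonal4 x z * zonal4 y z)
          + (s^4 / H * ?b s * s^2) * (zonal4 x z * zonal2 y z)
         + (s^4 / H * ?a s * s^2) * (zonal4 y z * zonal2 x z)
             + (?a s * s^2 * ?b s * s^2) * (zonal2 x z * zonal2 y z) \<partial>usphere)"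
    proof (rule usphere_cong)
      fix z :: "real^'n" assume z: "norm z = 1"
      show "K x (s *\<^sub>R z) * K y (s *\<^sub>R z) = (s^4 / H * s^4 / H) * (zonal4 x z * zonal4 y z)
          + (s^4 / H * ?b s * s^2) * (zonal4 x z * zonal2 y z)
         + (s^4 / H * ?a s * s^2) * (zonal4 y z * zonal2 x z)
             + (?a s * s^2 * ?b s * s^2) * (zonal2 x z * zonal2 y z)"
        using ev[OF z, of x] ev[OF z, of y] p q unfolding p_def[symmetric] q_def[symmetric]
        by (simp only:) (simp only: algebra_simps times_divide_eq_left times_divide_eq_right)
    next
      have "continuous_on UNIV (K v)" for v by (rule poly_deg_le_continuous[OF poly_deg_le_K])
      then have "continuous_on UNIV (\<lambda>z. K v (s *\<^sub>R z))" for v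
        by (rule continuous_on_compose2) (auto intro!: continuous_intros)
      then show "continuous_on UNIV (\<lambda>z. K x (s *\<^sub>R z) * K y (s *\<^sub>R z))" by (intro continuous_intros)
    qed (intro continuous_intros)
    also have "\<dots> = (s^4 / H * s^4 / H) * zonal4 x y + (?a s * s^2 * ?b s * s^2) * zonal2 x y"
    proof -
      have "integrable usphere (\<lambda>z. zonal4 x z * zonal4 y z)" "integrable usphere (\<lambda>z. zonal4 x z * zonal2 y
          z)"
        "integrable usphere (\<lambda>z. zonal4 y z * zonal2 x z)" "integrable usphere (\<lambda>z. zonal2 x z * zonal2 y z)"
        by (intro usphere_integrable continuous_intros)+
      then show ?thesis
        by (simp only: Bochner_Integration.integral_add Bochner_Integration.integrable_add
            integrable_mult_right
            integral_mult_right_zero zonal_convolution mult_zero_right add_0_right)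
    qed
    also have "\<dots> = s^8 / H^2 * zonal4 x y + ?a s * ?b s * s^4 * zonal2 x y"
    proof -
      have "s^4 * s^4 = s^8" "s^2 * s^2 = s^4" by (simp_all flip: power_add)
      then show ?thesis by (auto simp: power2_eq_square[of H])
    qed
    finally show "(\<integral>z. K x (s *\<^sub>R z) * K y (s *\<^sub>R z) \<partial>usphere) = s^8 / H^2 * zonal4 x y
        + ?a s * ?b s * s^4 * zonal2 x y" .
  qed
  also have "\<dots> = (\<Sum>s\<in>{r1,r2}. W s * s^8) / H^2 * zonal4 x y
      + (\<Sum>s\<in>{r1,r2}. W s * (?a s * ?b s * s^4)) * zonal2 x y"
    by (simp only: distrib_left sum.distrib sum_distrib_right sum_divide_distrib mult.assoc
        times_divide_eq_left times_divide_eq_right)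
  also have "(\<Sum>s\<in>{r1,r2}. W s * s^8) / H^2 = 1 / H"
    using r12 Hpos by (simp add: H_def[symmetric] power2_eq_square)
  also have "(\<Sum>s\<in>{r1,r2}. W s * (?a s * ?b s * s^4)) = (if q = p then 1 / (W p * p^4) else 0)"
  proof -
    have "(\<Sum>s\<in>{r1,r2}. W s * (?a s * ?b s * s^4)) = (\<Sum>s\<in>{r1,r2}. if s = p then (if q
        = p then 1 / (W p * p^4) else 0) else 0)"
      using Wpos[OF p] rpos[OF p] by (intro sum.cong) auto
    also have "\<dots> = (if q = p then 1 / (W p * p^4) else 0)" using p by simp
    finally show ?thesis .
  qed
  finally show ?thesis using K_shell[OF _ p _ q, of x y] unfolding p_def q_def by simp
qed

text \<open>The degree is 1 + 4 + 4 = 9, the last one available, and the integrand is odd on each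
  sphere.\<close>

lemma K_odd:
  "(\<Sum>z\<in>X. w z * (a \<bullet> z) * K x z * K z y) = 0" if "x \<in> X" "y \<in> X"
proof -
  let ?f = "\<lambda>z. (a \<bullet> z) * (K x z * K y z)"
  have f: "poly_deg_le 9 ?f"
    by (rule poly_deg_le_mult[OF poly_deg_le_inner poly_deg_le_mult[OF poly_deg_le_K poly_deg_le_K
        order_refl]]) simp
  have even: "K v (- z) = K v z" for v z
    unfolding K_def radial_def zonal4_def Let_def by simp
  have "(\<integral>z. ?f (s *\<^sub>R z) \<partial>usphere) = 0" for s
  proof -
    have "(\<integral>z. ?f (s *\<^sub>R z) \<partial>usphere) = (\<integral>z. ?f (s *\<^sub>R (- z)) \<partial>usphere)"
    proof (rule usphere_orthogonal[symmetric])
      show "orthogonal_transformation (uminus :: real^'n \<Rightarrow> real^'n)"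
        using bounded_linear.linear[OF bounded_linear_minus[OF bounded_linear_ident]]
        by (simp add: orthogonal_transformation_def)
      show "continuous_on UNIV (\<lambda>z. ?f (s *\<^sub>R z))"
        by (rule continuous_on_compose2[OF poly_deg_le_continuous[OF f, of UNIV]]) (auto intro!:
            continuous_intros)
    qed
    also have "\<dots> = - (\<integral>z. ?f (s *\<^sub>R z) \<partial>usphere)" by (simp add: even)
    finally show ?thesis by simp
  qed
  then have "(\<Sum>z\<in>X. w z * ?f z) = 0" using exact[OF f] by simp
  also have "(\<Sum>z\<in>X. w z * ?f z) = (\<Sum>z\<in>X. w z * (a \<bullet> z) * K x z * K z y)"
    using K_sym that by (intro sum.cong) auto
  finally show ?thesis .
qed

definition \<kappa> :: "real \<Rightarrow> real" where
  "\<kappa> r = n * (n + 6) / 24 * (n^2 - 1) * (r^8 / H) + n * (n + 1) / 2 / W r"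

lemma K_self:
  assumes "norm x = r" "r \<in> {r1, r2}"
  shows "K x x = \<kappa> r"
proof -
  have "K x x = zonal4 x x / H + zonal2 x x / (W r * r^4)"
    using K_shell[OF assms assms] by simp
  also have "zonal4 x x = n * (n + 6) / 24 * (n^2 - 1) * r^8"
    unfolding zonal_self n_eq[symmetric] assms(1) ..
  also have "zonal2 x x = n * (n + 1) / 2 * r^4"
    unfolding zonal_self n_eq[symmetric] assms(1) ..
  finally show ?thesis unfolding \<kappa>_def using rpos[OF assms(2)] by simp
qed

text \<open>The weighted diagonal sum is the dimension of the polynomial space; this is where
  \<open>tight\<close> enters.\<close>

lemma K_trace: "2 * (\<Sum>x\<in>X. w x * K x x) = card X"
proof -
  have "(\<Sum>x\<in>X. w x * K x x) = (\<Sum>r\<in>{r1,r2}. \<Sum>x\<in>{x\<in>X. norm x = r}. w x * K x x)"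
    using fin radii by (intro sum.group[symmetric]) auto
  also have "\<dots> = (\<Sum>r\<in>{r1,r2}. W r * \<kappa> r)"
    unfolding W_def layer_def sum_distrib_right by (intro sum.cong) (auto simp: K_self)
  also have "\<dots> = n * (n + 6) / 24 * (n^2 - 1) * ((W r1 * r1^8 + W r2 * r2^8) / H) + n * (n + 1)"
  proof -
    have "W r1 \<noteq> 0" "W r2 \<noteq> 0" using Wpos[of r1] Wpos[of r2] by auto
    then have "W r * \<kappa> r = n * (n + 6) / 24 * (n^2 - 1) * (W r * r^8 / H) + n * (n + 1) / 2"
        if "r \<in> {r1, r2}" for r
      using that unfolding \<kappa>_def by (auto simp: field_simps)
    then show ?thesis using r12 by (simp add: distrib_left add_divide_distrib)
  qed
  also have "\<dots> = n * (n + 6) / 24 * (n^2 - 1) + n * (n + 1)"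
    using Hpos by (simp add: H_def[symmetric])
  finally have S: "2 * (\<Sum>x\<in>X. w x * K x x) = n * (n + 6) / 12 * (n^2 - 1) + 2 * n * (n + 1)" by simp
  have "12 * real (card X) = real (12 * card X)" by simp
  also have "\<dots> = n * (n + 1) * (n^2 + 5 * n + 18)"
    unfolding tight n_eq by (simp only: of_nat_mult of_nat_add of_nat_power of_nat_numeral of_nat_1)
  finally have "12 * real (card X) = n * (n + 1) * (n^2 + 5 * n + 18)" .
  then show ?thesis unfolding S by (simp add: field_simps power2_eq_square)
qed

section \<open>Splitting of the kernel along the lines through the origin\<close>

lemma generic_direction: obtains a :: "real^'n" where "\<And>x. x \<in> X \<Longrightarrow> a \<bullet> x \<noteq> 0"
proof -
  have "x \<noteq> 0" if "x \<in> X" for x using norm_cases[OF that] r1pos r2pos by auto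
  then have "negligible (\<Union>x\<in>X. {a. x \<bullet> a = 0})"
    using fin by (intro negligible_Union) (auto intro!: negligible_hyperplane)
  then have "(\<Union>x\<in>X. {a. x \<bullet> a = 0}) \<noteq> UNIV" using non_negligible_UNIV by metis
  then obtain a where "a \<notin> (\<Union>x\<in>X. {a. x \<bullet> a = 0})" by blast
  then show thesis by (intro that[of a]) (auto simp: inner_commute)
qed

text \<open>In \<open>commuting_kernel\<close> take a linear form without zeros on \<open>X\<close>
  for l and every linear form for l'. A nonzero entry makes all these quotients agree at x and y, so
  the two vectors are parallel.\<close>

lemma K_nonparallel:
  assumes x: "x \<in> X" and y: "y \<in> X" and K: "K x y \<noteq> 0"
  shows "norm y *\<^sub>R x = norm x *\<^sub>R y \<or> norm y *\<^sub>R x = - (norm x *\<^sub>R y)"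
proof -
  obtain a :: "real^'n" where a: "\<And>x. x \<in> X \<Longrightarrow> a \<bullet> x \<noteq> 0" using generic_direction by blast
  have "(a \<bullet> y) * (e \<bullet> x) = (a \<bullet> x) * (e \<bullet> y)" for e
  proof -
    have "K x y * ((e \<bullet> x) / (a \<bullet> x) - (e \<bullet> y) / (a \<bullet> y)) = 0"
      using fin wpos K_sym K_reproducing K_trace a K_odd K_odd x y
      by (rule commuting_kernel[of X w K "\<lambda>z. a \<bullet> z" "\<lambda>z. e \<bullet> z"])
    then show ?thesis using K a[OF x] a[OF y] by (simp add: field_simps)
  qed
  then have "e \<bullet> ((a \<bullet> y) *\<^sub>R x - (a \<bullet> x) *\<^sub>R y) = 0" for e
    by (simp add: inner_diff_right)
  from this[of "(a \<bullet> y) *\<^sub>R x - (a \<bullet> x) *\<^sub>R y"] have par: "(a \<bullet> y) *\<^sub>R x = (a \<bullet> x) *\<^sub>R y"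
    by simp
  then have "collinear {0, x, y}"
    unfolding collinear_lemma using a[OF x] a[OF y]
    by (metis (no_types) divideR_right vector_fraction_eq_iff scaleR_scaleR)
  then have "\<bar>x \<bullet> y\<bar> = norm x * norm y" by (simp add: norm_cauchy_schwarz_equal)
  then show ?thesis unfolding norm_cauchy_schwarz_abs_eq by auto
qed

text \<open>The value of \<open>K\<close> at two points of different spheres on one line through 0.
  Only the harmonic part contributes, and it is even, so the side of the origin does not
  matter.\<close>

definition \<kappa>12 :: real where "\<kappa>12 = n * (n + 6) / 24 * (n^2 - 1) * ((r1 * r2)^4 / H)"

lemma h4_pos: "n * (n + 6) / 24 * (n^2 - 1) > 0"
proof -
  have "n * n \<ge> 2 * 2" using npos by (intro mult_mono) auto
  then show ?thesis using npos by (intro mult_pos_pos divide_pos_pos) (auto simp: power2_eq_square)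
qed

lemma \<kappa>_pos: "r \<in> {r1, r2} \<Longrightarrow> \<kappa> r > 0"
  unfolding \<kappa>_def using h4_pos npos Wpos[of r] rpos[of r] Hpos
  by (intro add_pos_pos mult_pos_pos divide_pos_pos) auto

lemma \<kappa>12_pos: "\<kappa>12 > 0"
  unfolding \<kappa>12_def using h4_pos r1pos r2pos Hpos
  by (intro mult_pos_pos[OF h4_pos] divide_pos_pos) auto

text \<open>The harmonic parts alone give equality; the parts of degree at most 2 are positive and
  make it strict.\<close>

lemma \<kappa>_det: "\<kappa> r1 * \<kappa> r2 > \<kappa>12 ^ 2"
proof -
  define h where "h = n * (n + 6) / 24 * (n^2 - 1)"
  define g where "g = n * (n + 1) / 2"
  have p: "h > 0" "g > 0" "W r1 > 0" "W r2 > 0" "H > 0" "h * (r1^8 / H) > 0" "h * (r2^8 / H) > 0"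
    using h4_pos npos Wpos Hpos r1pos r2pos unfolding h_def g_def by auto
  have "\<kappa>12 ^ 2 = h * (r1^8 / H) * (h * (r2^8 / H))"
  proof -
    have "r^4 * r^4 = r^8" for r :: real by (simp flip: power_add)
    from this[of r1, symmetric] this[of r2, symmetric] show ?thesis
      unfolding \<kappa>12_def h_def[symmetric] by (simp add: power_mult_distrib power2_eq_square mult_ac)
  qed
  also have "\<dots> < (h * (r1^8 / H) + g / W r1) * (h * (r2^8 / H) + g / W r2)"
    using p by (intro mult_strict_mono add_pos_pos divide_pos_pos) auto
  also have "\<dots> = \<kappa> r1 * \<kappa> r2" unfolding \<kappa>_def h_def g_def by simp
  finally show ?thesis .
qed

text \<open>If the line through a point of the first shell also met the second shell, then on that
  line \<open>K\<close> would have the rank-two block \<open>\<kappa>\<close> with nonzero off-diagonal entry, which is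
  incompatible with \<open>\<kappa> \<Omega> \<kappa> = \<kappa>\<close> for a diagonal \<open>\<Omega>\<close>.\<close>
lemma K_cross:
  assumes x: "x \<in> X" "norm x = r1" and y: "y \<in> X" "norm y = r2"
  shows "K x y = 0"
proof (rule ccontr)
  assume nz: "K x y \<noteq> 0"
  have xpar: "r2 *\<^sub>R x = r1 *\<^sub>R y \<or> r2 *\<^sub>R x = - (r1 *\<^sub>R y)"
    using K_nonparallel[OF x(1) y(1) nz] x y by simp
  have r0: "r1 \<noteq> 0" "r2 \<noteq> 0" using r1pos r2pos by auto
  obtain \<epsilon> :: real where eps: "\<epsilon> = 1 \<or> \<epsilon> = -1" and yx: "y = (\<epsilon> * r2 / r1) *\<^sub>R x"
  proof -
    from xpar consider "r2 *\<^sub>R x = r1 *\<^sub>R y" | "r2 *\<^sub>R x = - (r1 *\<^sub>R y)" by blast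
    then show thesis
    proof cases
      case 1
      then have "r1 *\<^sub>R y = r1 *\<^sub>R ((1 * r2 / r1) *\<^sub>R x)" using r0 by simp
      then have "y = (1 * r2 / r1) *\<^sub>R x" using r0 scaleR_cancel_left by blast
      then show ?thesis by (intro that[of 1]) auto
    next
      case 2
      then have "r1 *\<^sub>R y = r1 *\<^sub>R ((-1 * r2 / r1) *\<^sub>R x)" using r0 by simp
      then have "y = (-1 * r2 / r1) *\<^sub>R x" using r0 scaleR_cancel_left by blast
      then show ?thesis by (intro that[of "-1"]) auto
    qed
  qed
  have Kcross: "K u v = zonal4 u v / H" if "norm u = r1" "norm v = r2" for u v
    using K_shell[of u r1 v r2] r12 that by simp
  have Kxy: "K x y = \<kappa>12"
  proof -
    have "K x y = (\<epsilon> * r2 / r1)^4 * zonal4 x x / H"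
      using Kcross[OF x(2) y(2)] unfolding yx zonal4_scale by simp
    also have "\<dots> = (r2 / r1)^4 * zonal4 x x / H" using eps by auto
    also have "\<dots> = \<kappa>12"
    proof -
      have "(r2 / r1)^4 * r1^8 = (r1 * r2)^4"
        using r0 by (simp add: power_divide power_mult_distrib field_simps flip: power_add)
      then show ?thesis unfolding zonal_self n_eq[symmetric] x(2) \<kappa>12_def
        by (simp add: mult_ac)
    qed
    finally show ?thesis .
  qed
  \<comment> \<open>A point z of the first sphere is either x or - x, where both entries are known,
    or off the line, where both vanish. So the columns of x and y are proportional on this sphere;
    \<open>ratio2\<close> does the same on the other one.\<close>
  have ratio: "K z y * \<kappa> r1 = \<kappa>12 * K z x" if z: "z \<in> X" "norm z = r1" for z
  proof (cases "K z x = 0")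
    case True
    have "K z y = 0"
    proof (rule ccontr)
      assume "K z y \<noteq> 0"
      then have "r2 *\<^sub>R z = r1 *\<^sub>R y \<or> r2 *\<^sub>R z = - (r1 *\<^sub>R y)"
        using K_nonparallel[OF z(1) y(1)] z y by simp
      then have "r1 *\<^sub>R y = r2 *\<^sub>R z \<or> r1 *\<^sub>R y = - (r2 *\<^sub>R z)" by auto
      moreover have "r1 *\<^sub>R y = r2 *\<^sub>R x \<or> r1 *\<^sub>R y = - (r2 *\<^sub>R x)" using xpar by auto
      ultimately have "r2 *\<^sub>R z = r2 *\<^sub>R x \<or> r2 *\<^sub>R z = - (r2 *\<^sub>R x)" by (rule plus_minus_trans)
      then have "r2 *\<^sub>R z = r2 *\<^sub>R x \<or> r2 *\<^sub>R z = r2 *\<^sub>R (- x)" by (simp only: scaleR_minus_right)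
      then have "z = x \<or> z = - x" using r0 scaleR_cancel_left by blast
      then have "K z x = K x x" using K_shell[of z r1 x r1] K_shell[of x r1 x r1] x z
        by (auto simp: zonal4_def zonal2_def Let_def)
      then show False using True K_self[OF x(2)] \<kappa>_pos[of r1] by simp
    qed
    then show ?thesis using True by simp
  next
    case False
    then have "r1 *\<^sub>R z = r1 *\<^sub>R x \<or> r1 *\<^sub>R z = r1 *\<^sub>R (- x)" using K_nonparallel[OF z(1) x(1)] z x by simp
    then have "z = x \<or> z = - x" using r0 scaleR_cancel_left by blast
    then have "K z x = K x x" "K z y = K x y"
      using K_shell[of z r1 x r1] K_shell[of x r1 x r1] Kcross[of z y] Kcross[of x y] x y z
      by (auto simp: zonal4_def zonal2_def Let_def)
    then show ?thesis using K_self[OF x(2)] Kxy by simp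
  qed
  have ratio2: "K x z * \<kappa> r2 = \<kappa>12 * K z y" if z: "z \<in> X" "norm z = r2" for z
  proof (cases "K z y = 0")
    case True
    have "K x z = 0"
    proof (rule ccontr)
      assume "K x z \<noteq> 0"
      then have "r2 *\<^sub>R x = r1 *\<^sub>R z \<or> r2 *\<^sub>R x = - (r1 *\<^sub>R z)"
        using K_nonparallel[OF x(1) z(1)] z x by simp
      then have "r1 *\<^sub>R z = r1 *\<^sub>R y \<or> r1 *\<^sub>R z = - (r1 *\<^sub>R y)" using xpar by (rule plus_minus_trans)
      then have "r1 *\<^sub>R z = r1 *\<^sub>R y \<or> r1 *\<^sub>R z = r1 *\<^sub>R (- y)" by (simp only: scaleR_minus_right)
      then have "z = y \<or> z = - y" using r0 scaleR_cancel_left by blast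
      then have "K z y = K y y" using K_shell[of z r2 y r2] K_shell[of y r2 y r2] y z
        by (auto simp: zonal4_def zonal2_def Let_def)
      then show False using True K_self[OF y(2)] \<kappa>_pos[of r2] by simp
    qed
    then show ?thesis using True by simp
  next
    case False
    then have "r2 *\<^sub>R z = r2 *\<^sub>R y \<or> r2 *\<^sub>R z = r2 *\<^sub>R (- y)" using K_nonparallel[OF z(1) y(1)] z y by simp
    then have "z = y \<or> z = - y" using r0 scaleR_cancel_left by blast
    then have "K z y = K y y" "K x z = K x y"
      using K_shell[of z r2 y r2] K_shell[of y r2 y r2] Kcross[of x z] Kcross[of x y] x y z
      by (auto simp: zonal4_def zonal2_def Let_def)
    then show ?thesis using K_self[OF y(2)] Kxy by simp
  qed
  define S1 where "S1 = (\<Sum>z\<in>{z\<in>X. norm z = r1}. w z * (K z x)^2)"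
  define S2 where "S2 = (\<Sum>z\<in>{z\<in>X. norm z = r2}. w z * (K z y)^2)"
  have split: "(\<Sum>z\<in>X. f z) = (\<Sum>z\<in>{z\<in>X. norm z = r1}. f z) + (\<Sum>z\<in>{z\<in>X. norm z
      = r2}. f z)" for f :: "real^'n \<Rightarrow> real"
    using sum.group[of X "{r1,r2}" norm f] fin radii r12 by simp
  note k = \<kappa>_pos[of r1] \<kappa>_pos[of r2] \<kappa>12_pos \<kappa>_det
  have S: "(\<Sum>z\<in>{z\<in>X. norm z = r}. w z * K u z * K z v) = c * (\<Sum>z\<in>{z\<in>X. norm z = r}. w z * (K z t)^2)"
    if "\<And>z. z \<in> X \<Longrightarrow> norm z = r \<Longrightarrow> K u z * K z v = c * (K z t)^2" for r u v c t
    unfolding sum_distrib_left using that by (intro sum.cong) (auto simp: mult_ac)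
  have e1: "\<kappa> r1 = S1 + (\<kappa>12 / \<kappa> r2)^2 * S2"
  proof -
    have "K x x = 1 * S1 + (\<kappa>12 / \<kappa> r2)^2 * S2"
      unfolding K_reproducing[OF x(1) x(1), symmetric] S1_def S2_def split
    proof (intro arg_cong2[where f = "(+)"] S)
      fix z assume z: "z \<in> X" "norm z = r1"
      show "K x z * K z x = 1 * (K z x)^2" using K_sym[OF x(1) z(1)] by (simp add: power2_eq_square)
    next
      fix z assume z: "z \<in> X" "norm z = r2"
      have "K x z = \<kappa>12 / \<kappa> r2 * K z y" using ratio2[OF z] k by (simp add: field_simps)
      then show "K x z * K z x = (\<kappa>12 / \<kappa> r2)^2 * (K z y)^2"
        using K_sym[OF x(1) z(1)] by (simp add: power2_eq_square)
    qed
    then show ?thesis using K_self[OF x(2)] by simp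
  qed
  have "\<kappa>12 = \<kappa>12 / \<kappa> r1 * S1 + \<kappa>12 / \<kappa> r2 * S2"
  proof -
    have "K x y = \<kappa>12 / \<kappa> r1 * S1 + \<kappa>12 / \<kappa> r2 * S2"
      unfolding K_reproducing[OF x(1) y(1), symmetric] S1_def S2_def split
    proof (intro arg_cong2[where f = "(+)"] S)
      fix z assume z: "z \<in> X" "norm z = r1"
      have "K z y = \<kappa>12 / \<kappa> r1 * K z x" using ratio[OF z] k by (simp add: field_simps)
      then show "K x z * K z y = \<kappa>12 / \<kappa> r1 * (K z x)^2" using K_sym[OF x(1) z(1)]
          by (simp add: power2_eq_square)
    next
      fix z assume z: "z \<in> X" "norm z = r2"
      have "K x z = \<kappa>12 / \<kappa> r2 * K z y" using ratio2[OF z] k by (simp add: field_simps)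
      then show "K x z * K z y = \<kappa>12 / \<kappa> r2 * (K z y)^2"
        by (simp add: power2_eq_square)
    qed
    then show ?thesis using Kxy by simp
  qed
  then have "\<kappa>12 * 1 = \<kappa>12 * (S1 / \<kappa> r1 + S2 / \<kappa> r2)" by (simp add: distrib_left)
  then have e2: "1 = S1 / \<kappa> r1 + S2 / \<kappa> r2" using k(3) by (simp only: mult_cancel_left) auto
  have "S2 > 0"
    unfolding S2_def
  proof (rule sum_pos2[of _ y])
    show "0 < w y * (K y y)^2" using wpos[OF y(1)] K_self[OF y(2)] k by simp
    show "0 \<le> w z * (K z y)^2" if "z \<in> {z \<in> X. norm z = r2}" for z
      using wpos[of z] that by simp
  qed (use y fin in auto)
  \<comment> \<open>\<open>e1\<close> and \<open>e2\<close> are the (x, x) and (x, y) entries of the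
    reproducing identity. Eliminating \<open>S1\<close> leaves \<kappa>12^2 = \<kappa> r1 * \<kappa>
    r2, against \<open>\<kappa>_det\<close>.\<close>
  have "\<kappa> r1 = S1 + \<kappa> r1 * (S2 / \<kappa> r2)" using arg_cong[OF e2, of "\<lambda>t. \<kappa> r1 * t"] k by (simp add: distrib_left)
  then have "(\<kappa>12 / \<kappa> r2)^2 * S2 = \<kappa> r1 * (S2 / \<kappa> r2)" using e1 by simp
  then have "\<kappa>12^2 * S2 = \<kappa> r1 * \<kappa> r2 * S2" using k by (simp add: field_simps power2_eq_square)
  then show False using \<open>S2 > 0\<close> k by simp
qed

lemma K_zero:
  assumes x: "x \<in> X" and y: "y \<in> X" and ne: "y \<noteq> x" "y \<noteq> - x"
  shows "K x y = 0"
proof (cases "norm x = norm y")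
  case True
  have "norm x \<noteq> 0" using norm_cases[OF x] r1pos r2pos by auto
  then have "norm x *\<^sub>R x \<noteq> norm x *\<^sub>R y" "norm x *\<^sub>R x \<noteq> norm x *\<^sub>R (- y)"
    using ne scaleR_cancel_left[of "norm x" x] by (metis, metis minus_minus)
  then show ?thesis using K_nonparallel[OF x y] True by auto
next
  case False
  then show ?thesis using norm_cases[OF x] norm_cases[OF y] K_cross[of x y] K_cross[of y x] x y K_sym[OF x
      y] by auto
qed

text \<open>In the row of x only x and - x survive. Their contributions to the odd identity have
  opposite signs and must cancel, so - x is present with the same weight; the reproducing identity
  then determines this weight.\<close>

lemma antipodal_weight:
  assumes x: "x \<in> X"
  shows "- x \<in> X" "w (- x) = w x" "2 * w x * \<kappa> (norm x) = 1"
proof -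
  obtain a :: "real^'n" where a: "\<And>x. x \<in> X \<Longrightarrow> a \<bullet> x \<noteq> 0" using generic_direction by blast
  have kp: "\<kappa> (norm x) > 0" using \<kappa>_pos norm_in x by simp
  have Kxx: "K x x = \<kappa> (norm x)" using K_self norm_in x by simp
  have x0: "x \<noteq> - x" using a[OF x] by (metis equal_neg_zero inner_minus_right)
  have Kn: "K z x = K x x" if "z = - x" "z \<in> X" for z
    using K_shell[OF refl norm_in[OF that(2)] refl norm_in[OF x]] K_shell[OF refl norm_in[OF x] refl
        norm_in[OF x]] that(1)
    by (simp add: zonal4_def zonal2_def Let_def)
  have sub: "(\<Sum>z\<in>X. f z * K x z * K z x) = (\<Sum>z\<in>X \<inter> {x, -x}. f z * K x z * K z x)" for f
    using fin K_zero[OF x] by (intro sum.mono_neutral_right) auto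
  have mx: "- x \<in> X"
  proof (rule ccontr)
    assume "- x \<notin> X"
    then have "X \<inter> {x, -x} = {x}" using x by auto
    then have "w x * (a \<bullet> x) * K x x * K x x = 0" using K_odd[OF x x, of a] sub[of "\<lambda>z. w z * (a \<bullet> z)"]
        by simp
    then show False using wpos[OF x] a[OF x] kp Kxx by simp
  qed
  then show "- x \<in> X" .
  have S: "X \<inter> {x, -x} = {x, -x}" using x mx by auto
  have Km: "K x (- x) = \<kappa> (norm x)" "K (- x) x = \<kappa> (norm x)" using Kn[OF refl mx] K_sym[OF x mx] Kxx by auto
  have "w x * (a \<bullet> x) * K x x * K x x + w (- x) * (a \<bullet> (- x)) * K x (- x) * K (- x) x = 0"
    using K_odd[OF x x, of a] sub[of "\<lambda>z. w z * (a \<bullet> z)"] x0 unfolding S by simp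
  then have "(a \<bullet> x) * \<kappa> (norm x)^2 * (w x - w (- x)) = 0" unfolding Km Kxx
      by (simp add: power2_eq_square algebra_simps)
  then show weq: "w (- x) = w x" using a[OF x] kp by simp
  have "w x * K x x * K x x + w (- x) * K x (- x) * K (- x) x = K x x"
    using K_reproducing[OF x x] sub[of w] x0 unfolding S by simp
  then have "\<kappa> (norm x) * (2 * w x * \<kappa> (norm x)) = \<kappa> (norm x) * 1" unfolding Km Kxx weq
      by (simp add: algebra_simps)
  then show "2 * w x * \<kappa> (norm x) = 1" using kp by (simp only: mult_cancel_left) auto
qed

end

section \<open>Spherical 7-designs with two angles\<close>

lemma square_of_ratio:
  fixes A M B :: nat
  assumes "A^2 * M = B^2" "A \<noteq> 0"
  obtains r where "M = r^2"
proof -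
  have "A^2 dvd B^2" using assms(1) by (metis dvd_triv_left)
  then have "A dvd B" by simp
  then obtain c where "B = A * c" by (auto elim: dvdE)
  then have "A^2 * M = A^2 * c^2" using assms(1) by (simp add: power_mult_distrib)
  then show thesis using assms(2) that by simp
qed

lemma rat_square_nat:
  fixes x :: real and M :: nat
  assumes "x \<in> \<rat>" "x^2 = real M"
  obtains r :: nat where "M = r^2" "\<bar>x\<bar> = real r"
proof -
  obtain p q :: nat where q: "q \<noteq> 0" "\<bar>x\<bar> = real p / real q"
    using Rats_abs_nat_div_natE[OF assms(1)] by metis
  have "real M = (real p / real q)^2" using assms(2) q(2) by (metis power2_abs)
  then have "real q^2 * real M = real p^2" using q(1) by (simp add: power_divide)
  then have "real (q^2 * M) = real (p^2)" by simp
  then have "q^2 * M = p^2" by (simp only: of_nat_eq_iff)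
  then obtain r where r: "M = r^2" using q(1) by (rule square_of_ratio)
  then have "\<bar>x\<bar>^2 = real r^2" using assms(2) by simp
  then have "\<bar>x\<bar> = real r" using power2_eq_iff_nonneg[of "\<bar>x\<bar>" "real r"] by simp
  then show thesis using r that by blast
qed

text \<open>Antipodality takes care of the odd degrees. The moments of degrees 2, 4 and 6 are listed
  in the mixed form in which they are summed later. \<open>n\<close> is a real parameter that will
  be the dimension.\<close>

definition spherical7 :: "real \<Rightarrow> 'a::real_inner set \<Rightarrow> bool" where
  "spherical7 n U \<longleftrightarrow> finite U \<and> U \<noteq> {} \<and> (\<forall>z\<in>U. norm z = 1 \<and> - z \<in> U) \<and>
     (\<forall>x y. norm x = 1 \<longrightarrow> norm y = 1 \<longrightarrow>
        (\<Sum>z\<in>U. (x \<bullet> z) * (y \<bullet> z)) = card U * ((x \<bullet> y) / n) \<and>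
        (\<Sum>z\<in>U. (x \<bullet> z)^2 * (y \<bullet> z)^2) = card U * ((1 + 2 * (x \<bullet> y)^2) / (n * (n + 2))) \<and>
        (\<Sum>z\<in>U. (x \<bullet> z)^3 * (y \<bullet> z)) = card U * (3 * (x \<bullet> y) / (n * (n + 2))) \<and>
        (\<Sum>z\<in>U. (x \<bullet> z)^3 * (y \<bullet> z)^3) = card U * ((6 * (x \<bullet> y)^3 + 9 * (x \<bullet> y)) / (n * (n + 2) * (n + 4))))"

context
  fixes n :: real and U :: "'a::real_inner set"
  assumes U: "spherical7 n U"
begin

lemma s7_finite: "finite U" and s7_nonempty: "U \<noteq> {}" and s7_norm: "z \<in> U \<Longrightarrow> norm z = 1"
  and s7_neg: "z \<in> U \<Longrightarrow> - z \<in> U"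
  using U unfolding spherical7_def by auto

lemma s7_card: "real (card U) > 0"
  using s7_finite s7_nonempty by (simp add: card_gt_0_iff)

lemma s7_moments:
  assumes "norm x = 1" "norm y = 1"
  shows "(\<Sum>z\<in>U. (x \<bullet> z) * (y \<bullet> z)) = card U * ((x \<bullet> y) / n)"
    "(\<Sum>z\<in>U. (x \<bullet> z)^2 * (y \<bullet> z)^2) = card U * ((1 + 2 * (x \<bullet> y)^2) / (n * (n + 2)))"
    "(\<Sum>z\<in>U. (x \<bullet> z)^3 * (y \<bullet> z)) = card U * (3 * (x \<bullet> y) / (n * (n + 2)))"
    "(\<Sum>z\<in>U. (x \<bullet> z) * (y \<bullet> z)^3) = card U * (3 * (x \<bullet> y) / (n * (n + 2)))"
    "(\<Sum>z\<in>U. (x \<bullet> z)^3 * (y \<bullet> z)^3) = card U * ((6 * (x \<bullet> y)^3 + 9 * (x \<bullet> y)) / (n * (n + 2) * (n + 4)))"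
proof -
  note * = U[unfolded spherical7_def, THEN conjunct2, THEN conjunct2, THEN conjunct2, rule_format]
  from *[OF assms] show "(\<Sum>z\<in>U. (x \<bullet> z) * (y \<bullet> z)) = card U * ((x \<bullet> y) / n)"
    "(\<Sum>z\<in>U. (x \<bullet> z)^2 * (y \<bullet> z)^2) = card U * ((1 + 2 * (x \<bullet> y)^2) / (n * (n + 2)))"
    "(\<Sum>z\<in>U. (x \<bullet> z)^3 * (y \<bullet> z)) = card U * (3 * (x \<bullet> y) / (n * (n + 2)))"
    "(\<Sum>z\<in>U. (x \<bullet> z)^3 * (y \<bullet> z)^3) = card U * ((6 * (x \<bullet> y)^3 + 9 * (x \<bullet> y)) / (n * (n + 2) * (n + 4)))"
    by blast+
  from *[OF assms(2) assms(1)] show "(\<Sum>z\<in>U. (x \<bullet> z) * (y \<bullet> z)^3) = card U * (3 * (x \<bullet> y) / (n * (n + 2)))"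
    by (simp add: inner_commute[of y x] mult.commute)
qed

lemma s7_power_moments:
  assumes x: "norm x = 1"
  shows "(\<Sum>z\<in>U. (x \<bullet> z)^2) = card U / n" "(\<Sum>z\<in>U. (x \<bullet> z)^4) = card U * (3 / (n * (n + 2)))"
    "(\<Sum>z\<in>U. (x \<bullet> z)^6) = card U * (15 / (n * (n + 2) * (n + 4)))"
proof -
  have xx: "x \<bullet> x = 1" using x by (simp add: norm_eq_1)
  have e: "t^3 * t = t^4" "t^3 * t^3 = t^6" for t :: real
    by (simp_all add: power4_eq_xxxx power3_eq_cube eval_nat_numeral)
  show "(\<Sum>z\<in>U. (x \<bullet> z)^2) = card U / n" using s7_moments(1)[OF x x] xx by (simp add: power2_eq_square)
  show "(\<Sum>z\<in>U. (x \<bullet> z)^4) = card U * (3 / (n * (n + 2)))" using s7_moments(3)[OF x x] xx by (simp add: e)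
  show "(\<Sum>z\<in>U. (x \<bullet> z)^6) = card U * (15 / (n * (n + 2) * (n + 4)))" using s7_moments(5)[OF x x] xx
      by (simp add: e)
qed

lemma even_card_level:
  fixes G :: real
  assumes "G \<noteq> 0"
  obtains k :: nat where "card {z\<in>U. (x \<bullet> z)^2 = G} = 2 * k"
proof -
  let ?P = "{z\<in>U. (x \<bullet> z)^2 = G \<and> x \<bullet> z > 0}" and ?N = "{z\<in>U. (x \<bullet> z)^2 = G \<and> x \<bullet> z < 0}"
  have "?N = uminus ` ?P"
  proof
    show "?N \<subseteq> uminus ` ?P"
    proof
      fix z assume "z \<in> ?N"
      then have "- z \<in> ?P" using s7_neg by simp
      then show "z \<in> uminus ` ?P" by (metis (lifting) image_eqI minus_minus)
    qed
    show "uminus ` ?P \<subseteq> ?N" using s7_neg by auto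
  qed
  then have "card ?N = card ?P" by (simp add: card_image)
  moreover have "{z\<in>U. (x \<bullet> z)^2 = G} = ?P \<union> ?N"
    using assms by (auto simp: not_less less_le)
  moreover have "card (?P \<union> ?N) = card ?P + card ?N"
    using s7_finite by (intro card_Un_disjoint) auto
  ultimately show thesis by (intro that[of "card ?P"]) simp
qed

text \<open>The second moment counts the points on level \<open>G\<close>. As neither level is 0,
  the map z -> - z pairs off the points of each level, so that all counts are even; in the plane
  this parity decides the cardinalities.\<close>

lemma two_level_count:
  fixes G D :: real
  assumes x: "norm x = 1" and lv: "\<And>z. z \<in> U \<Longrightarrow> (x \<bullet> z)^2 = G \<or> (x \<bullet> z)^2 = D"
    and ne: "G \<noteq> D" "G \<noteq> 0" "D \<noteq> 0"
  obtains v k :: nat where "card U = 2 * v" "v * (1 / n - D) = k * (G - D)"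
proof -
  obtain k where k: "card {z\<in>U. (x \<bullet> z)^2 = G} = 2 * k" by (rule even_card_level[OF ne(2)])
  obtain k' where k': "card {z\<in>U. (x \<bullet> z)^2 = D} = 2 * k'" by (rule even_card_level[OF ne(3)])
  have "U = {z\<in>U. (x \<bullet> z)^2 = G} \<union> {z\<in>U. (x \<bullet> z)^2 = D}" using lv by auto
  then have "card U = card {z\<in>U. (x \<bullet> z)^2 = G} + card {z\<in>U. (x \<bullet> z)^2 = D}"
    using s7_finite ne(1) by (subst card_Un_disjoint[symmetric]) auto
  then have v: "card U = 2 * (k + k')" using k k' by simp
  have "(\<Sum>z\<in>U. (x \<bullet> z)^2 - D) = (\<Sum>z\<in>U. if (x \<bullet> z)^2 = G then G - D else 0)"
    using lv by (intro sum.cong) auto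
  also have "\<dots> = real (2 * k) * (G - D)" using s7_finite by (simp add: sum.If_cases Int_def k)
  finally have "real (card U) * (1 / n - D) = real (2 * k) * (G - D)"
    using s7_power_moments(1)[OF x] by (simp add: sum_subtractf algebra_simps)
  then have "2 * (real (k + k') * (1 / n - D)) = 2 * (real k * (G - D))"
    unfolding v by (simp only: of_nat_mult mult.assoc of_nat_numeral)
  then have "real (k + k') * (1 / n - D) = real k * (G - D)" by (simp only: mult_cancel_left) simp
  then show thesis using that v by blast
qed

text \<open>Otherwise the distribution of \<open>(x \<bullet> z)^2\<close> would be concentrated on \<open>1\<close> and \<open>A\<close>, and then its
  first three moments overdetermine \<open>A\<close>.\<close>
lemma other_inner_product:
  fixes A :: real
  assumes n: "n \<ge> 2" and x: "x \<in> U"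
  obtains y where "y \<in> U" "y \<noteq> x" "y \<noteq> - x" "(x \<bullet> y)^2 \<noteq> A"
proof (rule ccontr)
  assume nt: "\<not> thesis"
  note found = that
  have c: "(1 - (x \<bullet> z)^2) * ((x \<bullet> z)^2 - A) = 0" if "z \<in> U" for z
  proof (cases "z = x \<or> z = - x")
    case True
    then have "(x \<bullet> z)^2 = 1" using s7_norm[OF x] by (auto simp: norm_eq_1)
    then show ?thesis by simp
  next
    case False
    then have "(x \<bullet> z)^2 = A" using nt found[OF that] by blast
    then show ?thesis by simp
  qed
  note x1 = s7_norm[OF x]
  have "(\<Sum>z\<in>U. (1 + A) * (x \<bullet> z)^2 - (x \<bullet> z)^4 - A) = 0"
  proof (intro sum.neutral ballI)
    fix z assume "z \<in> U"
    then show "(1 + A) * (x \<bullet> z)^2 - (x \<bullet> z)^4 - A = 0" using c[of z]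
      by (simp add: algebra_simps power2_eq_square power4_eq_xxxx)
  qed
  then have "(1 + A) * (\<Sum>z\<in>U. (x \<bullet> z)^2) - (\<Sum>z\<in>U. (x \<bullet> z)^4) - real (card U) * A = 0"
    by (simp only: sum_subtractf sum_distrib_left sum_constant)
  then have "real (card U) * ((1 + A) / n - 3 / (n * (n + 2)) - A) = 0"
    unfolding s7_power_moments[OF x1] by (simp add: right_diff_distrib mult.commute)
  then have e1: "(1 + A) / n - 3 / (n * (n + 2)) - A = 0" using s7_card by simp
  have "(\<Sum>z\<in>U. (1 + A) * (x \<bullet> z)^4 - (x \<bullet> z)^6 - A * (x \<bullet> z)^2) = 0"
  proof (intro sum.neutral ballI)
    fix z assume "z \<in> U"
    have "(1 + A) * t^4 - t^6 - A * t^2 = t^2 * ((1 - t^2) * (t^2 - A))" for t :: real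
      by (simp add: algebra_simps eval_nat_numeral)
    then show "(1 + A) * (x \<bullet> z)^4 - (x \<bullet> z)^6 - A * (x \<bullet> z)^2 = 0" using c[OF \<open>z \<in> U\<close>] by simp
  qed
  then have "(1 + A) * (\<Sum>z\<in>U. (x \<bullet> z)^4) - (\<Sum>z\<in>U. (x \<bullet> z)^6) - A * (\<Sum>z\<in>U. (x \<bullet> z)^2) = 0"
    by (simp only: sum_subtractf sum_distrib_left)
  then have "real (card U) * ((1 + A) * (3 / (n * (n + 2))) - 15 / (n * (n + 2) * (n + 4)) - A / n) = 0"
  proof -
    define a c where "a = 3 / (n * (n + 2))" and "c = 15 / (n * (n + 2) * (n + 4))"
    show "(1 + A) * (\<Sum>z\<in>U. (x \<bullet> z)^4) - (\<Sum>z\<in>U. (x \<bullet> z)^6) - A * (\<Sum>z\<in>U. (x \<bullet> z)^2) = 0 \<Longrightarrow> ?thesis"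
      unfolding s7_power_moments[OF x1] a_def[symmetric] c_def[symmetric] by (simp add: algebra_simps)
  qed
  then have e2: "(1 + A) * (3 / (n * (n + 2))) - 15 / (n * (n + 2) * (n + 4)) - A / n = 0" using s7_card
      by simp
  have pos: "n > 0" "n + 2 > 0" "n + 4 > 0" using n by auto
  have "(1 + A) * p - 3 - A * n * p = n * p * ((1 + A) / n - 3 / (n * p) - A)" if "p > 0" for p
    using pos(1) that by (simp add: field_simps)
  from this[OF pos(2)] have "(n - 1) * (1 - A * (n + 2)) = 0" unfolding e1 by (simp add: algebra_simps)
  then have a1: "A * (n + 2) = 1" using n by simp
  have "(1 + A) * 3 * q - 15 - A * p * q = n * p * q * ((1 + A) * (3 / (n * p)) - 15 / (n * p * q) - A / n)"
    if "p > 0" "q > 0" for p q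
    using pos(1) that by (simp add: field_simps)
  from this[OF pos(2,3)]
  have "(n - 1) * (3 - A * (n + 4)) = 0" unfolding e2 by (simp add: algebra_simps)
  then have a2: "A * (n + 4) = 3" using n by simp
  have "A = 1" using a1 a2 by (simp add: algebra_simps)
  then show False using a1 n by simp
qed

end

text \<open>The numerical data of one normalized layer. The cardinality is 2 W \<kappa>, and the
  quadratic in (x . y)^2 is the condition K = 0 multiplied by 24 W / n.\<close>

definition shell :: "real \<Rightarrow> real \<Rightarrow> 'a::real_inner set \<Rightarrow> bool" where
  "shell n b U \<longleftrightarrow> spherical7 n U \<and> real (card U) = n * (n + 1) / 12 * (12 + b * (n - 1)) \<and>
     (\<forall>x\<in>U. \<forall>y\<in>U. y \<noteq> x \<longrightarrow> y \<noteq> - x \<longrightarrow>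
        b * (n + 4) * (n + 2) * ((x \<bullet> y)^2)^2 - 6 * (n + 2) * (b - 2) * (x \<bullet> y)^2 + 3 * (b - 4) = 0)"

lemma quadratic_vieta:
  fixes a p q s t :: real
  assumes "a * s^2 - p * s + q = 0" "a * t^2 - p * t + q = 0" "s \<noteq> t"
  shows "p = a * (s + t)" "q = a * (s * t)"
proof -
  have "(s - t) * (a * (s + t) - p) = 0" using assms(1,2) by (simp add: algebra_simps power2_eq_square)
  then show p: "p = a * (s + t)" using assms(3) by simp
  show "q = a * (s * t)" using assms(1) unfolding p by (simp add: algebra_simps power2_eq_square)
qed

lemma quadratic_roots_cover:
  fixes a p q s t u :: real
  assumes "a * s^2 - p * s + q = 0" "a * t^2 - p * t + q = 0" "s \<noteq> t" "a * u^2 - p * u + q = 0" "a \<noteq> 0"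
  shows "u = s \<or> u = t"
proof -
  have "a * ((u - s) * (u - t)) = 0"
    using assms(4) unfolding quadratic_vieta[OF assms(1-3)] by (simp add: algebra_simps power2_eq_square)
  then show ?thesis using assms(5) by simp
qed

text \<open>The quadratic allows at most two levels, and \<open>other_inner_product\<close>, first
  with an arbitrary level to avoid and then with the level just found, shows that both occur. Sum
  and product follow from Vieta.\<close>

lemma shell_two_inner_products:
  assumes sh: "shell n b U" and n: "n \<ge> 2" and b: "b > 0" and x: "x \<in> U"
  obtains y y' A A' where "y \<in> U" "y \<noteq> x" "y \<noteq> - x" "(x \<bullet> y)^2 = A" "y' \<in> U" "y' \<noteq> x" "y' \<noteq> - x" "(x \<bullet> y')^2
      = A'"
    "A \<noteq> A'" "b * (n + 4) * (n + 2) * A^2 - 6 * (n + 2) * (b - 2) * A + 3 * (b - 4) = 0"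
    "6 * (b - 2) = b * (n + 4) * (A + A')" "3 * (b - 4) = b * (n + 4) * (n + 2) * (A * A')"
    "\<And>x y. x \<in> U \<Longrightarrow> y \<in> U \<Longrightarrow> y \<noteq> x \<Longrightarrow> y \<noteq> - x \<Longrightarrow> (x \<bullet> y)^2 = A \<or> (x \<bullet> y)^2 = A'"
proof -
  have s7: "spherical7 n U" using sh unfolding shell_def by blast
  have q: "b * (n + 4) * (n + 2) * ((x \<bullet> y)^2)^2 - 6 * (n + 2) * (b - 2) * (x \<bullet> y)^2 + 3 * (b - 4) = 0"
    if "x \<in> U" "y \<in> U" "y \<noteq> x" "y \<noteq> - x" for x y
    using sh that unfolding shell_def by blast
  obtain y where y: "y \<in> U" "y \<noteq> x" "y \<noteq> - x" by (rule other_inner_product[OF s7 n x])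
  obtain y' where y': "y' \<in> U" "y' \<noteq> x" "y' \<noteq> - x" "(x \<bullet> y')^2 \<noteq> (x \<bullet> y)^2"
    by (rule other_inner_product[OF s7 n x])
  have a0: "b * (n + 4) * (n + 2) \<noteq> 0" using b n by simp
  note v = quadratic_vieta[OF q[OF x y] q[OF x y'(1-3)] y'(4)[symmetric]]
  have "(n + 2) * (6 * (b - 2)) = (n + 2) * (b * (n + 4) * ((x \<bullet> y)^2 + (x \<bullet> y')^2))"
    using v(1) by (simp only: mult_ac)
  then have v1: "6 * (b - 2) = b * (n + 4) * ((x \<bullet> y)^2 + (x \<bullet> y')^2)"
    by (rule mult_left_cancel[THEN iffD1, rotated]) (use n in simp)
  show thesis
    by (rule that[OF y refl y'(1-3) refl y'(4)[symmetric] q[OF x y] v1 v(2)])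
      (rule quadratic_roots_cover[OF q[OF x y] q[OF x y'(1-3)] y'(4)[symmetric] q a0])
qed

text \<open>For \<open>G\<close>, \<open>D\<close> the only two squared inner products with the points of \<open>U\<close>, integer-valued
  functions on \<open>U\<close> that are polynomials of degree at most 3 in the inner product are summed
  against each other with the 7-design property.\<close>

lemma inner_product_sq_rational:
  fixes G D n :: real
  assumes s7: "spherical7 n U" and n: "n \<ge> 2" and rat: "n \<in> \<rat>" "G \<in> \<rat>" "D \<in> \<rat>" and ne: "G \<noteq> D"
    and x: "norm x = 1" and y: "norm y = 1"
    and lx: "\<And>z. z \<in> U \<Longrightarrow> (x \<bullet> z)^2 = G \<or> (x \<bullet> z)^2 = D" and ly: "\<And>z. z \<in> U \<Longrightarrow> (y \<bullet> z)^2 = G \<or> (y \<bullet> z)^2 = D"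
  shows "(x \<bullet> y)^2 \<in> \<rat>"
proof -
  define N where "N = real (card U)"
  have N: "N > 0" "N \<in> \<rat>" using s7_card[OF s7] unfolding N_def by auto
  define I where "I = (\<Sum>z\<in>U. (((x \<bullet> z)^2 - D) / (G - D)) * (((y \<bullet> z)^2 - D) / (G - D)))"
  have "I \<in> \<int>" unfolding I_def
  proof (intro Ints_sum Ints_mult)
    fix z assume z: "z \<in> U"
    show "((x \<bullet> z)^2 - D) / (G - D) \<in> \<int>" using lx[OF z] ne by auto
    show "((y \<bullet> z)^2 - D) / (G - D) \<in> \<int>" using ly[OF z] ne by auto
  qed
  then have I: "I \<in> \<rat>" using Ints_subset_Rats by blast
  have "I * (G - D)^2 = (\<Sum>z\<in>U. ((x \<bullet> z)^2 - D) * ((y \<bullet> z)^2 - D))"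
    unfolding I_def sum_distrib_right using ne by (intro sum.cong) (auto simp: power2_eq_square)
  also have "\<dots> = (\<Sum>z\<in>U. (x \<bullet> z)^2 * (y \<bullet> z)^2 - D * (x \<bullet> z)^2 - D * (y \<bullet> z)^2 + D * D)"
    by (simp add: algebra_simps)
  also have "\<dots> = (\<Sum>z\<in>U. (x \<bullet> z)^2 * (y \<bullet> z)^2) - D * (\<Sum>z\<in>U. (x \<bullet> z)^2) - D * (\<Sum>z\<in>U. (y \<bullet> z)^2)
      + real (card U) * (D * D)"
    by (simp only: sum_subtractf sum.distrib sum_distrib_left sum_constant)
  also have "\<dots> = N * ((1 + 2 * (x \<bullet> y)^2) / (n * (n + 2))) - D * (N / n) - D * (N / n) + N * (D * D)"
    unfolding s7_moments[OF s7 x y] s7_power_moments[OF s7 x] s7_power_moments[OF s7 y] N_def[symmetric] ..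
  finally have "I * (G - D)^2 + 2 * D * (N / n) - N * (D * D) = N * ((1 + 2 * (x \<bullet> y)^2) / (n * (n + 2)))"
    by simp
  moreover have "n * (n + 2) \<noteq> 0" using n by simp
  ultimately have "(x \<bullet> y)^2 = ((I * (G - D)^2 + 2 * D * (N / n) - N * (D * D)) * (n * (n + 2)) / N - 1) / 2"
    using N(1) by simp
  moreover have "\<dots> \<in> \<rat>"
    using I N rat by (intro Rats_divide Rats_diff Rats_mult Rats_add Rats_power) auto
  ultimately show ?thesis by (simp only:)
qed

lemma cubic_moment_sum:
  fixes P Q :: real
  assumes s7: "spherical7 n U" and x: "norm x = 1" and y: "norm y = 1"
  shows "(\<Sum>z\<in>U. ((x \<bullet> z) * ((x \<bullet> z)^2 - P)) * ((y \<bullet> z) * ((y \<bullet> z)^2 - Q)))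
    = card U * ((6 * (x \<bullet> y)^3 + 9 * (x \<bullet> y)) / (n * (n + 2) * (n + 4)) - (P + Q) * (3 * (x \<bullet> y) / (n * (n
        + 2))) + P * Q * ((x \<bullet> y) / n))"
proof -
  have "(\<Sum>z\<in>U. ((x \<bullet> z) * ((x \<bullet> z)^2 - P)) * ((y \<bullet> z) * ((y \<bullet> z)^2 - Q)))
    = (\<Sum>z\<in>U. (x \<bullet> z)^3 * (y \<bullet> z)^3 - Q * ((x \<bullet> z)^3 * (y \<bullet> z)) - P * ((x \<bullet> z) * (y \<bullet> z)^3)
        + P * Q * ((x \<bullet> z) * (y \<bullet> z)))"
    by (simp add: algebra_simps power2_eq_square power3_eq_cube)
  also have "\<dots> = (\<Sum>z\<in>U. (x \<bullet> z)^3 * (y \<bullet> z)^3) - Q * (\<Sum>z\<in>U. (x \<bullet> z)^3 * (y \<bullet> z))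
      - P * (\<Sum>z\<in>U. (x \<bullet> z) * (y \<bullet> z)^3) + P * Q * (\<Sum>z\<in>U. (x \<bullet> z) * (y \<bullet> z))"
    by (simp only: sum_subtractf sum.distrib sum_distrib_left)
  also have "\<dots> = card U * ((6 * (x \<bullet> y)^3 + 9 * (x \<bullet> y)) / (n * (n + 2) * (n + 4)) - (P
      + Q) * (3 * (x \<bullet> y) / (n * (n + 2))) + P * Q * ((x \<bullet> y) / n))"
    unfolding s7_moments[OF s7 x y]
        by (simp only: distrib_left distrib_right right_diff_distrib left_diff_distrib mult_ac)
  finally show ?thesis .
qed

text \<open>The quotient is u / g, a sign, if u^2 = G, and 0 if u^2 = D.\<close>

lemma level_sign_integer:
  fixes u g G D :: real
  assumes "u^2 = G \<or> u^2 = D" "g^2 = G" "g \<noteq> 0" "G \<noteq> D"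
  shows "u * (u^2 - D) / (g * (G - D)) \<in> \<int>"
proof (cases "u^2 = D")
  case False
  then have "u^2 = g^2" using assms by simp
  then have "u = g \<or> u = - g" by (simp add: power2_eq_iff)
  then have "u / g \<in> \<int>" using assms(3) by auto
  moreover have "u * (u^2 - D) / (g * (G - D)) = u / g" using assms False by simp
  ultimately show ?thesis by simp
qed simp

text \<open>The odd cubic attached to x is a sign on level \<open>G\<close> and 0 on level
  \<open>D\<close>; for y the levels are exchanged. Normalization divides by sqrt G and sqrt D,
  whose product is 3 / r with r the square root in the claim, so the integer sum shows that a
  rational multiple of x . y is rational over r. On the moment side everything collapses to 6 c (c^2
  - 1), whence the condition that c^2 is not 1.\<close>

lemma sq_times_rational:
  fixes G D n :: real
  assumes s7: "spherical7 n U" and n: "n \<ge> 2" and rat: "n \<in> \<rat>" "G \<in> \<rat>" "D \<in> \<rat>" and ne: "G \<noteq> D" "G > 0" "D > 0"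
    and GD: "G + D = 6 / (n + 4)" "G * D = 3 / ((n + 4) * (n + 2))"
    and x: "norm x = 1" and y: "norm y = 1" and c: "(x \<bullet> y)^2 \<in> \<rat>" "(x \<bullet> y)^2 \<noteq> 1"
    and lx: "\<And>z. z \<in> U \<Longrightarrow> (x \<bullet> z)^2 = G \<or> (x \<bullet> z)^2 = D" and ly: "\<And>z. z \<in> U \<Longrightarrow> (y \<bullet> z)^2 = G \<or> (y \<bullet> z)^2 = D"
  shows "(x \<bullet> y) * sqrt (3 * (n + 2) * (n + 4)) \<in> \<rat>"
proof -
  define N where "N = real (card U)"
  have N: "N > 0" "N \<in> \<rat>" using s7_card[OF s7] unfolding N_def by auto
  define c where "c = x \<bullet> y"
  define r where "r = sqrt (3 * (n + 2) * (n + 4))"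
  have r2: "r^2 = 3 * (n + 2) * (n + 4)" and r0: "r > 0" using n unfolding r_def by auto
  define g d where "g = sqrt G" and "d = sqrt D"
  have gd: "g^2 = G" "d^2 = D" "g > 0" "d > 0" using ne unfolding g_def d_def by auto
  have "9 / (3 * p * q) = 3 / (q * p)" if "p > 0" "q > 0" for p q :: real
    using that by (simp add: field_simps)
  from this[of "n + 2" "n + 4"] have "(g * d)^2 = (3 / r)^2"
    unfolding power_mult_distrib power_divide gd(1,2) GD(2) r2 using n by simp
  then have gdr: "g * d = 3 / r" using gd r0 by (subst (asm) power2_eq_iff_nonneg) auto
  define I where "I = (\<Sum>z\<in>U. ((x \<bullet> z) * ((x \<bullet> z)^2 - D) / (g * (G - D))) * ((y \<bullet> z) * ((y \<bullet> z)^2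
      - G) / (d * (D - G))))"
  have "I \<in> \<int>" unfolding I_def
  proof (intro Ints_sum Ints_mult)
    fix z assume z: "z \<in> U"
    show "(x \<bullet> z) * ((x \<bullet> z)^2 - D) / (g * (G - D)) \<in> \<int>" using lx[OF z] gd ne
        by (intro level_sign_integer) auto
    show "(y \<bullet> z) * ((y \<bullet> z)^2 - G) / (d * (D - G)) \<in> \<int>" using ly[OF z] gd ne
        by (intro level_sign_integer) auto
  qed
  then have I: "I \<in> \<rat>" using Ints_subset_Rats by blast
  have "(\<Sum>z\<in>U. ((x \<bullet> z) * ((x \<bullet> z)^2 - D)) * ((y \<bullet> z) * ((y \<bullet> z)^2 - G))) = (\<Sum>z\<in>U. - (g * d * (G
      - D)^2) * (((x \<bullet> z) * ((x \<bullet> z)^2 - D) / (g * (G - D))) * ((y \<bullet> z) * ((y \<bullet> z)^2 - G) / (d * (D - G)))))"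
  proof (intro sum.cong refl)
    fix z
    have "f * h = - (g * d * e^2) * ((f / (g * e)) * (h / (d * (- e))))" if "e \<noteq> 0" for f h e :: real
      using gd(3,4) that by (simp add: power2_eq_square)
    from this[of "G - D" "(x \<bullet> z) * ((x \<bullet> z)^2 - D)" "(y \<bullet> z) * ((y \<bullet> z)^2 - G)"]
    show "((x \<bullet> z) * ((x \<bullet> z)^2 - D)) * ((y \<bullet> z) * ((y \<bullet> z)^2 - G)) = - (g * d * (G
        - D)^2) * (((x \<bullet> z) * ((x \<bullet> z)^2 - D) / (g * (G - D))) * ((y \<bullet> z) * ((y \<bullet> z)^2 - G) / (d * (D - G))))"
      using ne(1) unfolding minus_diff_eq right_minus_eq by blast
  qed
  also have "\<dots> = - (g * d * (G - D)^2) * I" unfolding I_def sum_distrib_left ..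
  finally have "- (3 / r * (G - D)^2) * I = N * ((6 * c^3 + 9 * c) / (n * (n + 2) * (n + 4)) - (G
      + D) * (3 * c / (n * (n + 2))) + G * D * (c / n))"
    unfolding cubic_moment_sum[OF s7 x y] gdr N_def c_def by (simp add: add.commute mult.commute)
  also have "\<dots> = N * (6 * c * (c^2 - 1) / (n * (n + 2) * (n + 4)))"
  proof -
    have "(6 * c^3 + 9 * c) / (n * p * q) - 6 / q * (3 * c / (n * p)) + 3 / (q * p) * (c / n) = 6 * c * (c^2
        - 1) / (n * p * q)"
      if "p > 0" "q > 0" for p q
      using n that by (simp add: field_simps power2_eq_square power3_eq_cube)
    from this[of "n + 2" "n + 4"] show ?thesis unfolding GD using n by simp
  qed
  finally have e: "- (3 / r * (G - D)^2) * I = N * (6 * c * (c^2 - 1) / (n * (n + 2) * (n + 4)))" .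
  have "c * r = - (3 * (G - D)^2 * I * (n * (n + 2) * (n + 4))) / (N * 6 * (c^2 - 1))"
  proof -
    have "c^2 - 1 \<noteq> 0" "n * (n + 2) * (n + 4) \<noteq> 0" using c(2) n unfolding c_def by auto
    moreover have "- (3 * (G - D)^2 * I) = r * (N * (6 * c * (c^2 - 1) / (n * (n + 2) * (n + 4))))"
      using e r0 by (simp add: field_simps)
    ultimately show ?thesis using N by (simp add: field_simps)
  qed
  moreover have "(G - D)^2 \<in> \<rat>" using rat by (intro Rats_power Rats_diff)
  then have "- (3 * (G - D)^2 * I * (n * (n + 2) * (n + 4))) / (N * 6 * (c^2 - 1)) \<in> \<rat>"
    using I N rat c(1) unfolding c_def
        by (intro Rats_divide Rats_diff Rats_mult Rats_add Rats_minus_iff[THEN iffD2]) auto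
  ultimately show ?thesis unfolding c_def[symmetric] r_def[symmetric] by (simp only:)
qed

text \<open>The test points now belong to \<open>U\<close>, where z = x and z = y need not lie on
  either level. Both cubics are therefore chosen to vanish on level \<open>A\<close>, the level of
  the pair x, y: at z = x the factor of y is 0, and conversely. Elsewhere the common normalization
  sqrt A' enters squared, which is rational. The conditions on \<open>A\<close> keep the factor
  \<open>M\<close> nonzero.\<close>

lemma inner_product_rational:
  assumes s7: "spherical7 n U" and n: "n \<ge> 2" and rat: "n \<in> \<rat>" "A \<in> \<rat>" "A' \<in> \<rat>" and ne: "A \<noteq> A'" "A' > 0"
    and x: "x \<in> U" and y: "y \<in> U" and A: "(x \<bullet> y)^2 = A"
    and lv: "\<And>x y. x \<in> U \<Longrightarrow> y \<in> U \<Longrightarrow> y \<noteq> x \<Longrightarrow> y \<noteq> - x \<Longrightarrow> (x \<bullet> y)^2 = A \<or> (x \<bullet> y)^2 = A'"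
    and A3: "A * (n + 2) \<noteq> 3" "A * (n + 4) \<noteq> 3"
  shows "x \<bullet> y \<in> \<rat>"
proof -
  define N where "N = real (card U)"
  have N: "N > 0" "N \<in> \<rat>" using s7_card[OF s7] unfolding N_def by auto
  have nx: "norm x = 1" and ny: "norm y = 1" using s7_norm[OF s7] x y by auto
  define c where "c = x \<bullet> y"
  define d where "d = sqrt A'"
  have d: "d^2 = A'" "d > 0" using ne unfolding d_def by auto
  define I where "I = (\<Sum>z\<in>U. ((x \<bullet> z) * ((x \<bullet> z)^2 - A) / (d * (A' - A))) * ((y \<bullet> z) * ((y \<bullet> z)^2
      - A) / (d * (A' - A))))"
  have "I \<in> \<int>" unfolding I_def
  proof (intro Ints_sum)
    fix z assume z: "z \<in> U"
    show "((x \<bullet> z) * ((x \<bullet> z)^2 - A) / (d * (A' - A))) * ((y \<bullet> z) * ((y \<bullet> z)^2 - A) / (d * (A' - A))) \<in> \<int>"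
    proof (cases "z = x \<or> z = - x \<or> z = y \<or> z = - y")
      case True
      then have "(y \<bullet> z)^2 = A \<or> (x \<bullet> z)^2 = A" using A by (auto simp: inner_commute)
      then show ?thesis by auto
    next
      case False
      then have "(x \<bullet> z)^2 = A' \<or> (x \<bullet> z)^2 = A" "(y \<bullet> z)^2 = A' \<or> (y \<bullet> z)^2 = A" using lv x y z by blast+
      then show ?thesis using d ne by (intro Ints_mult level_sign_integer) auto
    qed
  qed
  then have I: "I \<in> \<rat>" using Ints_subset_Rats by blast
  have "(\<Sum>z\<in>U. ((x \<bullet> z) * ((x \<bullet> z)^2 - A)) * ((y \<bullet> z) * ((y \<bullet> z)^2 - A))) = (\<Sum>z\<in>U. (A' * (A'
      - A)^2) * (((x \<bullet> z) * ((x \<bullet> z)^2 - A) / (d * (A' - A))) * ((y \<bullet> z) * ((y \<bullet> z)^2 - A) / (d * (A'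
          - A)))))"
  proof (intro sum.cong refl)
    fix z
    have "f * g = d^2 * e^2 * ((f / (d * e)) * (g / (d * e)))" if "e \<noteq> 0" for f g e :: real
      using d(2) that by (simp add: power2_eq_square)
    from this[of "A' - A" "(x \<bullet> z) * ((x \<bullet> z)^2 - A)" "(y \<bullet> z) * ((y \<bullet> z)^2 - A)"]
    show "((x \<bullet> z) * ((x \<bullet> z)^2 - A)) * ((y \<bullet> z) * ((y \<bullet> z)^2 - A)) = (A' * (A'
        - A)^2) * (((x \<bullet> z) * ((x \<bullet> z)^2 - A) / (d * (A' - A))) * ((y \<bullet> z) * ((y \<bullet> z)^2 - A) / (d * (A'
            - A))))"
      using ne(1) unfolding d(1) by simp
  qed
  also have "\<dots> = A' * (A' - A)^2 * I" unfolding I_def sum_distrib_left ..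
  finally have e: "A' * (A' - A)^2 * I = N * ((6 * c^3 + 9 * c) / (n * (n + 2) * (n + 4)) - (A
      + A) * (3 * c / (n * (n + 2))) + A * A * (c / n))"
    unfolding cubic_moment_sum[OF s7 nx ny] N_def c_def by simp
  define M where "M = (A * (n + 2) - 3) * (A * (n + 4) - 3)"
  have M: "M \<noteq> 0" "M \<in> \<rat>" using A3 rat unfolding M_def by (auto intro!: Rats_mult Rats_diff Rats_add)
  have "(6 * c^3 + 9 * c) / (n * (n + 2) * (n + 4)) - (A + A) * (3 * c / (n * (n + 2))) + A * A * (c / n)
      = c * M / (n * (n + 2) * (n + 4))"
  proof -
    have "c^3 = A * c" using A unfolding c_def by (simp add: power2_eq_square power3_eq_cube)
    then have "(6 * c^3 + 9 * c) / (n * p * q) - (A + A) * (3 * c / (n * p)) + A * A * (c / n) = c * (6 * A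
        + 9 - 6 * A * q + A * A * p * q) / (n * p * q)"
      if "p > 0" "q > 0" for p q
      using n that by (simp add: field_simps)
    from this[of "n + 2" "n + 4"] have "(6 * c^3 + 9 * c) / (n * (n + 2) * (n + 4)) - (A
        + A) * (3 * c / (n * (n + 2))) + A * A * (c / n)
      = c * (6 * A + 9 - 6 * A * (n + 4) + A * A * (n + 2) * (n + 4)) / (n * (n + 2) * (n + 4))" using n
          by simp
    moreover have "6 * A + 9 - 6 * A * (n + 4) + A * A * (n + 2) * (n + 4) = M" unfolding M_def
        by (simp add: algebra_simps)
    ultimately show ?thesis by simp
  qed
  then have "A' * (A' - A)^2 * I = N * (c * M / (n * (n + 2) * (n + 4)))" using e by simp
  moreover have "c = N * (c * M / T) * T / (N * M)" if "T > 0" for T using that N M by simp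
  from this[of "n * (n + 2) * (n + 4)"] have "c = N * (c * M / (n * (n + 2) * (n + 4))) * (n * (n + 2) * (n
      + 4)) / (N * M)"
    using n by simp
  ultimately have "c = A' * (A' - A)^2 * I * (n * (n + 2) * (n + 4)) / (N * M)" by (simp only:)
  moreover have "\<dots> \<in> \<rat>"
    using I N M rat by (intro Rats_divide Rats_diff Rats_mult Rats_add Rats_power) auto
  ultimately show ?thesis unfolding c_def[symmetric] by (simp only:)
qed

section \<open>Nonexistence in higher dimensions\<close>

lemma rat_square_int:
  fixes x :: real and M :: int
  assumes "x \<in> \<rat>" "x^2 = of_int M"
  obtains r :: int where "x = of_int r"
proof -
  have "M \<ge> 0" using assms(2) by (metis of_int_0_le_iff zero_le_power2)
  then have "x^2 = real (nat M)" using assms(2) by simp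
  with assms(1) obtain r :: nat where "\<bar>x\<bar> = real r" by (rule rat_square_nat)
  then have "x = of_int (int r) \<or> x = of_int (- int r)" by (auto simp: abs_if split: if_splits)
  then show thesis using that by blast
qed

lemma unit_inner_sq_eq_1:
  fixes x y :: "'a::real_inner"
  assumes "norm x = 1" "norm y = 1" "(x \<bullet> y)^2 = 1"
  shows "y = x \<or> y = - x"
proof -
  have "x \<bullet> x = 1" "y \<bullet> y = 1" using assms(1,2) by (simp_all add: norm_eq_1)
  moreover have "x \<bullet> y = 1 \<or> x \<bullet> y = -1" using assms(3) by (simp add: power2_eq_1_iff)
  ultimately have "(y - x) \<bullet> (y - x) = 0 \<or> (y + x) \<bullet> (y + x) = 0"
    by (auto simp: inner_diff_left inner_diff_right inner_add_left inner_add_right inner_commute)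
  then show ?thesis by (auto simp: eq_neg_iff_add_eq_0)
qed

text \<open>\<open>cnt\<close> forces s n to divide v, and then the cardinality formula makes L = s
  D (b - 2) / 2 an integer. With rational cosines, the scaled discriminant and product of the roots
  are integers with rational square roots, hence integer ones.\<close>

lemma no_shell_pell:
  fixes s t r v k :: nat and n b c c' :: real
  assumes s: "s \<ge> 1" and n6: "n = 6 * real s^2 - 1" and t: "t^2 = 6 * s^2 + 1" and r: "2 * s^2 + 1 = r^2"
    and card: "2 * real v = n * (n + 1) / 12 * (12 + b * (n - 1))"
    and cnt: "6 * real s * real t * (n * (2 * real k - real v)) = real v * (n + 2) * (4 - 2 * n)"
    and b: "b \<ge> (n + 6) / 2"
    and vieta: "6 * (b - 2) = b * (n + 4) * (c^2 + c'^2)" "3 * (b - 4) = b * (n + 4) * (n + 2) * (c^2 * c'^2)"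
    and rat: "c \<in> \<rat>" "c' \<in> \<rat>"
  shows False
proof -
  define S T Q where "S = real s" and "T = real t" and "Q = real r"
  define R D where "R = 2 * S^2 + 1" and "D = 3 * S^2 - 1"
  have T2: "T^2 = 6 * S^2 + 1" using arg_cong[OF t, of real] unfolding T_def S_def by simp
  have Q2: "Q^2 = R" using arg_cong[OF r, of real] unfolding Q_def S_def R_def by simp
  have S1: "S \<ge> 1" using s unfolding S_def by simp
  have "S^2 \<ge> 1" using S1 by (simp add: one_le_power)
  then have D0: "D > 0" and R0: "R > 0" unfolding D_def R_def by auto
  have T0: "T > 0" using T2 \<open>S^2 \<ge> 1\<close> unfolding T_def by (cases "t = 0") auto
  have n: "n = 6 * S^2 - 1" using n6 unfolding S_def .
  have n0: "n > 0" using n \<open>S^2 \<ge> 1\<close> by simp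
  have b0: "b > 0" using b n0 by simp
  have irat: "S \<in> \<rat>" "T \<in> \<rat>" "Q \<in> \<rat>" unfolding S_def T_def Q_def by auto
  have nrat: "n \<in> \<rat>" "R \<in> \<rat>" "D \<in> \<rat>" unfolding n R_def D_def using irat by auto
  define N :: int where "N = 6 * int s^2 - 1"
  have NN: "n = of_int N" unfolding n N_def S_def by simp
  \<comment> \<open>With n + 2 = t^2 and 4 - 2 n = - 6 (2 s^2 - 1) the count becomes s n (2 k - v) =
    - v t (2 s^2 - 1), and s n is coprime to t (2 s^2 - 1).\<close>
  have div: "int s * N dvd int v"
  proof -
    have "6 * T * (S * (n * (2 * real k - real v))) = 6 * T * (- (real v * T * (2 * S^2 - 1)))"
    proof -
      have "n + 2 = T * T" using n T2 by (simp add: power2_eq_square)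
      moreover have "4 - 2 * n = - 6 * (2 * S^2 - 1)" using n by simp
      moreover have "6 * T * (S * (n * (2 * real k - real v))) = real v * (n + 2) * (4 - 2 * n)"
        using cnt unfolding S_def[symmetric] T_def[symmetric] by (simp only: mult_ac)
      ultimately have "6 * T * (S * (n * (2 * real k - real v))) = real v * (T * T) * (- 6 * (2 * S^2 - 1))"
        by (simp only:)
      then show ?thesis by (simp add: algebra_simps)
    qed
    then have "S * (n * (2 * real k - real v)) = - (real v * T * (2 * S^2 - 1))"
      by (rule mult_left_cancel[THEN iffD1, rotated]) (use T0 in simp)
    then have "real_of_int (int s * (N * (2 * int k - int v)))
        = real_of_int (- (int v * int t * (2 * int s^2 - 1)))"
      unfolding S_def T_def NN by simp
    then have "int s * (N * (2 * int k - int v)) = - (int v * int t * (2 * int s^2 - 1))"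
      by (simp only: of_int_eq_iff)
    then have "int v * (int t * (2 * int s^2 - 1)) = int s * N * (int v - 2 * int k)"
      by (simp add: algebra_simps)
    then have d: "int s * N dvd int v * (int t * (2 * int s^2 - 1))" by simp
    have ti: "int t^2 = 6 * int s^2 + 1" using arg_cong[OF t, of int] by simp
    have "coprime (int s) (int t)"
    proof (rule coprimeI)
      fix c assume "c dvd int s" "c dvd int t"
      then have "c dvd int t * int t - 6 * int s * int s" by simp
      then show "is_unit c" using ti by (simp add: power2_eq_square)
    qed
    moreover have "coprime (int s) (2 * int s^2 - 1)"
    proof (rule coprimeI)
      fix c assume c: "c dvd int s" "c dvd 2 * int s^2 - 1"
      have "c dvd int s * (2 * int s) - (2 * int s^2 - 1)" by (rule dvd_diff[OF dvd_mult2[OF c(1)] c(2)])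
      also have "int s * (2 * int s) - (2 * int s^2 - 1) = 1" by (simp add: power2_eq_square)
      finally show "is_unit c" .
    qed
    moreover have odd: "is_unit c" if "c dvd N" "c dvd 2" for c
    proof -
      have "c dvd 2 * (3 * int s^2) - N" by (rule dvd_diff[OF dvd_mult2[OF that(2)] that(1)])
      also have "2 * (3 * int s^2) - N = 1" by (simp add: N_def)
      finally show ?thesis .
    qed
    have "coprime N (int t)"
    proof (rule coprimeI)
      fix c assume "c dvd N" "c dvd int t"
      then have "c dvd int t * int t - N" by simp
      then have "c dvd 2" using ti by (simp add: power2_eq_square N_def)
      then show "is_unit c" using odd \<open>c dvd N\<close> by blast
    qed
    moreover have "coprime N (2 * int s^2 - 1)"
    proof (rule coprimeI)
      fix c assume c: "c dvd N" "c dvd 2 * int s^2 - 1"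
      have "c dvd N - 3 * (2 * int s^2 - 1)" by (rule dvd_diff[OF c(1) dvd_mult[OF c(2)]])
      also have "N - 3 * (2 * int s^2 - 1) = 2" by (simp add: N_def)
      finally have "c dvd 2" .
      then show "is_unit c" using odd c by blast
    qed
    ultimately have "coprime (int s * N) (int t * (2 * int s^2 - 1))" by simp
    then show ?thesis using d by (simp add: coprime_dvd_mult_left_iff)
  qed
  then obtain u where u: "int v = int s * N * u" by (auto elim: dvdE)
  then have vr: "real v = S * n * of_int u" unfolding S_def NN by (metis of_int_mult of_int_of_nat_eq)
  have "2 * (S * n) * of_int u = (S * n) * (6 * S + S * b * D)"
    using card unfolding vr n D_def by (simp add: field_simps power2_eq_square)
  then have ur: "2 * of_int u = 6 * S + S * b * D" using S1 n0 by simp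
  define L where "L = u - 3 * int s - int s * (3 * int s^2 - 1)"
  have Lr: "of_int L = S * D * (b - 2) / 2"
  proof -
    have "2 * real_of_int L = 2 * of_int u - 6 * S - 2 * S * D" unfolding L_def S_def D_def
        by (simp add: algebra_simps)
    then show ?thesis unfolding ur by (simp add: algebra_simps)
  qed
  have brat: "b \<in> \<rat>"
  proof -
    have "b = (2 * of_int u - 6 * S) / (S * D)" using ur S1 D0 by (simp add: field_simps)
    then show ?thesis using irat nrat by auto
  qed
  have n4: "n + 4 = 3 * R" and n2: "n + 2 = T^2" unfolding n R_def T2 by auto
  have v1: "b * R * (c^2 + c'^2) = 2 * (b - 2)" using vieta(1) unfolding n4 by simp
  have v2: "b * R * T^2 * (c^2 * c'^2) = b - 4" using vieta(2) unfolding n4 n2 by simp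
  \<comment> \<open>\<open>Z\<close> comes from the discriminant (sum)^2 - 4 (product) of the
    squared cosines, \<open>M\<close> from their product and b (b - 4) = (b - 2)^2 - 4. The factors
    are chosen so that the right-hand sides become expressions in L; \<open>M\<close> is rational
    because R is the square of \<open>Q\<close>.\<close>
  define Z where "Z = D * b * R * T * \<bar>c^2 - c'^2\<bar> / 4"
  define M where "M = S * D * b * Q * T * \<bar>c * c'\<bar> / 2"
  have "Z^2 = D^2 * (T^2 * (b * R * (c^2 + c'^2))^2 - 4 * b * R * (b * R * T^2 * (c^2 * c'^2))) / 16"
    unfolding Z_def by (simp add: power_mult_distrib power_divide) (simp add: algebra_simps power2_eq_square)
  also have "\<dots> = D^2 * (T^2 * (2 * (b - 2))^2 - 4 * b * R * (b - 4)) / 16" unfolding v1 v2 ..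
  also have "\<dots> = 4 * (S * D * (b - 2) / 2)^2 + R * D^2"
    unfolding T2 R_def by (simp add: field_simps power2_eq_square)
  finally have Z2: "Z^2 = of_int (4 * L^2 + (2 * int s^2 + 1) * (3 * int s^2 - 1)^2)"
    unfolding Lr[symmetric] unfolding R_def D_def S_def by simp
  have "Z \<in> \<rat>" unfolding Z_def using rat brat irat nrat by (intro Rats_divide Rats_mult) (auto simp: abs_if)
  then obtain z where z: "Z = of_int z" using Z2 by (rule rat_square_int)
  have "M^2 = S^2 * D^2 * b * (b * R * T^2 * (c^2 * c'^2)) / 4"
    unfolding M_def using Q2 by (simp add: power_mult_distrib power_divide) (simp add: algebra_simps
        power2_eq_square)
  also have "\<dots> = (S * D * (b - 2) / 2)^2 - S^2 * D^2"
    unfolding v2 by (simp add: field_simps power2_eq_square)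
  finally have M2: "M^2 = of_int (L^2 - int s^2 * (3 * int s^2 - 1)^2)"
    unfolding Lr[symmetric] unfolding D_def S_def by simp
  have "M \<in> \<rat>" unfolding M_def using rat brat irat nrat by (intro Rats_divide Rats_mult) (auto simp: abs_if)
  then obtain \<mu> where \<mu>: "M = of_int \<mu>" using M2 by (rule rat_square_int)
  show False
  proof (rule no_integral_shell[of "int s" "int t" "2 * int s^2 + 1" "3 * int s^2 - 1" z L \<mu>])
    show "1 \<le> int s" using s by simp
    show "int t^2 = 6 * int s^2 + 1" using arg_cong[OF t, of int] by simp
    show "z^2 = 4 * L^2 + (2 * int s^2 + 1) * (3 * int s^2 - 1)^2"
      using Z2 unfolding z by (simp only: of_int_eq_iff flip: of_int_power)
    have "\<mu>^2 = L^2 - int s^2 * (3 * int s^2 - 1)^2"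
      using M2 unfolding \<mu> by (simp only: of_int_eq_iff flip: of_int_power)
    then show "L^2 = int s^2 * (3 * int s^2 - 1)^2 + \<mu>^2" by simp
    have "Z \<ge> 0" unfolding Z_def using D0 b0 R0 T0 by simp
    then show "0 \<le> z" unfolding z by simp
    have "M \<ge> 0" unfolding M_def Q_def using S1 D0 b0 T0 by simp
    then show "0 \<le> \<mu>" unfolding \<mu> by simp
    have "S * D * T^2 \<le> S * D * (2 * (b - 2))"
      using b S1 D0 n2 by (intro mult_left_mono) auto
    then have "S * D * T^2 \<le> 4 * of_int L" unfolding Lr by (simp add: algebra_simps)
    then have "real_of_int (int s * (3 * int s^2 - 1) * int t^2) \<le> real_of_int (4 * L)"
      unfolding S_def D_def T_def by simp
    then show "int s * (3 * int s^2 - 1) * int t^2 \<le> 4 * L" by (simp only: of_int_le_iff)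
  qed auto
qed

text \<open>\<open>G\<close> and \<open>D\<close> are the squared zeros of the Gegenbauer
  polynomial. Each layer serves as a set of test points for the other, and \<open>U1\<close> also
  for itself. The ordering gives b1 > 4, hence two positive levels inside \<open>U1\<close>.\<close>

lemma no_shell_pair:
  fixes m :: nat and n b1 b2 :: real and U1 U2 :: "'a::real_inner set"
  assumes m: "m \<ge> 3" and nm: "n = real m"
    and sh1: "shell n b1 U1" and sh2: "shell n b2 U2" and sum: "b1 + b2 = n + 6" and ord: "b1 \<ge> b2"
    and cross: "\<And>x y. x \<in> U1 \<Longrightarrow> y \<in> U2 \<Longrightarrow> (n + 4) * (n + 2) * ((x \<bullet> y)^2)^2 - 6 * (n + 2) * (x \<bullet> y)^2 + 3 = 0"
  shows False
proof -
  have s1: "spherical7 n U1" and s2: "spherical7 n U2" using sh1 sh2 unfolding shell_def by auto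
  have n3: "n \<ge> 3" and n2: "n \<ge> 2" and nrat: "n \<in> \<rat>" using m nm by auto
  have b: "b1 \<ge> (n + 6) / 2" using sum ord by simp
  have b4: "b1 > 4" and b0: "b1 > 0" using b n3 by auto
  define \<rho> where "\<rho> = sqrt (6 * (n + 1) * (n + 2))"
  have \<rho>2: "\<rho>^2 = 6 * (n + 1) * (n + 2)" and \<rho>0: "\<rho> > 0" using n3 unfolding \<rho>_def by auto
  define E where "E = (n + 4) * (n + 2)"
  have E0: "E > 0" unfolding E_def using n3 by (intro mult_pos_pos) auto
  define G D where "G = (3 * (n + 2) + \<rho>) / E" and "D = (3 * (n + 2) - \<rho>) / E"
  have GD: "G + D = 6 / (n + 4)" "G * D = 3 / E"
  proof -
    have "G + D = 6 * (n + 2) / E" unfolding G_def D_def by (simp flip: add_divide_distrib)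
    moreover have "6 * (n + 2) / ((n + 4) * (n + 2)) = 6 / (n + 4)"
      by (rule nonzero_mult_divide_mult_cancel_right) (use n3 in simp)
    ultimately show "G + D = 6 / (n + 4)" unfolding E_def by (simp only:)
    have "G * D = ((3 * (n + 2))^2 - \<rho>^2) / E^2" unfolding G_def D_def
        by (simp add: power2_eq_square algebra_simps)
    also have "(3 * (n + 2))^2 - \<rho>^2 = 3 * E" unfolding \<rho>2 E_def by (simp add: algebra_simps power2_eq_square)
    finally show "G * D = 3 / E" using E0 by (simp add: power2_eq_square)
  qed
  have GmD: "G - D = 2 * \<rho> / E" unfolding G_def D_def by (simp flip: diff_divide_distrib)
  have ne: "G \<noteq> D" using GmD \<rho>0 E0 by auto
  have Gpos: "G > 0" unfolding G_def using \<rho>0 n3 E0 by (intro divide_pos_pos) auto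
  then have Dpos: "D > 0" using GD(2) E0 by (metis divide_pos_pos zero_less_mult_pos zero_less_numeral)
  have lev: "(x \<bullet> y)^2 = G \<or> (x \<bullet> y)^2 = D" if "x \<in> U1" "y \<in> U2" for x y
  proof -
    define q where "q = (x \<bullet> y)^2"
    have "E * ((q - G) * (q - D)) = E * q^2 - E * (G + D) * q + E * (G * D)"
        by (simp add: algebra_simps power2_eq_square)
    also have "\<dots> = E * q^2 - 6 * (n + 2) * q + 3" unfolding GD using E0 n3 by (simp add: E_def)
    also have "\<dots> = 0" using cross[OF that] unfolding E_def q_def by simp
    finally show ?thesis using E0 unfolding q_def by simp
  qed
  obtain x0 where x0: "x0 \<in> U2" using s7_nonempty[OF s2] by blast
  obtain v k :: nat where v: "card U1 = 2 * v" and k: "v * (1 / n - D) = k * (G - D)"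
  proof (rule two_level_count[OF s1])
    show "norm x0 = 1" using s7_norm[OF s2 x0] .
    show "(x0 \<bullet> z)^2 = G \<or> (x0 \<bullet> z)^2 = D" if "z \<in> U1" for z using lev[OF that x0]
        by (simp add: inner_commute)
  qed (use ne Gpos Dpos in auto)
  have "v > 0" using s7_card[OF s1] v by simp
  \<comment> \<open>The second moment of \<open>U1\<close> seen from one point of \<open>U2\<close>.
    The right-hand side is 0 for n = 2 but not for n >= 3, where it makes \<open>\<rho>\<close>
    rational.\<close>
  have cnt: "\<rho> * (n * (2 * real k - real v)) = real v * (n + 2) * (4 - 2 * n)"
  proof -
    have "n * E * (v * (1 / n - D)) = v * (E - n * (3 * (n + 2) - \<rho>))"
      unfolding D_def using n3 E0 by (simp add: field_simps)
    moreover have "n * E * (k * (G - D)) = 2 * n * k * \<rho>" unfolding GmD using E0 by simp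
    ultimately have "v * (E - n * (3 * (n + 2) - \<rho>)) = 2 * n * k * \<rho>" using k by simp
    then show ?thesis unfolding E_def by (simp add: algebra_simps)
  qed
  have \<rho>rat: "\<rho> \<in> \<rat>"
  proof -
    have "real v * (n + 2) * (4 - 2 * n) \<noteq> 0" using \<open>v > 0\<close> n3 by simp
    then have "n * (2 * real k - real v) \<noteq> 0" using cnt by auto
    then have "\<rho> = real v * (n + 2) * (4 - 2 * n) / (n * (2 * real k - real v))" using cnt
        by (simp add: field_simps)
    then show ?thesis using nrat by auto
  qed
  have "\<rho>^2 = real (6 * (m + 1) * (m + 2))" unfolding \<rho>2 nm by (simp add: algebra_simps)
  with \<rho>rat obtain j0 :: nat where j0: "6 * (m + 1) * (m + 2) = j0^2" "\<bar>\<rho>\<bar> = real j0"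
    by (rule rat_square_nat)
  have "2 dvd j0^2" "3 dvd j0^2" unfolding j0(1)[symmetric] by (simp_all add: mult.assoc)
  then have "2 dvd j0" "3 dvd j0" using prime_dvd_power[of "2::nat" j0 2] prime_dvd_power[of "3::nat" j0 2]
      by auto
  then have "6 dvd j0" by presburger
  then obtain j where j: "j0 = 6 * j" by (auto elim: dvdE)
  have "6 * ((m + 1) * (m + 2)) = 6 * (6 * j^2)" using j0(1) unfolding j
      by (simp add: power_mult_distrib algebra_simps)
  then have jj: "(m + 1) * ((m + 1) + 1) = 6 * j^2" by simp
  have \<rho>j: "\<rho> = 6 * real j" using j0(2) \<rho>0 unfolding j by simp
  \<comment> \<open>For n = 3, 4, 5, 6 the number (n + 1) (n + 2) / 6 is not a square. The bound
    serves to show that A (n + 2) is not 3.\<close>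
  have n7: "n \<ge> 7"
  proof (rule ccontr)
    assume "\<not> n \<ge> 7"
    then have "m = 3 \<or> m = 4 \<or> m = 5 \<or> m = 6" using m nm by auto
    then have "6 * j^2 = 20 \<or> 6 * j^2 = 30 \<or> 6 * j^2 = 42 \<or> 6 * j^2 = 56" unfolding jj[symmetric] by auto
    moreover have "j^2 \<le> 4" if "j \<le> 2" using power_mono[OF that, of 2] by simp
    moreover have "j^2 \<ge> 9" if "j \<ge> 3" using power_mono[OF that, of 2] by simp
    moreover have "j \<le> 2 \<or> j \<ge> 3" by auto
    moreover define q where "q = j^2"
    ultimately have "q \<le> 4 \<or> q \<ge> 9" "6 * q = 20 \<or> 6 * q = 30 \<or> 6 * q = 42 \<or> 6 * q = 56" by auto
    then show False by presburger
  qed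
  have GDrat: "G \<in> \<rat>" "D \<in> \<rat>" unfolding G_def D_def E_def using nrat \<rho>rat by auto
  have sqrat: "(x \<bullet> y)^2 \<in> \<rat>" if "x \<in> U1" "y \<in> U1" for x y
    using inner_product_sq_rational[OF s2 n2 nrat GDrat ne s7_norm[OF s1 that(1)] s7_norm[OF s1 that(2)]
        lev[OF that(1)] lev[OF that(2)]] by simp
  obtain x where x: "x \<in> U1" using s7_nonempty[OF s1] by blast
  obtain y y' A A' where y: "y \<in> U1" "y \<noteq> x" "y \<noteq> - x" "(x \<bullet> y)^2 = A" and y': "y' \<in> U1" "y' \<noteq> x" "y' \<noteq>
      - x" "(x \<bullet> y')^2 = A'"
    and AA: "A \<noteq> A'" "b1 * (n + 4) * (n + 2) * A^2 - 6 * (n + 2) * (b1 - 2) * A + 3 * (b1 - 4) = 0"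
    "6 * (b1 - 2) = b1 * (n + 4) * (A + A')" "3 * (b1 - 4) = b1 * (n + 4) * (n + 2) * (A * A')"
    and lv: "\<And>x y. x \<in> U1 \<Longrightarrow> y \<in> U1 \<Longrightarrow> y \<noteq> x \<Longrightarrow> y \<noteq> - x \<Longrightarrow> (x \<bullet> y)^2 = A \<or> (x \<bullet> y)^2 = A'"
    by (rule shell_two_inner_products[OF sh1 n2 b0 x]) blast
  have Arat: "A \<in> \<rat>" "A' \<in> \<rat>" using sqrat x y y' by auto
  have "b1 * (n + 4) * (n + 2) * (A * A') > 0" using AA(4) b4 by simp
  then have "A * A' \<noteq> 0" by auto
  then have A0: "A > 0" "A' > 0" using y(4) y'(4) by (auto simp: less_le)
  \<comment> \<open>Testing on \<open>U2\<close> gives all cosines of \<open>U1\<close> up to one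
    common square root. Testing on \<open>U1\<close> makes a single cosine rational, and then the
    root and the other cosine follow.\<close>
  have qr: "(x \<bullet> u) * sqrt (3 * (n + 2) * (n + 4)) \<in> \<rat>" if u: "u \<in> U1" "u \<noteq> x" "u \<noteq> - x" for u
  proof (rule sq_times_rational[OF s2 n2 nrat GDrat ne Gpos Dpos GD[unfolded E_def] s7_norm[OF s1 x]
      s7_norm[OF s1 u(1)] sqrat[OF x u(1)] _ lev[OF x] lev[OF u(1)]])
    show "(x \<bullet> u)^2 \<noteq> 1" using unit_inner_sq_eq_1[OF s7_norm[OF s1 x] s7_norm[OF s1 u(1)]] u by blast
  qed
  \<comment> \<open>A (n + 4) = 3 would give b1 = 4; A (n + 2) = 3, treated next, would give b1 (n -
    1) = 4 (n + 2), too small for b1 >= (n + 6) / 2.\<close>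
  have A3: "A * (n + 4) \<noteq> 3"
  proof
    assume e: "A * (n + 4) = 3"
    have "0 = (n + 4) * (b1 * (n + 4) * (n + 2) * A^2 - 6 * (n + 2) * (b1 - 2) * A + 3 * (b1
        - 4))" unfolding AA(2) by simp
    also have "\<dots> = b1 * (n + 2) * (A * (n + 4))^2 - 6 * (n + 2) * (b1 - 2) * (A * (n + 4)) + 3 * (b1
        - 4) * (n + 4)"
      by (simp add: algebra_simps power2_eq_square)
    also have "\<dots> = - 6 * (n + 1) * (b1 - 4)" unfolding e by (simp add: algebra_simps)
    finally show False using n3 b4 by simp
  qed
  have A2: "A * (n + 2) \<noteq> 3"
  proof
    assume e: "A * (n + 2) = 3"
    have "0 = (n + 2) * (b1 * (n + 4) * (n + 2) * A^2 - 6 * (n + 2) * (b1 - 2) * A + 3 * (b1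
        - 4))" unfolding AA(2) by simp
    also have "\<dots> = b1 * (n + 4) * (A * (n + 2))^2 - 6 * (n + 2) * (b1 - 2) * (A * (n + 2)) + 3 * (b1
        - 4) * (n + 2)"
      by (simp add: algebra_simps power2_eq_square)
    also have "\<dots> = 6 * (4 * (n + 2) - b1 * (n - 1))" unfolding e by (simp add: algebra_simps)
    finally have "b1 * (n - 1) = 4 * (n + 2)" by simp
    moreover have "(n + 6) / 2 * (n - 1) \<le> b1 * (n - 1)" using b n3 by (intro mult_right_mono) auto
    ultimately have "n * n \<le> 3 * n + 22" by (simp add: field_simps)
    moreover have "7 * n \<le> n * n" using n7 by (intro mult_right_mono) auto
    ultimately show False using n7 by simp
  qed
  have crat: "x \<bullet> y \<in> \<rat>"
    by (rule inner_product_rational[OF s1 n2 nrat Arat AA(1) A0(2) x y(1) y(4) lv A2 A3])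
  define q where "q = sqrt (3 * (n + 2) * (n + 4))"
  have q2: "q^2 = real (3 * (m + 2) * (m + 4))" and q0: "q > 0"
    using n3 unfolding q_def by (simp add: nm algebra_simps, simp)
  have "x \<bullet> y \<noteq> 0" using y(4) A0 by auto
  have "((x \<bullet> y) * q) / (x \<bullet> y) \<in> \<rat>" using qr[OF y(1-3)] crat unfolding q_def by (rule Rats_divide)
  then have qrat: "q \<in> \<rat>" using \<open>x \<bullet> y \<noteq> 0\<close> by simp
  have "((x \<bullet> y') * q) / q \<in> \<rat>" using qr[OF y'(1-3)] qrat unfolding q_def by (rule Rats_divide)
  then have c'rat: "x \<bullet> y' \<in> \<rat>" using q0 by simp
  obtain h :: nat where h: "3 * (m + 2) * (m + 4) = h^2" using qrat q2 by (rule rat_square_nat)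
  show False
  proof (rule six_times_square_cases[OF jj])
    show "0 < m + 1" by simp
  next
    \<comment> \<open>In this case n + 4 = 3 t^2 + 2 would be a square congruent to 2 modulo
      3.\<close>
    fix s t assume st: "m + 1 = 2 * s^2" "m + 1 + 1 = 3 * t^2"
    have m2: "m + 2 = 3 * t^2" using st(2) by simp
    have "(3 * t)^2 * (m + 4) = h^2" unfolding h[symmetric] m2 by (simp add: power_mult_distrib)
    moreover have "3 * t \<noteq> 0" using st(2) by (cases "t = 0") auto
    ultimately obtain e where "m + 4 = e^2" by (rule square_of_ratio)
    then have "e^2 = 3 * t^2 + 2" using st(2) by simp
    moreover have "(3 * t^2 + 2) mod 3 = 2" by presburger
    ultimately show False using square_mod_3[of e] by simp
  next
    fix s t assume st: "m + 1 = 6 * s^2" "m + 1 + 1 = t^2"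
    have m4: "m + 4 = 3 * (2 * s^2 + 1)" using st(1) by simp
    have m2: "m + 2 = t^2" using st(2) by simp
    have "(3 * t)^2 * (2 * s^2 + 1) = h^2" unfolding h[symmetric] m2 m4
        by (simp add: power_mult_distrib algebra_simps)
    moreover have "3 * t \<noteq> 0" using st(2) by (cases "t = 0") auto
    ultimately obtain r where r: "2 * s^2 + 1 = r^2" by (rule square_of_ratio)
    have s0: "s \<ge> 1" using st(1) by (cases "s = 0") auto
    have "6 * (s * t)^2 = 6 * j^2" using jj unfolding st(2) unfolding st(1) by (simp add: power_mult_distrib)
    then have "(s * t)^2 = j^2" by simp
    then have "s * t = j" by (simp only: power2_eq_iff_nonneg)
    then have \<rho>st: "\<rho> = 6 * real s * real t" using \<rho>j by auto
    have nr: "n = 6 * real s^2 - 1" using arg_cong[OF st(1), of real] nm by simp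
    show False
    proof (rule no_shell_pell[OF s0 nr _ r _ cnt[unfolded \<rho>st] b _ _ crat c'rat])
      show "t^2 = 6 * s^2 + 1" using st by simp
      show "2 * real v = n * (n + 1) / 12 * (12 + b1 * (n - 1))"
        using sh1 v unfolding shell_def by simp
      show "6 * (b1 - 2) = b1 * (n + 4) * ((x \<bullet> y)^2 + (x \<bullet> y')^2)" using AA(3) y(4) y'(4) by simp
      show "3 * (b1 - 4) = b1 * (n + 4) * (n + 2) * ((x \<bullet> y)^2 * (x \<bullet> y')^2)" using AA(4) y(4) y'(4) by simp
    qed
  qed
qed

section \<open>The planar case\<close>

context tight_two_shell
begin

section \<open>Normalized layers as spherical designs\<close>

lemma weight_layer: "x \<in> layer X r \<Longrightarrow> w x = 1 / (2 * \<kappa> r)"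
proof -
  assume "x \<in> layer X r"
  then have x: "x \<in> X" "norm x = r" unfolding layer_def by auto
  then have "2 * w x * \<kappa> r = 1" using antipodal_weight(3) by blast
  then show ?thesis using \<kappa>_pos[OF norm_in[OF x(1)]] x(2) by (simp add: field_simps)
qed

lemma card_layer: "r \<in> {r1, r2} \<Longrightarrow> real (card (layer X r)) = 2 * W r * \<kappa> r"
  using weight_layer \<kappa>_pos[of r] unfolding W_def by (simp add: weight_layer)

lemma finite_layer: "finite (layer X r)"
  using fin unfolding layer_def by simp

definition U :: "real \<Rightarrow> (real^'n) set" where "U r = (\<lambda>z. z /\<^sub>R r) ` layer X r"

lemma inj_scale: "r \<in> {r1, r2} \<Longrightarrow> inj_on (\<lambda>z::real^'n. z /\<^sub>R r) A"
  using rpos[of r] by (intro inj_onI) auto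

lemma card_U: "r \<in> {r1, r2} \<Longrightarrow> card (U r) = card (layer X r)"
  unfolding U_def by (rule card_image) (rule inj_scale)

lemma U_iff: "r \<in> {r1, r2} \<Longrightarrow> z \<in> U r \<longleftrightarrow> norm z = 1 \<and> r *\<^sub>R z \<in> X"
proof -
  assume r: "r \<in> {r1, r2}"
  have "r > 0" using rpos[OF r] .
  then show ?thesis unfolding U_def layer_def by (auto intro!: image_eqI[of _ _ "r *\<^sub>R z"])
qed

text \<open>Multiplying by \<open>radial r\<close> isolates one layer at the cost of two degrees, so
  exactness in degree 9 leaves degree 7. The weight is constant on a layer, which turns the weighted
  sum into a plain one.\<close>

lemma U_moment:
  assumes r: "r \<in> {r1, r2}" and ab: "a + b \<le> 7"
  shows "(\<Sum>z\<in>U r. (x \<bullet> z)^a * (y \<bullet> z)^b) = card (U r) * moment a b x y"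
proof -
  have r0: "r > 0" using rpos[OF r] .
  let ?g = "\<lambda>z. (x \<bullet> z)^a * (y \<bullet> z)^b"
  let ?f = "\<lambda>z. radial r z * ?g z"
  have f: "poly_deg_le 9 ?f"
    using ab by (intro poly_deg_le_mult[OF poly_deg_le_radial, of 7] poly_deg_le_mult[of a _ b]
      poly_deg_le_power[OF poly_deg_le_inner]) auto
  have rad: "radial r z = (if norm z = r then 1 else 0)" if "z \<in> X" for z
    using radial_scale[OF r norm_in[OF that] refl] .
  have "(\<Sum>z\<in>X. w z * ?f z) = (\<Sum>z\<in>layer X r. w z * ?g z)"
    using fin rad unfolding layer_def
    by (intro sum.mono_neutral_cong_right) auto
  also have "\<dots> = (\<Sum>z\<in>layer X r. ?g z) / (2 * \<kappa> r)"
    unfolding sum_divide_distrib by (intro sum.cong) (auto simp: weight_layer)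
  finally have L: "(\<Sum>z\<in>X. w z * ?f z) = (\<Sum>z\<in>layer X r. ?g z) / (2 * \<kappa> r)" .
  have "(\<integral>z. ?f (s *\<^sub>R z) \<partial>usphere) = (if s = r then r^(a+b) * moment a b x y else 0)"
      if s: "s \<in> {r1, r2}" for s
  proof -
    have "(\<integral>z. ?f (s *\<^sub>R z) \<partial>usphere) = (\<integral>z. (if s
        = r then r^(a+b) else 0) * ((x \<bullet> z)^a * (y \<bullet> z)^b) \<partial>usphere)"
    proof (rule usphere_cong)
      fix z :: "real^'n" assume "norm z = 1"
      then have "norm (s *\<^sub>R z) = s" using rpos[OF s] by simp
      from radial_scale[OF r s this] show "?f (s *\<^sub>R z) = (if s
          = r then r^(a+b) else 0) * ((x \<bullet> z)^a * (y \<bullet> z)^b)"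
        by (simp add: power_mult_distrib power_add mult_ac)
    next
      show "continuous_on UNIV (\<lambda>z. ?f (s *\<^sub>R z))"
        by (rule continuous_on_compose2[OF poly_deg_le_continuous[OF f, of UNIV]]) (auto intro!:
            continuous_intros)
    qed (intro continuous_intros)
    then show ?thesis unfolding moment_def by simp
  qed
  then have "(\<Sum>z\<in>X. w z * ?f z) = (\<Sum>s\<in>{r1, r2}. W s * (if s = r then r^(a+b) * moment a b x y else 0))"
    unfolding exact[OF f] by (intro sum.cong) auto
  also have "\<dots> = W r * (r^(a+b) * moment a b x y)" using r r12 by auto
  finally have "(\<Sum>z\<in>layer X r. ?g z) = 2 * W r * \<kappa> r * (r^(a+b) * moment a b x y)"
    unfolding L using \<kappa>_pos[OF r] by (simp add: field_simps)
  then have S: "(\<Sum>z\<in>layer X r. ?g z) = card (layer X r) * r^(a+b) * moment a b x y"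
    using card_layer[OF r] by simp
  have "(\<Sum>z\<in>U r. ?g z) = (\<Sum>z\<in>layer X r. ?g (z /\<^sub>R r))"
    unfolding U_def by (subst sum.reindex[OF inj_scale[OF r]]) simp
  also have "\<dots> = (\<Sum>z\<in>layer X r. ?g z) / r^(a+b)"
    unfolding sum_divide_distrib using r0
    by (intro sum.cong refl) (simp add: power_mult_distrib power_add field_simps)
  also have "\<dots> = card (U r) * moment a b x y" unfolding S card_U[OF r] using r0 by simp
  finally show ?thesis .
qed

lemma spherical7_U:
  assumes r: "r \<in> {r1, r2}"
  shows "spherical7 n (U r)"
  unfolding spherical7_def
proof (intro conjI allI impI ballI)
  show "finite (U r)" unfolding U_def using finite_layer by simp
  show "U r \<noteq> {}"
  proof -
    have "r \<in> norm ` X" using r radii by simp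
    then show ?thesis unfolding U_def layer_def by auto
  qed
  show "norm z = 1" "- z \<in> U r" if "z \<in> U r" for z
    using that antipodal_weight(1)[of "r *\<^sub>R z"] unfolding U_iff[OF r] by auto
next
  fix x y :: "real^'n" assume n1: "norm x = 1" "norm y = 1"
  show "(\<Sum>z\<in>U r. (x \<bullet> z) * (y \<bullet> z)) = card (U r) * ((x \<bullet> y) / n)"
    using U_moment[OF r, of 1 1 x y] unfolding moment_deg2 n_eq[symmetric] by simp
  show "(\<Sum>z\<in>U r. (x \<bullet> z)^2 * (y \<bullet> z)^2) = card (U r) * ((1 + 2 * (x \<bullet> y)^2) / (n * (n + 2)))"
    using U_moment[OF r, of 2 2 x y] unfolding moment_deg4 n_eq[symmetric] n1 by (simp add: add.commute)
  show "(\<Sum>z\<in>U r. (x \<bullet> z)^3 * (y \<bullet> z)) = card (U r) * (3 * (x \<bullet> y) / (n * (n + 2)))"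
    using U_moment[OF r, of 3 1 x y] unfolding moment_deg4 n_eq[symmetric] n1 by simp
  show "(\<Sum>z\<in>U r. (x \<bullet> z)^3 * (y \<bullet> z)^3) = card (U r) * ((6 * (x \<bullet> y)^3 + 9 * (x \<bullet> y)) / (n * (n + 2) * (n
      + 4)))"
    using U_moment[OF r, of 3 3 x y] unfolding moment_deg6 n_eq[symmetric] n1 by simp
qed

text \<open>The factor n + 6 is absorbed from \<open>zonal4\<close>; it is the sum of the two
  coefficients because the shares in \<open>H\<close> add up to 1.\<close>

definition bcoef :: "real \<Rightarrow> real" where "bcoef r = (n + 6) * (W r * r^8 / H)"

lemma bcoef_pos: "r \<in> {r1, r2} \<Longrightarrow> bcoef r > 0"
  unfolding bcoef_def using npos Wpos[of r] rpos[of r] Hpos by (intro mult_pos_pos divide_pos_pos) auto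

lemma bcoef_sum: "bcoef r1 + bcoef r2 = n + 6"
proof -
  have "bcoef r1 + bcoef r2 = (n + 6) * ((W r1 * r1^8 + W r2 * r2^8) / H)"
    unfolding bcoef_def by (simp add: distrib_left add_divide_distrib)
  then show ?thesis using Hpos unfolding H_def[symmetric] by simp
qed

lemma zonal_units:
  fixes x y :: "real^'n"
  assumes "norm x = 1" "norm y = 1"
  shows "zonal4 x y = n * (n + 6) / 24 * ((n + 4) * (n + 2) * ((x \<bullet> y)^2)^2 - 6 * (n + 2) * (x \<bullet> y)^2 + 3)"
    "zonal2 x y = n * (n + 2) / 2 * (x \<bullet> y)^2 - n / 2"
  unfolding zonal4_def zonal2_def Let_def n_eq[symmetric] assms by simp_all

lemma zonal_scale: "zonal4 (s *\<^sub>R x) (t *\<^sub>R y) = s^4 * t^4 * zonal4 x y" "zonal2 (s *\<^sub>R x) (t *\<^sub>R y)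
    = s^2 * t^2 * zonal2 x y"
  for x y :: "real^'n"
  unfolding zonal4_scale zonal2_scale zonal_commute[of "s *\<^sub>R x" y]
      by (simp_all add: zonal4_scale zonal2_scale zonal_commute[of y x])

lemma shell_U:
  assumes r: "r \<in> {r1, r2}"
  shows "shell n (bcoef r) (U r)"
  unfolding shell_def
proof (intro conjI ballI impI)
  show "spherical7 n (U r)" by (rule spherical7_U[OF r])
  have "W r > 0" by (rule Wpos[OF r])
  then show "real (card (U r)) = n * (n + 1) / 12 * (12 + bcoef r * (n - 1))"
  proof -
    define g where "g = W r * r^8 / H"
    have "2 * W r * \<kappa> r = n * (n + 6) / 12 * (n^2 - 1) * g + n * (n + 1)"
    proof -
      have e: "2 * W r * (c * (r^8 / H) + d / W r) = 2 * c * g + 2 * d" for c d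
        using \<open>W r > 0\<close> unfolding g_def by (simp add: distrib_left)
      then show ?thesis unfolding \<kappa>_def e by simp
    qed
    then show ?thesis
      unfolding card_U[OF r] card_layer[OF r] bcoef_def g_def[symmetric]
          by (simp add: field_simps power2_eq_square)
  qed
next
  fix x y assume x: "x \<in> U r" and y: "y \<in> U r" and ne: "y \<noteq> x" "y \<noteq> - x"
  have r0: "r > 0" by (rule rpos[OF r])
  have W0: "W r > 0" by (rule Wpos[OF r])
  have nx: "norm x = 1" "norm y = 1" "r *\<^sub>R x \<in> X" "r *\<^sub>R y \<in> X" using x y unfolding U_iff[OF r] by auto
  have "r *\<^sub>R y \<noteq> r *\<^sub>R x" "r *\<^sub>R y \<noteq> - (r *\<^sub>R x)" using ne r0 by (auto simp flip: scaleR_minus_right)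
  then have "K (r *\<^sub>R x) (r *\<^sub>R y) = 0" using K_zero nx by blast
  moreover have "K (r *\<^sub>R x) (r *\<^sub>R y) = r^8 * zonal4 x y / H + zonal2 x y / W r"
    using K_shell[of "r *\<^sub>R x" r "r *\<^sub>R y" r] nx(1,2) r r0 unfolding zonal_scale by (simp flip: power_add)
  ultimately have "0 = 24 / n * W r * (r^8 * zonal4 x y / H + zonal2 x y / W r)" by simp
  also have "\<dots> = bcoef r * (n + 4) * (n + 2) * ((x \<bullet> y)^2)^2 - 6 * (n + 2) * (bcoef r - 2) * (x \<bullet> y)^2
      + 3 * (bcoef r - 4)"
    unfolding zonal_units[OF nx(1,2)] bcoef_def using W0 npos Hpos by (simp add: field_simps)
  finally show "bcoef r * (n + 4) * (n + 2) * ((x \<bullet> y)^2)^2 - 6 * (n + 2) * (bcoef r - 2) * (x \<bullet> y)^2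
      + 3 * (bcoef r - 4) = 0" ..
qed

lemma cross_U:
  assumes x: "x \<in> U r1" and y: "y \<in> U r2"
  shows "(n + 4) * (n + 2) * ((x \<bullet> y)^2)^2 - 6 * (n + 2) * (x \<bullet> y)^2 + 3 = 0"
proof -
  have nx: "norm x = 1" "norm y = 1" "r1 *\<^sub>R x \<in> X" "r2 *\<^sub>R y \<in> X" using x y U_iff[of r1] U_iff[of r2] by auto
  have "K (r1 *\<^sub>R x) (r2 *\<^sub>R y) = 0" using K_cross nx r1pos r2pos by simp
  then have "zonal4 (r1 *\<^sub>R x) (r2 *\<^sub>R y) = 0"
    using K_shell[of "r1 *\<^sub>R x" r1 "r2 *\<^sub>R y" r2] nx(1,2) r1pos r2pos r12 Hpos by simp
  then have "zonal4 x y = 0" unfolding zonal_scale using r1pos r2pos by simp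
  then show ?thesis unfolding zonal_units[OF nx(1,2)] using npos by simp
qed

lemma dim_2: "CARD('n) = 2"
proof (rule ccontr)
  assume "CARD('n) \<noteq> 2"
  then have m: "3 \<le> CARD('n)" using n2 by simp
  have sh: "shell n (bcoef r1) (U r1)" "shell n (bcoef r2) (U r2)" by (simp_all add: shell_U)
  show False
  proof (cases "bcoef r2 \<le> bcoef r1")
    case True
    show False
      by (rule no_shell_pair[OF m n_eq sh bcoef_sum True cross_U])
  next
    case False
    have "bcoef r2 + bcoef r1 = n + 6" using bcoef_sum by simp
    moreover have "bcoef r1 \<le> bcoef r2" using False by simp
    moreover have "(n + 4) * (n + 2) * ((x \<bullet> y)^2)^2 - 6 * (n + 2) * (x \<bullet> y)^2 + 3 = 0"
        if "x \<in> U r2" "y \<in> U r1" for x y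
      using cross_U[OF that(2,1)] by (simp only: inner_commute)
    ultimately show False
      by (rule no_shell_pair[OF m n_eq sh(2,1)])
  qed
qed

lemma n_2: "n = 2" using dim_2 n_eq by simp

lemma cross_levels:
  assumes x: "x \<in> U r1" and y: "y \<in> U r2"
  shows "(x \<bullet> y)^2 = (2 + sqrt 2) / 4 \<or> (x \<bullet> y)^2 = (2 - sqrt 2) / 4"
proof -
  define q where "q = (x \<bullet> y)^2"
  have "24 * ((q - (2 + sqrt 2) / 4) * (q - (2 - sqrt 2) / 4)) = 24 * q^2 - 24 * q + 3"
    by (simp add: field_simps power2_eq_square)
  also have "\<dots> = 0" using cross_U[OF x y] unfolding n_2 q_def by simp
  finally show ?thesis unfolding q_def by auto
qed

text \<open>For n = 2 a layer has (12 + b) / 2 > 6 points, an even number, and both layers together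
  have 16.\<close>

lemma card_U_8: "card (U r1) = 8" "card (U r2) = 8" and bcoef_4: "bcoef r1 = 4" "bcoef r2 = 4"
proof -
  have "(0::real) < sqrt 2" "sqrt 2 < (2::real)" using real_sqrt_less_mono[of 2 4] by simp_all
  then have "(2 - sqrt 2) / 4 > 0" "(2 - sqrt 2) / 4 < (2 + sqrt 2) / 4" by simp_all
  then have lv: "(2 + sqrt 2) / 4 \<noteq> (2 - sqrt 2) / 4" "(2 + sqrt 2) / 4 \<noteq> 0" "(2 - sqrt 2) / 4 \<noteq> 0"
    by linarith+
  obtain x y where x: "x \<in> U r1" and y: "y \<in> U r2"
    using s7_nonempty[OF spherical7_U[of r1]] s7_nonempty[OF spherical7_U[of r2]] by auto
  have nx: "norm x = 1" "norm y = 1" using x y U_iff[of r1] U_iff[of r2] by auto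
  obtain v1 where v1: "card (U r1) = 2 * v1"
    by (rule two_level_count[OF spherical7_U[of r1] nx(2) _ lv]) (use cross_levels[OF _ y] in \<open>auto simp:
        inner_commute\<close>)
  obtain v2 where v2: "card (U r2) = 2 * v2"
    by (rule two_level_count[OF spherical7_U[of r2] nx(1) _ lv]) (use cross_levels[OF x] in auto)
  have c: "real (card (U r)) = (12 + bcoef r) / 2" if "r \<in> {r1, r2}" for r
    using shell_U[OF that] unfolding shell_def n_2 by simp
  have "real (2 * v1) = (12 + bcoef r1) / 2" "real (2 * v2) = (12 + bcoef r2) / 2"
    using c[of r1] c[of r2] v1 v2 by auto
  then have e: "4 * real v1 = 12 + bcoef r1" "4 * real v2 = 12 + bcoef r2" by simp_all
  then have "real v1 > 3" "real v2 > 3" "real v1 + real v2 = 8"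
    using bcoef_pos[of r1] bcoef_pos[of r2] bcoef_sum n_2 by auto
  then have "v1 = 4" "v2 = 4" by linarith+
  then show "card (U r1) = 8" "card (U r2) = 8" "bcoef r1 = 4" "bcoef r2 = 4" using v1 v2 e by auto
qed

lemma inner_levels:
  assumes x: "x \<in> U r1" and y: "y \<in> U r1"
  shows "(x \<bullet> y)^2 \<in> {0, 1/2, 1}"
proof (cases "y = x \<or> y = - x")
  case True
  have "norm x = 1" using x U_iff[of r1] by auto
  then show ?thesis using True by (auto simp: norm_eq_1)
next
  case False
  have "bcoef r1 * (n + 4) * (n + 2) * ((x \<bullet> y)^2)^2 - 6 * (n + 2) * (bcoef r1 - 2) * (x \<bullet> y)^2
      + 3 * (bcoef r1 - 4) = 0"
    using shell_U[of r1] x y False unfolding shell_def by blast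
  then have "(x \<bullet> y)^2 * ((x \<bullet> y)^2 - 1/2) = 0"
    unfolding bcoef_4 unfolding n_2 by (simp add: power2_eq_square algebra_simps)
  then show ?thesis by auto
qed

text \<open>Equal coefficients mean W r1 * r1^8 = W r2 * r2^8, and each layer spreads its total
  weight evenly over 8 points.\<close>

lemma weight_ratio: "1 / (2 * \<kappa> r2) = r1^8 / r2^8 * (1 / (2 * \<kappa> r1))"
proof -
  have "W r1 * r1^8 / H = W r2 * r2^8 / H"
  proof -
    have "bcoef r1 = bcoef r2" using bcoef_4 by simp
    then show ?thesis unfolding bcoef_def using npos by simp
  qed
  then have W: "W r1 * r1^8 = W r2 * r2^8" using Hpos by (simp only: divide_cancel_right) auto
  have "8 = 2 * W r1 * \<kappa> r1" "8 = 2 * W r2 * \<kappa> r2"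
    using card_layer[of r1] card_layer[of r2] card_U[of r1] card_U[of r2] card_U_8 by auto
  then have k: "1 / (2 * \<kappa> r1) = W r1 / 8" "1 / (2 * \<kappa> r2) = W r2 / 8"
    using \<kappa>_pos[of r1] \<kappa>_pos[of r2] by (simp_all add: field_simps)
  show ?thesis unfolding k using W r2pos by (simp add: field_simps)
qed

end

section \<open>The two octagons in coordinates\<close>

lemma vector_2_eq_iff: "p = (vector [a, b] :: real^2) \<longleftrightarrow> p $ 1 = a \<and> p $ 2 = b"
  by (auto simp: vec_eq_iff forall_2)

lemma norm_2: "norm (p :: real^2) ^ 2 = (p $ 1)^2 + (p $ 2)^2"
  unfolding power2_norm_eq_inner by (simp add: inner_vec_def sum_2 power2_eq_square)

lemma unit_vector_cases:
  fixes p :: "real^2"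
  assumes "norm p = 1" "(p $ 1)^2 = (cos t)^2"
  shows "p = vector [cos t, sin t] \<or> p = vector [cos (pi - t), sin (pi - t)] \<or>
    p = vector [cos (pi + t), sin (pi + t)] \<or> p = vector [cos (2 * pi - t), sin (2 * pi - t)]"
proof -
  have "(p $ 2)^2 = (sin t)^2" using norm_2[of p] assms sin_squared_eq[of t] by simp
  then have "p $ 2 = sin t \<or> p $ 2 = - sin t" by (simp add: power2_eq_iff)
  moreover have "p $ 1 = cos t \<or> p $ 1 = - cos t" using assms(2) by (simp add: power2_eq_iff)
  moreover have "cos (2 * pi - t) = cos t" "sin (2 * pi - t) = - sin t" by (simp_all add: cos_diff sin_diff)
  ultimately show ?thesis by (auto simp: vector_2_eq_iff)
qed

lemma Y1_memI:
  assumes "norm p = 1" "(p $ 1)^2 \<in> {0, 1/2, 1}"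
  shows "r *\<^sub>R p \<in> Y1 r"
proof -
  have mem: "r *\<^sub>R p \<in> Y1 r" if "p = vector [cos a, sin a]" "a = 2 * real k * pi / 8" "k \<le> 7" for a k
    using that unfolding Y1_def by blast
  from assms(2) consider "(p $ 1)^2 = (cos 0)^2" | "(p $ 1)^2 = (cos (pi / 4))^2" | "(p $ 1)^2
      = (cos (pi / 2))^2"
    by (auto simp: cos_45 power_divide)
  then show ?thesis
  proof cases
    case 1
    \<comment> \<open>For t = 0 the four points coincide in pairs; the last one has angle 2 pi,
      which is index 0 again.\<close>
    from unit_vector_cases[OF assms(1) this] show ?thesis
      by (elim disjE) (rule mem[where k = 0], assumption, simp, simp,
          rule mem[where k = 4], assumption, simp, simp,
          rule mem[where k = 4], assumption, simp, simp,
          rule mem[where k = 0 and a = 0], simp, simp, simp)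
  next
    case 2
    from unit_vector_cases[OF assms(1) this] show ?thesis
      by (elim disjE) (rule mem[where k = 1], assumption, simp, simp,
          rule mem[where k = 3], assumption, simp, simp,
          rule mem[where k = 5], assumption, simp, simp,
          rule mem[where k = 7], assumption, simp, simp)
  next
    case 3
    from unit_vector_cases[OF assms(1) this] show ?thesis
      by (elim disjE) (rule mem[where k = 2], assumption, simp, simp,
          rule mem[where k = 2], assumption, simp, simp,
          rule mem[where k = 6], assumption, simp, simp,
          rule mem[where k = 6], assumption, simp, simp)
  qed
qed

lemma cos_sq_pi_8: "(cos (pi / 8))^2 = (2 + sqrt 2) / 4" "(cos (3 * pi / 8))^2 = (2 - sqrt 2) / 4"
proof -
  have "cos (2 * (pi / 8)) = sqrt 2 / 2" by (simp add: cos_45)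
  then show "(cos (pi / 8))^2 = (2 + sqrt 2) / 4" unfolding cos_double_cos by (simp add: field_simps)
  have "cos (2 * (3 * pi / 8)) = cos (pi - pi / 4)" by (rule arg_cong[of _ _ cos]) simp
  also have "\<dots> = - (sqrt 2 / 2)" unfolding cos_pi_minus cos_45 ..
  finally show "(cos (3 * pi / 8))^2 = (2 - sqrt 2) / 4" unfolding cos_double_cos by (simp add: field_simps)
qed

lemma Y2_memI:
  assumes "norm p = 1" "(p $ 1)^2 = (2 + sqrt 2) / 4 \<or> (p $ 1)^2 = (2 - sqrt 2) / 4"
  shows "r *\<^sub>R p \<in> Y2 r"
proof -
  have mem: "r *\<^sub>R p \<in> Y2 r" if "p = vector [cos a, sin a]" "a = (2 * real k + 1) * pi / 8" "k \<le> 7" for a k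
    using that unfolding Y2_def by blast
  from assms(2) consider "(p $ 1)^2 = (cos (pi / 8))^2" | "(p $ 1)^2 = (cos (3 * pi / 8))^2"
    unfolding cos_sq_pi_8 by blast
  then show ?thesis
  proof cases
    case 1
    from unit_vector_cases[OF assms(1) this] show ?thesis
      by (elim disjE) (rule mem[where k = 0], assumption, simp, simp,
          rule mem[where k = 3], assumption, simp, simp,
          rule mem[where k = 4], assumption, simp, simp,
          rule mem[where k = 7], assumption, simp, simp)
  next
    case 2
    from unit_vector_cases[OF assms(1) this] show ?thesis
      by (elim disjE) (rule mem[where k = 1], assumption, simp, simp,
          rule mem[where k = 2], assumption, simp, simp,
          rule mem[where k = 5], assumption, simp, simp,
          rule mem[where k = 6], assumption, simp, simp)
  qed
qed

lemma Y_finite_card: "finite (Y1 r)" "card (Y1 r) \<le> 8" "finite (Y2 r)" "card (Y2 r) \<le> 8"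
proof -
  have 1: "Y1 r = (\<lambda>k::nat. r *\<^sub>R vector [cos (2 * real k * pi / 8), sin (2 * real k * pi / 8)]) ` {..7}"
    unfolding Y1_def by auto
  have 2: "Y2 r = (\<lambda>k::nat. r *\<^sub>R vector [cos ((2 * real k + 1) * pi / 8), sin ((2 * real k
      + 1) * pi / 8)]) ` {..7}"
    unfolding Y2_def by auto
  show "finite (Y1 r)" "finite (Y2 r)" unfolding 1 2 by auto
  show "card (Y1 r) \<le> 8" unfolding 1 by (rule order_trans[OF card_image_le]) auto
  show "card (Y2 r) \<le> 8" unfolding 2 by (rule order_trans[OF card_image_le]) auto
qed

text \<open>The first axis is sent to \<open>u\<close>, so the first coordinate of p becomes the
  inner product of \<open>u\<close> with T p.\<close>

lemma plane_isometry:
  fixes u :: "real^'n"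
  assumes "CARD('n) = 2" "norm u = 1"
  obtains T :: "real^2 \<Rightarrow> real^'n" where "linear T" "bij T" "\<And>y. norm (T y) = norm y" "T (axis 1 1) = u"
proof -
  obtain f g where f: "linear f" "f ` (UNIV :: (real^2) set) = (UNIV :: (real^'n) set)" "\<And>x. norm (f x)
      = norm x"
    and g: "\<And>x. g (f x) = x"
    by (rule isometries_subspaces[of "UNIV :: (real^2) set" "UNIV :: (real^'n) set"]) (auto simp: assms(1))
  have "norm (f (axis 1 1)) = 1" using f(3) by simp
  then obtain S where S: "orthogonal_transformation S" "S (f (axis 1 1)) = u"
    using orthogonal_transformation_exists_1[OF _ assms(2)] by blast
  have "bij f" using f(2) g by (intro bijI injI) (metis, simp)
  show thesis
  proof
    show "linear (S \<circ> f)" using f(1) orthogonal_transformation_linear[OF S(1)] by (rule linear_compose)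
    show "bij (S \<circ> f)" using \<open>bij f\<close> orthogonal_transformation_bij[OF S(1)] by (rule bij_comp)
    show "norm ((S \<circ> f) y) = norm y" for y using f(3) orthogonal_transformation_norm[OF S(1)] by simp
    show "(S \<circ> f) (axis 1 1) = u" using S(2) by simp
  qed
qed

context tight_two_shell
begin

text \<open>With a point of the first layer as first axis, the known levels are exactly conditions
  on the squared first coordinate, and these single out the vertices of the octagons. A layer of 8
  points inside the image of at most 8 vertices fills it.\<close>

lemma similar_to_octagons:
  obtains T :: "real^2 \<Rightarrow> real^'n" where "linear T" "bij T" "\<And>y. norm (T y) = norm y"
    "T ` Y1 r1 = layer X r1" "T ` Y2 r2 = layer X r2"
proof -
  obtain u where u: "u \<in> U r1" using s7_nonempty[OF spherical7_U[of r1]] by auto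
  then have "norm u = 1" using U_iff[of r1] by simp
  then obtain T :: "real^2 \<Rightarrow> real^'n" where T: "linear T" "bij T" "\<And>y. norm (T y) = norm y" "T (axis 1 1) = u"
    using plane_isometry[OF dim_2] by blast
  have inner_T: "T p \<bullet> T q = p \<bullet> q" for p q
    using T(1,3) by (simp add: dot_norm flip: linear_add)
  have layer: "T ` Y = layer X r" if r: "r \<in> {r1, r2}" and c8: "card (U r) = 8" and Y: "finite Y" "card Y \<le> 8"
    and sub: "\<And>p. norm p = 1 \<Longrightarrow> T p \<in> U r \<Longrightarrow> r *\<^sub>R p \<in> Y" for r Y
  proof -
    have "layer X r \<subseteq> T ` Y"
    proof
      fix x assume x: "x \<in> layer X r"
      have r0: "r > 0" by (rule rpos[OF r])
      obtain p where p: "x /\<^sub>R r = T p" using bij_is_surj[OF T(2)] by (metis surjD)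
      have "T p \<in> U r" using x unfolding U_def p[symmetric] by blast
      moreover from this have "norm p = 1" using U_iff[OF r] T(3) by simp
      ultimately have "r *\<^sub>R p \<in> Y" by (rule sub[rotated])
      moreover have "T (r *\<^sub>R p) = x" using T(1) r0 by (simp add: linear_scale flip: p)
      ultimately show "x \<in> T ` Y" by blast
    qed
    moreover have "card (T ` Y) \<le> card (layer X r)"
      using card_image_le[OF Y(1), of T] Y(2) c8 card_U[OF r] by simp
    ultimately show ?thesis using Y(1) by (intro card_seteq[symmetric]) auto
  qed
  have comp: "p $ 1 = u \<bullet> T p" for p
    unfolding T(4)[symmetric] inner_T by (simp add: inner_axis' )
  show thesis
  proof (rule that[OF T(1-3)])
    show "T ` Y1 r1 = layer X r1"
    proof (rule layer)
      fix p :: "real^2" assume p: "norm p = 1" "T p \<in> U r1"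
      show "r1 *\<^sub>R p \<in> Y1 r1"
        using inner_levels[OF u p(2)] by (intro Y1_memI p(1)) (simp only: comp)
    qed (use card_U_8 Y_finite_card in auto)
    show "T ` Y2 r2 = layer X r2"
    proof (rule layer)
      fix p :: "real^2" assume p: "norm p = 1" "T p \<in> U r2"
      show "r2 *\<^sub>R p \<in> Y2 r2"
        using cross_levels[OF u p(2)] by (intro Y2_memI p(1)) (simp only: comp)
    qed (use card_U_8 Y_finite_card in auto)
  qed
qed

end

theorem theorem1p1:
  fixes X :: "(real^'n) set" and w :: "real^'n \<Rightarrow> real" and r1 r2 :: real
  assumes n2: "CARD('n) \<ge> 2"
    and design: "euclidean_design 9 X w"
    and radii: "norm ` X = {r1, r2}" and r1pos: "0 < r1" and r2pos: "0 < r2" and r12: "r1 \<noteq> r2"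
    and tight: "12 * card X = CARD('n) * (CARD('n) + 1) * (CARD('n)^2 + 5 * CARD('n) + 18)"
  shows "uminus ` X = X
    \<and> (\<forall>x\<in>X. \<forall>y\<in>X. norm x = r1 \<longrightarrow> norm y = r2 \<longrightarrow>
          gegenbauer4 CARD('n) ((x \<bullet> y) / (r1 * r2)) = 0)
    \<and> CARD('n) = 2
    \<and> (\<exists>T :: real^2 \<Rightarrow> real^'n. linear T \<and> bij T \<and> (\<forall>y. norm (T y) = norm y) \<and>
         T ` (Y1 r1 \<union> Y2 r2) = X \<and>
         (\<exists>w1 > 0. (\<forall>y\<in>Y1 r1. w (T y) = w1) \<and> (\<forall>y\<in>Y2 r2. w (T y) = r1^8 / r2^8 * w1)))"
proof -
  interpret tight_two_shell X w r1 r2 "real CARD('n)"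
    using assms by unfold_locales auto
  have anti: "uminus ` X = X"
  proof
    show "uminus ` X \<subseteq> X" using antipodal_weight(1) by auto
    show "X \<subseteq> uminus ` X" using antipodal_weight(1) by (metis (no_types, lifting) image_eqI minus_minus subsetI)
  qed
  have geg: "gegenbauer4 CARD('n) ((x \<bullet> y) / (r1 * r2)) = 0" if x: "x \<in> X" "norm x = r1" and y: "y \<in> X" "norm y = r2" for x y
  proof -
    have "x /\<^sub>R r1 \<in> U r1" "y /\<^sub>R r2 \<in> U r2" using x y unfolding U_def layer_def by auto
    then have "(real CARD('n) + 4) * (real CARD('n) + 2) * (((x /\<^sub>R r1) \<bullet> (y /\<^sub>R r2))^2)^2 - 6 * (real CARD('n) + 2) * ((x /\<^sub>R r1) \<bullet> (y /\<^sub>R r2))^2 + 3 = 0"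
      by (rule cross_U)
    moreover have "(x /\<^sub>R r1) \<bullet> (y /\<^sub>R r2) = (x \<bullet> y) / (r1 * r2)" by (simp add: divide_inverse)
    ultimately show ?thesis unfolding gegenbauer4_def by (simp flip: power_mult)
  qed
  obtain T :: "real^2 \<Rightarrow> real^'n" where T: "linear T" "bij T" "\<And>y. norm (T y) = norm y"
    "T ` Y1 r1 = layer X r1" "T ` Y2 r2 = layer X r2" by (rule similar_to_octagons) blast
  have "T ` (Y1 r1 \<union> Y2 r2) = X"
    unfolding image_Un T(4,5) using norm_cases unfolding layer_def by auto
  moreover have "1 / (2 * \<kappa> r1) > 0" using \<kappa>_pos[of r1] by simp
  moreover have "w (T y) = 1 / (2 * \<kappa> r1)" if "y \<in> Y1 r1" for y
    using weight_layer T(4) that by blast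
  moreover have "w (T y) = r1^8 / r2^8 * (1 / (2 * \<kappa> r1))" if "y \<in> Y2 r2" for y
    unfolding weight_ratio[symmetric] using weight_layer T(5) that by blast
  ultimately show ?thesis using anti geg dim_2 T(1-3) by blast
qed

end
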